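(* Let $k\ge 1$ be an integer, let $p\ge 1$, and let $\alpha_0,\dots,\alpha_k\in\mathbb R$ satisfy $\alpha_j\ge \alpha_k-(k-j)p$ for all $j=0,\dots,k-1$. Let $\theta\in\mathbb R$ satisfy $\alpha_k-kp\le\theta\le\alpha_0$. Write $X^{k,p}_\infty=X^{k,p}_\infty(\alpha_0,\dots,\alpha_k)$ and $L^q_\theta=L^q_\theta(0,\infty)$. (a) (Sobolev embedding) Suppose $\alpha_k-kp+1>0$ and set $p^*:=\dfrac{(\theta+1)p}{\alpha_k-kp+1}$. Then there is a continuous embedding $X^{k,p}_\infty\hookrightarrow L^q_\theta$ for every $q$ with $p\le q\le p^*$. Moreover, this embedding is compact if one of the following two conditions is fulfilled: (i) $\theta=\alpha_0$ and $p<q<p^*$; (ii) $\theta<\alpha_0$ and $p\le q<p^*$. (b) (Limiting Sobolev embedding) Suppose $\alpha_k-kp+1=0$. Then there is a continuous embedding $X^{k,p}_\infty\hookrightarrow L^q_\theta$ for every $q$ with $p\le q<\infty$. Moreover, this embedding is compact if one of the following two conditions is fulfilled: (i) $\theta=\alpha_0$, $q>p>1$ and $\alpha_0>-1$; (ii) $\theta<\alpha_0$ and $q\ge p\ge 1$.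
   Context: For $q\ge1$ and $\theta\in\mathbb R$, $L^q_\theta=L^q_\theta(0,\infty)$ is the space of measurable $u:(0,\infty)\to\mathbb R$ with $\|u\|_{L^q_\theta}=\left(\int_0^\infty|u|^q r^\theta\,dr\right)^{1/q}<\infty$. For $k\ge1$, $p\ge1$ and real $\alpha_0,\dots,\alpha_k$, $X^{k,p}_\infty(\alpha_0,\dots,\alpha_k)$ is the space of functions $u:(0,\infty)\to\mathbb R$ whose weak derivatives satisfy $u^{(j)}\in L^p_{\alpha_j}(0,\infty)$ for $j=0,1,\dots,k$, a Banach space with norm $\|u\|_{X^{k,p}_\infty}=\left(\sum_{j=0}^k\|u^{(j)}\|^p_{L^p_{\alpha_j}}\right)^{1/p}$.
   Formalization: In part (b) the case θ = −1 < α_0 is excluded: there the claim is false for every q, since a smooth function equal to 1 near 0 and 0 for large r lies in X but |u|^q/r is not integrable at 0. *)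

theory Defs
  imports "HOL-Analysis.Analysis"
begin

text \<open>
  All spaces consist of functions \<^typ>\<open>real \<Rightarrow> real\<close> of which only the restriction to the half line
  \<open>(0,\<infinity>)\<close> is relevant.  Functions that agree almost everywhere on \<open>(0,\<infinity>)\<close> are not
  identified, so the norms below are seminorms whose null functions are those that vanish
  almost everywhere there.
\<close>

definition Lw :: "real \<Rightarrow> real \<Rightarrow> (real \<Rightarrow> real) set" where
  "Lw q \<theta> = {u. u \<in> borel_measurable (lebesgue_on {0<..}) \<and>
                  set_integrable lebesgue {0<..} (\<lambda>r. \<bar>u r\<bar> powr q * r powr \<theta>)}"

definition Lw_norm :: "real \<Rightarrow> real \<Rightarrow> (real \<Rightarrow> real) \<Rightarrow> real" where
  "Lw_norm q \<theta> u = (LINT r:{0<..}|lebesgue. \<bar>u r\<bar> powr q * r powr \<theta>) powr (1 / q)"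

definition locally_integrable :: "(real \<Rightarrow> real) \<Rightarrow> bool" where
  "locally_integrable u \<longleftrightarrow> (\<forall>K. compact K \<and> K \<subseteq> {0<..} \<longrightarrow> set_integrable lebesgue K u)"

text \<open>The space \<open>C\<^sub>c\<^sup>\<infinity>(0,\<infinity>)\<close>, its elements being extended by zero to the real line.\<close>

definition test_functions :: "(real \<Rightarrow> real) set" where
  "test_functions = {\<phi>. (\<forall>n x. (deriv ^^ n) \<phi> differentiable at x) \<and>
                         compact (closure {x. \<phi> x \<noteq> 0}) \<and> closure {x. \<phi> x \<noteq> 0} \<subseteq> {0<..}}"

definition has_weak_deriv :: "nat \<Rightarrow> (real \<Rightarrow> real) \<Rightarrow> (real \<Rightarrow> real) \<Rightarrow> bool" where
  "has_weak_deriv j u v \<longleftrightarrow> locally_integrable u \<and> locally_integrable v \<and>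
     (\<forall>\<phi>\<in>test_functions.
        (LINT r:{0<..}|lebesgue. u r * (deriv ^^ j) \<phi> r) =
        (-1) ^ j * (LINT r:{0<..}|lebesgue. v r * \<phi> r))"

text \<open>
  A weak derivative is unique only up to null sets, hence the choice operator; the norm
  \<open>X_norm\<close> below does not depend on the representative.
\<close>

definition weak_deriv :: "nat \<Rightarrow> (real \<Rightarrow> real) \<Rightarrow> real \<Rightarrow> real" where
  "weak_deriv j u = (SOME v. has_weak_deriv j u v)"

definition X_space :: "nat \<Rightarrow> real \<Rightarrow> (nat \<Rightarrow> real) \<Rightarrow> (real \<Rightarrow> real) set" where
  "X_space k p \<alpha> = {u. \<forall>j\<le>k. \<exists>v. has_weak_deriv j u v \<and> v \<in> Lw p (\<alpha> j)}"

definition X_norm :: "nat \<Rightarrow> real \<Rightarrow> (nat \<Rightarrow> real) \<Rightarrow> (real \<Rightarrow> real) \<Rightarrow> real" where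
  "X_norm k p \<alpha> u = (\<Sum>j\<le>k. Lw_norm p (\<alpha> j) (weak_deriv j u) powr p) powr (1 / p)"

text \<open>
  The embeddings are inclusions, so each is given by two function spaces with their norms.
\<close>

definition continuous_embedding ::
  "(real \<Rightarrow> real) set \<Rightarrow> ((real \<Rightarrow> real) \<Rightarrow> real) \<Rightarrow>
   (real \<Rightarrow> real) set \<Rightarrow> ((real \<Rightarrow> real) \<Rightarrow> real) \<Rightarrow> bool" where
  "continuous_embedding A normA B normB \<longleftrightarrow>
     A \<subseteq> B \<and> (\<exists>C. \<forall>u\<in>A. normB u \<le> C * normA u)"

definition compact_embedding ::
  "(real \<Rightarrow> real) set \<Rightarrow> ((real \<Rightarrow> real) \<Rightarrow> real) \<Rightarrow>
   (real \<Rightarrow> real) set \<Rightarrow> ((real \<Rightarrow> real) \<Rightarrow> real) \<Rightarrow> bool" where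
  "compact_embedding A normA B normB \<longleftrightarrow>
     continuous_embedding A normA B normB \<and>
     (\<forall>u :: nat \<Rightarrow> real \<Rightarrow> real. (\<forall>n. u n \<in> A) \<and> (\<exists>M. \<forall>n. normA (u n) \<le> M) \<longrightarrow>
        (\<exists>v\<in>B. \<exists>\<sigma>. strict_mono \<sigma> \<and> (\<lambda>n. normB (\<lambda>r. u (\<sigma> n) r - v r)) \<longlonglongrightarrow> 0))"

end

theory Submission
  imports Defs "HOL-Probability.Helly_Selection"
begin

text \<open>
  Put \<open>b = \<alpha>\<^sub>k - k p\<close>.  Hardy's inequality near \<open>0\<close>, applied successively to the derivatives of order
  \<open>k - 1, \<dots>, 1\<close>, shows that \<open>u'\<close> has finite norm with weight exponent \<open>b + p\<close>, so that everything reduces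
  to \<open>k = 1\<close>.  Estimating \<open>u\<close> by its mean and the integral of \<open>|u'|\<close> over intervals comparable to \<open>r\<close>
  gives pointwise power bounds for \<open>|u(r)|\<close>, and the embeddings follow from
  \<open>|u|\<^sup>q = |u|\<^bsup>q - p\<^esup> |u|\<^sup>p\<close>.  For compactness, Helly's selection theorem, applied to the increasing
  functions \<open>F(r) = \<integral>\<^sub>1\<^sup>r |u'|\<close> and \<open>F + u\<close>, yields a subsequence converging almost everywhere; the
  pointwise bounds dominate it on bounded intervals and make the tails at infinity uniformly small.
  In part (b) Hardy's inequality is used with an exponent slightly above the critical \<open>-1\<close>.
\<close>

subsection \<open>Estimates for primitives\<close>

text \<open>Hardy's inequality needs an exponent above \<open>-1\<close>. Down to order 1 the
  exponents stay at least \<open>b + p \<ge> 0\<close>, but for \<open>u\<close> itself the natural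
  exponent \<open>b\<close> is critical in part (b). The estimates near 0 therefore carry a separate
  exponent \<open>c\<close>: it is \<open>b\<close> in part (a), some value above \<open>-1\<close>
  in part (b), and \<open>\<alpha> 0\<close>, where the norm itself gives the bound, if
  \<open>\<theta> = \<alpha> 0 = -1\<close>. The condition on \<open>q\<close> is always
  \<open>(c + 1) * q \<le> (\<theta> + 1) * p\<close>; its strict form makes the dominating power
  integrable at 0. At infinity the length \<open>r powr \<tau>\<close> of the averaging interval is
  free. The scale-invariant choice \<open>\<tau> = 1\<close> bounds \<open>|u| powr p\<close> by a
  multiple of \<open>r powr (- (b + 1))\<close>, which is no decay in part (b). For
  \<open>p > 1\<close> and \<open>\<alpha> 0 > -1\<close> a suitable \<open>\<tau> < 1\<close> still
  gives decay; this is how condition (i) of part (b) enters. Helly's theorem is used because for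
  \<open>p = 1\<close> local bounds on the integral of \<open>|u'|\<close> give bounded variation
  but no equicontinuity.\<close>

lemma powr_add_le:
  fixes a b p :: real
  assumes "a \<ge> 0" "b \<ge> 0" "p \<ge> 0"
  shows "(a + b) powr p \<le> 2 powr p * (a powr p + b powr p)"
proof -
  have "(a + b) powr p \<le> (2 * max a b) powr p"
    using assms by (intro powr_mono2) auto
  also have "\<dots> = 2 powr p * (max a b) powr p"
    using assms by (simp add: powr_mult)
  also have "(max a b) powr p \<le> a powr p + b powr p"
    by (auto simp: max_def)
  finally show ?thesis by simp
qed

text \<open>Optimising \<open>t \<le> l + l powr (1 - p) * t powr p\<close> in \<open>l\<close> gives Jensen's inequality up to the factor 2.\<close>

lemma nn_integral_Jensen_factor_2:
  fixes f \<phi> :: "'a \<Rightarrow> real" and m A p :: real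
  assumes [measurable]: "f \<in> borel_measurable M" "\<phi> \<in> borel_measurable M"
    and f: "\<And>x. f x \<ge> 0" and \<phi>: "\<And>x. \<phi> x \<ge> 0" and p: "p \<ge> 1" and m: "m > 0" and A: "A \<ge> 0"
    and int_\<phi>: "(\<integral>\<^sup>+x. ennreal (\<phi> x) \<partial>M) \<le> ennreal m"
    and int_f: "(\<integral>\<^sup>+x. ennreal (\<phi> x * f x powr p) \<partial>M) \<le> ennreal A"
  shows "(\<integral>\<^sup>+x. ennreal (\<phi> x * f x) \<partial>M) \<le> ennreal (2 * m powr (1 - 1 / p) * A powr (1 / p))"
\<comment> \<open>For \<open>A = 0\<close> the balancing value \<open>l\<close> chosen below would
  be 0, so the integrand is shown to vanish almost everywhere instead.\<close>
proof (cases "A = 0")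
  case True
  then have "(\<integral>\<^sup>+x. ennreal (\<phi> x * f x powr p) \<partial>M) = 0" using int_f by simp
  then have "AE x in M. ennreal (\<phi> x * f x powr p) = 0"
    by (subst (asm) nn_integral_0_iff_AE) auto
  then have "AE x in M. ennreal (\<phi> x * f x) = 0"
  proof eventually_elim
    case (elim x)
    then have "\<phi> x * f x powr p = 0" using \<phi>[of x] by (metis ennreal_eq_0_iff mult_nonneg_nonneg powr_ge_zero order_antisym)
    then show ?case by auto
  qed
  then have "(\<integral>\<^sup>+x. ennreal (\<phi> x * f x) \<partial>M) = 0"
    by (subst nn_integral_0_iff_AE) auto
  then show ?thesis by simp
next
  case False
  with A have A: "A > 0" by simp
  \<comment> \<open>At this \<open>l\<close> the two terms \<open>l * m\<close> and
    \<open>l powr (1 - p) * A\<close> coincide: both equal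
    \<open>m powr (1 - 1 / p) * A powr (1 / p)\<close>, hence the factor 2.\<close>
  define l where "l = (A / m) powr (1 / p)"
  have l: "l > 0" using A m by (simp add: l_def)
  have le: "t \<le> l + l powr (1 - p) * t powr p" if "t \<ge> 0" for t
  proof (cases "t \<le> l")
    case True
    then show ?thesis using l by (smt (verit) mult_nonneg_nonneg powr_ge_zero)
  next
    case False
    then have t: "t > 0" using l by simp
    have "t = t powr (1 - p) * t powr p" using t by (simp flip: powr_add)
    also have "\<dots> \<le> l powr (1 - p) * t powr p"
      using False l p by (intro mult_right_mono powr_mono2') auto
    finally show ?thesis using l by simp
  qed
  have "(\<integral>\<^sup>+x. ennreal (\<phi> x * f x) \<partial>M)
      \<le> (\<integral>\<^sup>+x. ennreal l * ennreal (\<phi> x) + ennreal (l powr (1 - p)) * ennreal (\<phi> x * f x powr p) \<partial>M)"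
  proof (rule nn_integral_mono)
    fix x
    have "\<phi> x * f x \<le> \<phi> x * (l + l powr (1 - p) * f x powr p)"
      using le[OF f] \<phi> by (intro mult_left_mono) auto
    also have "\<dots> = l * \<phi> x + l powr (1 - p) * (\<phi> x * f x powr p)" by (simp add: algebra_simps)
    finally show "ennreal (\<phi> x * f x) \<le> ennreal l * ennreal (\<phi> x) + ennreal (l powr (1 - p)) * ennreal (\<phi> x * f x powr p)"
      using l \<phi>[of x] by (simp add: ennreal_leI flip: ennreal_mult ennreal_plus)
  qed
  also have "\<dots> = ennreal l * (\<integral>\<^sup>+x. ennreal (\<phi> x) \<partial>M) + ennreal (l powr (1 - p)) * (\<integral>\<^sup>+x. ennreal (\<phi> x * f x powr p) \<partial>M)"
    by (simp add: nn_integral_add nn_integral_cmult)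
  also have "\<dots> \<le> ennreal l * ennreal m + ennreal (l powr (1 - p)) * ennreal A"
    using int_\<phi> int_f by (intro add_mono mult_left_mono) auto
  also have "\<dots> = ennreal (l * m + l powr (1 - p) * A)"
    using l m A by (simp flip: ennreal_mult ennreal_plus)
  also have "l * m = m powr (1 - 1 / p) * A powr (1 / p)"
    unfolding l_def using m A by (simp add: powr_divide powr_diff)
  also have "l powr (1 - p) * A = m powr (1 - 1 / p) * A powr (1 / p)"
  proof -
    have "l powr (1 - p) = (A / m) powr (1 / p - 1)"
      using p by (simp add: l_def powr_powr field_simps)
    also have "\<dots> = A powr (1 / p - 1) * m powr (1 - 1 / p)"
      using m A by (simp add: powr_divide powr_diff)
    finally show ?thesis using A by (simp add: powr_diff)
  qed
  finally show ?thesis by (simp add: mult.assoc mult.left_commute mult.commute)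
qed

text \<open>The \<open>p\<close>-th power of the weighted norm over \<open>S\<close>. Leaving out
  the root makes it additive in \<open>S\<close>, and values in \<open>ennreal\<close> admit
  infinite integrals without integrability side conditions, so that finiteness becomes a
  conclusion.\<close>

definition wint :: "real \<Rightarrow> real \<Rightarrow> real set \<Rightarrow> (real \<Rightarrow> real) \<Rightarrow> ennreal" where
  "wint p a S g = (\<integral>\<^sup>+r\<in>S. ennreal (\<bar>g r\<bar> powr p * r powr a) \<partial>lborel)"

text \<open>Local absolute continuity on \<open>(0,\<infinity>)\<close> with derivative
  \<open>w\<close>, stated through the integral formula. Borel measurability on the whole line lets
  both functions enter integrals with respect to \<open>lborel\<close>.\<close>

definition primitive :: "(real \<Rightarrow> real) \<Rightarrow> (real \<Rightarrow> real) \<Rightarrow> bool" where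
  "primitive g w \<longleftrightarrow> g \<in> borel_measurable borel \<and> w \<in> borel_measurable borel \<and>
     (\<forall>x y. 0 < x \<and> x \<le> y \<longrightarrow> set_integrable lborel {x..y} w \<and>
        g y - g x = (LINT r:{x..y}|lborel. w r))"

lemma primitive_diff_le:
  assumes "primitive g w" "0 < x" "s \<in> {x..y}" "t \<in> {x..y}"
    and I: "(\<integral>\<^sup>+r\<in>{x..y}. ennreal \<bar>w r\<bar> \<partial>lborel) \<le> ennreal I" "I \<ge> 0"
  shows "\<bar>g t\<bar> \<le> \<bar>g s\<bar> + I"
proof -
  have *: "\<bar>g d - g c\<bar> \<le> I" if "x \<le> c" "c \<le> d" "d \<le> y" for c d
  proof -
    have int: "set_integrable lborel {c..d} w" and eq: "g d - g c = (LINT r:{c..d}|lborel. w r)"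
      using assms that unfolding primitive_def by auto
    have "ennreal \<bar>g d - g c\<bar> \<le> (\<integral>\<^sup>+r. ennreal (norm (indicator {c..d} r *\<^sub>R w r)) \<partial>lborel)"
      unfolding eq set_lebesgue_integral_def real_norm_def[symmetric]
      by (rule integral_norm_bound_ennreal) (use int in \<open>simp add: set_integrable_def\<close>)
    also have "\<dots> \<le> (\<integral>\<^sup>+r\<in>{x..y}. ennreal \<bar>w r\<bar> \<partial>lborel)"
      using that by (intro nn_integral_mono) (auto split: split_indicator)
    also note I(1)
    finally show ?thesis using I(2) by simp
  qed
  from *[of s t] *[of t s] assms show ?thesis by (cases "s \<le> t") auto
qed

lemma primitive_measurable:
  assumes "primitive g w"
  shows "g \<in> borel_measurable borel" "w \<in> borel_measurable borel"
  using assms by (auto simp: primitive_def)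

text \<open>The inequality \<open>|g t| \<le> |g s| + I\<close>, raised to the power
  \<open>p\<close>, is averaged over all \<open>s\<close> in the interval. A larger \<open>h\<close>
  improves the mean \<open>B / h\<close> and, for \<open>p > 1\<close>, worsens the oscillation term
  \<open>h powr (p - 1) * A\<close>; later estimates choose \<open>h\<close> accordingly.\<close>

lemma primitive_local_bound:
  fixes p A B h x t :: real
  assumes gw: "primitive g w" and p: "p \<ge> 1" and x: "0 < x" and h: "0 < h" and t: "t \<in> {x..x + h}"
    and B: "wint p 0 {x..x + h} g \<le> ennreal B" "B \<ge> 0"
    and A: "wint p 0 {x..x + h} w \<le> ennreal A" "A \<ge> 0"
  shows "\<bar>g t\<bar> powr p \<le> 4 powr p * (B / h + h powr (p - 1) * A)"
proof -
  note [measurable] = primitive_measurable[OF gw]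
  \<comment> \<open>The bound for the integral of \<open>|w|\<close> from the Jensen-type inequality
    with weight 1 on an interval of length \<open>h\<close>.\<close>
  define I where "I = 2 * h powr (1 - 1 / p) * A powr (1 / p)"
  have I0: "I \<ge> 0" using A by (simp add: I_def)
  have I: "(\<integral>\<^sup>+r\<in>{x..x + h}. ennreal \<bar>w r\<bar> \<partial>lborel) \<le> ennreal I"
  proof -
    have "(\<integral>\<^sup>+r. ennreal (indicator {x..x + h} r * \<bar>w r\<bar>) \<partial>lborel) \<le> ennreal I"
      unfolding I_def
    proof (rule nn_integral_Jensen_factor_2)
      show "(\<integral>\<^sup>+r. ennreal (indicator {x..x + h} r) \<partial>lborel) \<le> ennreal h"
        using h by (simp add: ennreal_indicator)
      have "(\<integral>\<^sup>+r. ennreal (indicator {x..x + h} r * \<bar>w r\<bar> powr p) \<partial>lborel) = wint p 0 {x..x + h} w"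
        unfolding wint_def using x by (intro nn_integral_cong) (auto split: split_indicator)
      then show "(\<integral>\<^sup>+r. ennreal (indicator {x..x + h} r * \<bar>w r\<bar> powr p) \<partial>lborel) \<le> ennreal A"
        using A by simp
    qed (use p h A in auto)
    also have "(\<integral>\<^sup>+r. ennreal (indicator {x..x + h} r * \<bar>w r\<bar>) \<partial>lborel) = (\<integral>\<^sup>+r\<in>{x..x + h}. ennreal \<bar>w r\<bar> \<partial>lborel)"
      by (intro nn_integral_cong) (auto split: split_indicator)
    finally show ?thesis .
  qed
  have Ip: "I powr p = 2 powr p * h powr (p - 1) * A"
  proof -
    have "(1 - 1 / p) * p = p - 1" using p by (simp add: field_simps)
    then show ?thesis using p h A by (simp add: I_def powr_mult powr_powr)
  qed
  have "ennreal (h * \<bar>g t\<bar> powr p) = (\<integral>\<^sup>+s\<in>{x..x + h}. ennreal (\<bar>g t\<bar> powr p) \<partial>lborel)"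
    using h by (simp add: nn_integral_cmult_indicator ennreal_mult' mult.commute)
  also have "\<dots> \<le> (\<integral>\<^sup>+s. ennreal (2 powr p) * (ennreal (\<bar>g s\<bar> powr p * s powr 0) * indicator {x..x + h} s) +
        ennreal (2 powr p * I powr p) * indicator {x..x + h} s \<partial>lborel)"
  proof (rule nn_integral_mono)
    fix s
    have "\<bar>g t\<bar> powr p \<le> 2 powr p * (\<bar>g s\<bar> powr p) + 2 powr p * I powr p" if s: "s \<in> {x..x + h}"
    proof -
      have "\<bar>g t\<bar> powr p \<le> (\<bar>g s\<bar> + I) powr p"
        using primitive_diff_le[OF gw x s t I I0] p by (intro powr_mono2) auto
      also have "\<dots> \<le> 2 powr p * (\<bar>g s\<bar> powr p + I powr p)"
        using p I0 by (intro powr_add_le) auto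
      finally show ?thesis by (simp add: algebra_simps)
    qed
    then show "ennreal (\<bar>g t\<bar> powr p) * indicator {x..x + h} s \<le> ennreal (2 powr p) * (ennreal (\<bar>g s\<bar> powr p * s powr 0) * indicator {x..x + h} s) +
        ennreal (2 powr p * I powr p) * indicator {x..x + h} s"
      using x by (auto split: split_indicator simp: ennreal_leI simp flip: ennreal_mult ennreal_plus)
  qed
  also have "\<dots> = ennreal (2 powr p) * wint p 0 {x..x + h} g + ennreal (2 powr p * I powr p) * ennreal h"
    unfolding wint_def using h by (subst nn_integral_add) (auto simp: nn_integral_cmult)
  also have "\<dots> \<le> ennreal (2 powr p) * ennreal B + ennreal (2 powr p * I powr p) * ennreal h"
    using B by (intro add_mono mult_left_mono) auto
  also have "\<dots> = ennreal (2 powr p * B + 2 powr p * I powr p * h)"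
    using h B by (simp flip: ennreal_mult ennreal_plus)
  finally have "h * \<bar>g t\<bar> powr p \<le> 2 powr p * B + 2 powr p * I powr p * h"
    using h B by (subst (asm) ennreal_le_iff) auto
  also have "\<dots> \<le> 4 powr p * B + 4 powr p * (h powr (p - 1) * A) * h"
  proof -
    have "(2::real) powr p \<le> 4 powr p" using p by (intro powr_mono2) auto
    moreover have "(2::real) powr p * 2 powr p = 4 powr p" by (simp flip: powr_mult)
    ultimately show ?thesis using B h by (intro add_mono mult_right_mono) (auto simp: Ip mult.assoc[symmetric])
  qed
  finally show ?thesis using h by (simp add: field_simps)
qed

lemma wint_mono:
  assumes "S \<subseteq> T" "\<And>r. r \<in> S \<Longrightarrow> r powr a \<le> c * r powr b" "c \<ge> 0"
    and [measurable]: "g \<in> borel_measurable borel" "T \<in> sets borel"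
  shows "wint p a S g \<le> ennreal c * wint p b T g"
proof -
  have "wint p a S g \<le> (\<integral>\<^sup>+r. ennreal c * (ennreal (\<bar>g r\<bar> powr p * r powr b) * indicator T r) \<partial>lborel)"
    unfolding wint_def
  proof (rule nn_integral_mono)
    fix r
    have "\<bar>g r\<bar> powr p * r powr a \<le> c * (\<bar>g r\<bar> powr p * r powr b)" if "r \<in> S"
      using mult_left_mono[OF assms(2)[OF that], of "\<bar>g r\<bar> powr p"] by (simp add: algebra_simps)
    then show "ennreal (\<bar>g r\<bar> powr p * r powr a) * indicator S r \<le> ennreal c * (ennreal (\<bar>g r\<bar> powr p * r powr b) * indicator T r)"
      using assms(1,3) by (auto split: split_indicator simp flip: ennreal_mult intro!: ennreal_leI)
  qed
  also have "\<dots> = ennreal c * wint p b T g"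
    unfolding wint_def by (rule nn_integral_cmult) auto
  finally show ?thesis .
qed

section \<open>Integrals of powers and Hardy's inequality near 0\<close>

lemma nn_integral_powr_from_0:
  assumes "a > -1" "c \<ge> 0"
  shows "(\<integral>\<^sup>+r\<in>{0<..c}. ennreal (r powr a) \<partial>lborel) = ennreal (c powr (a + 1) / (a + 1))"
proof -
  have "(\<integral>\<^sup>+r\<in>{0..c}. ennreal (r powr a) \<partial>lborel) = ennreal (c powr (a + 1) / (a + 1))"
    by (rule nn_integral_has_integral_lebesgue'[OF _ has_integral_powr_from_0]) (use assms in auto)
  also have "(\<integral>\<^sup>+r\<in>{0..c}. ennreal (r powr a) \<partial>lborel) = (\<integral>\<^sup>+r\<in>{0<..c}. ennreal (r powr a) \<partial>lborel)"
    by (intro nn_integral_cong) (auto split: split_indicator)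
  finally show ?thesis .
qed

lemma nn_integral_powr_to_inf:
  assumes "e < -1" "c > 0"
  shows "(\<integral>\<^sup>+r\<in>{c..}. ennreal (r powr e) \<partial>lborel) = ennreal (- (c powr (e + 1)) / (e + 1))"
  by (rule nn_integral_has_integral_lebesgue'[OF _ has_integral_powr_to_inf]) (use assms in auto)

text \<open>
  The integral of \<open>|w|\<close> over \<open>[r, 1]\<close> is estimated by the Jensen-type inequality for the weight \<open>s powr (-1 - e)\<close>,
  whose integral over \<open>[r, \<infinity>)\<close> is \<open>r powr (-e) / e\<close>; the choice \<open>e = (a + 1) / p\<close> makes the remaining
  power \<open>r powr (e - 1)\<close> integrable at \<open>0\<close> in Tonelli's theorem.
\<close>

lemma Hardy_near_0:
  fixes p a A :: real
  assumes p: "p \<ge> 1" and a: "a > -1"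
  shows "\<exists>C\<ge>0. \<forall>g w A. primitive g w \<longrightarrow> A \<ge> 0 \<longrightarrow> wint p (a + p) {0<..1} w \<le> ennreal A \<longrightarrow>
    wint p a {0<..1} g \<le> ennreal (C * (\<bar>g 1\<bar> powr p + A))"
proof -
  define e where "e = (a + 1) / p"
  have e: "e > 0" using p a by (simp add: e_def)
  \<comment> \<open>\<open>1 / (a + 1)\<close> is the integral of \<open>r powr a\<close> over
    \<open>(0,1]\<close>, \<open>e powr (1 - p)\<close> comes from \<open>m powr (p - 1)\<close>
    below, and \<open>1 / e\<close> from the inner integral of \<open>r powr (e - 1)\<close> after
    the order of integration is exchanged.\<close>
  define C where "C = 2 powr p / (a + 1) + 4 powr p * e powr (1 - p) / e"
  have C: "C \<ge> 0" using a e by (simp add: C_def)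
  show ?thesis
  proof (intro exI[of _ C] conjI C allI impI)
    fix g w :: "real \<Rightarrow> real" and A :: real
    assume gw: "primitive g w" and A: "A \<ge> 0" and wA: "wint p (a + p) {0<..1} w \<le> ennreal A"
    note [measurable] = primitive_measurable[OF gw]
    \<comment> \<open>The exponent that results when \<open>s powr (- 1 - e)\<close> is multiplied
      by the \<open>p\<close>-th power of \<open>s powr (1 + e)\<close>.\<close>
    let ?c = "(1 + e) * (p - 1)"
    define J where "J r = wint p ?c {r..1} w" for r
    have Jr: "ennreal (\<bar>g r\<bar> powr p) \<le> ennreal (2 powr p * \<bar>g 1\<bar> powr p) +
        ennreal (4 powr p * e powr (1 - p) * r powr (e * (1 - p))) * J r" if r: "r \<in> {0<..1}" for r
    proof (cases "J r = \<infinity>")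
      case True
      then show ?thesis using r e by (simp add: ennreal_mult_top)
    next
      case False
      then obtain B where B: "B \<ge> 0" "J r = ennreal B" by (cases "J r") auto
      define m where "m = r powr (- e) / e"
      have m: "m > 0" using r e by (simp add: m_def)
      define I where "I = 2 * m powr (1 - 1 / p) * B powr (1 / p)"
      have I0: "I \<ge> 0" using B by (simp add: I_def)
      have "(\<integral>\<^sup>+s\<in>{r..1}. ennreal \<bar>w s\<bar> \<partial>lborel) \<le>
            (\<integral>\<^sup>+s. ennreal ((indicator {r..1} s * s powr (- 1 - e)) * (\<bar>w s\<bar> * \<bar>s\<bar> powr (1 + e))) \<partial>lborel)"
      proof (intro nn_integral_mono)
        fix s :: real
        have "s powr (- 1 - e) * \<bar>s\<bar> powr (1 + e) = 1" if "s \<ge> r"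
          using that r by (simp flip: powr_add)
        then show "ennreal \<bar>w s\<bar> * indicator {r..1} s \<le> ennreal ((indicator {r..1} s * s powr (- 1 - e)) * (\<bar>w s\<bar> * \<bar>s\<bar> powr (1 + e)))"
          by (auto split: split_indicator simp: mult.left_commute[of _ "\<bar>w s\<bar>"])
      qed
      also have "\<dots> \<le> ennreal I"
        unfolding I_def
      proof (rule nn_integral_Jensen_factor_2)
        have "(\<integral>\<^sup>+s. ennreal (indicator {r..1} s * s powr (- 1 - e)) \<partial>lborel) \<le> (\<integral>\<^sup>+s\<in>{r..}. ennreal (s powr (- 1 - e)) \<partial>lborel)"
          by (intro nn_integral_mono) (auto split: split_indicator)
        also have "\<dots> = ennreal m"
          using r e by (subst nn_integral_powr_to_inf) (auto simp: m_def)
        finally show "(\<integral>\<^sup>+s. ennreal (indicator {r..1} s * s powr (- 1 - e)) \<partial>lborel) \<le> ennreal m" .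
        have "(\<integral>\<^sup>+s. ennreal ((indicator {r..1} s * s powr (- 1 - e)) * (\<bar>w s\<bar> * \<bar>s\<bar> powr (1 + e)) powr p) \<partial>lborel) = J r"
          unfolding J_def wint_def
        proof (intro nn_integral_cong)
          fix s :: real
          have "s powr (- 1 - e) * (\<bar>w s\<bar> * \<bar>s\<bar> powr (1 + e)) powr p = \<bar>w s\<bar> powr p * s powr ?c" if "s \<ge> r"
          proof -
            have "s powr (- 1 - e) * (\<bar>w s\<bar> * \<bar>s\<bar> powr (1 + e)) powr p = \<bar>w s\<bar> powr p * (s powr (- 1 - e) * s powr ((1 + e) * p))"
              using that r by (simp add: powr_mult powr_powr)
            also have "s powr (- 1 - e) * s powr ((1 + e) * p) = s powr ?c"
              by (simp add: algebra_simps flip: powr_add)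
            finally show ?thesis .
          qed
          then show "ennreal ((indicator {r..1} s * s powr (- 1 - e)) * (\<bar>w s\<bar> * \<bar>s\<bar> powr (1 + e)) powr p)
             = ennreal (\<bar>w s\<bar> powr p * s powr ?c) * indicator {r..1} s"
            by (auto split: split_indicator)
        qed
        then show "(\<integral>\<^sup>+s. ennreal ((indicator {r..1} s * s powr (- 1 - e)) * (\<bar>w s\<bar> * \<bar>s\<bar> powr (1 + e)) powr p) \<partial>lborel) \<le> ennreal B"
          using B by simp
      qed (use p m B in auto)
      finally have I: "(\<integral>\<^sup>+s\<in>{r..1}. ennreal \<bar>w s\<bar> \<partial>lborel) \<le> ennreal I" .
      have "(1 - 1 / p) * p = p - 1" using p by (simp add: field_simps)
      then have Ip: "I powr p = 2 powr p * m powr (p - 1) * B"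
        using p m B by (simp add: I_def powr_mult powr_powr)
      have mp: "m powr (p - 1) = e powr (1 - p) * r powr (e * (1 - p))"
      proof -
        have "m powr (p - 1) = r powr (- e * (p - 1)) / e powr (p - 1)"
          using r e by (simp add: m_def powr_divide powr_powr)
        also have "1 / e powr (p - 1) = e powr (1 - p)"
          using e by (metis minus_diff_eq powr_minus_divide)
        then have "r powr (- e * (p - 1)) / e powr (p - 1) = e powr (1 - p) * r powr (- e * (p - 1))"
          by (simp add: divide_inverse)
        finally show ?thesis by (simp add: algebra_simps)
      qed
      have "\<bar>g r\<bar> powr p \<le> (\<bar>g 1\<bar> + I) powr p"
        using primitive_diff_le[OF gw, of r 1 1 r I] r I I0 p by (intro powr_mono2) auto
      also have "\<dots> \<le> 2 powr p * (\<bar>g 1\<bar> powr p + I powr p)"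
        using p I0 by (intro powr_add_le) auto
      also have "\<dots> = 2 powr p * \<bar>g 1\<bar> powr p + 4 powr p * e powr (1 - p) * r powr (e * (1 - p)) * B"
      proof -
        have "(2::real) powr p * 2 powr p = 4 powr p" by (simp flip: powr_mult)
        then show ?thesis unfolding Ip mp by (simp add: algebra_simps)
      qed
      finally show ?thesis using B e r
        by (simp add: ennreal_leI flip: ennreal_mult ennreal_plus)
    qed
    have "wint p a {0<..1} g \<le> (\<integral>\<^sup>+r. ennreal (2 powr p * \<bar>g 1\<bar> powr p) * (ennreal (r powr a) * indicator {0<..1} r) +
        ennreal (4 powr p * e powr (1 - p)) * (ennreal (r powr (e - 1)) * J r * indicator {0<..1} r) \<partial>lborel)"
      unfolding wint_def
    proof (rule nn_integral_mono)
      fix r :: real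
      have "ennreal (\<bar>g r\<bar> powr p * r powr a) \<le> ennreal (2 powr p * \<bar>g 1\<bar> powr p) * ennreal (r powr a) +
        ennreal (4 powr p * e powr (1 - p)) * (ennreal (r powr (e - 1)) * J r)" if r: "r \<in> {0<..1}"
      proof -
        have "ennreal (\<bar>g r\<bar> powr p * r powr a) \<le> (ennreal (2 powr p * \<bar>g 1\<bar> powr p) +
            ennreal (4 powr p * e powr (1 - p) * r powr (e * (1 - p))) * J r) * ennreal (r powr a)"
          using mult_right_mono[OF Jr[OF r], of "ennreal (r powr a)"] by (simp add: ennreal_mult)
        also have "\<dots> = ennreal (2 powr p * \<bar>g 1\<bar> powr p) * ennreal (r powr a) +
            ennreal (4 powr p * e powr (1 - p)) * (ennreal (r powr (e * (1 - p)) * r powr a) * J r)"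
          using e by (simp add: ennreal_mult distrib_right distrib_left mult_ac)
        \<comment> \<open>As \<open>e * p = a + 1\<close>, the exponents add up to
          \<open>e - 1 > -1\<close>.\<close>
        also have "r powr (e * (1 - p)) * r powr a = r powr (e - 1)"
          using p by (simp add: e_def field_simps flip: powr_add)
        finally show ?thesis .
      qed
      then show "ennreal (\<bar>g r\<bar> powr p * r powr a) * indicator {0<..1} r \<le> ennreal (2 powr p * \<bar>g 1\<bar> powr p) * (ennreal (r powr a) * indicator {0<..1} r) +
        ennreal (4 powr p * e powr (1 - p)) * (ennreal (r powr (e - 1)) * J r * indicator {0<..1} r)"
        by (auto split: split_indicator)
    qed
    also have "\<dots> = ennreal (2 powr p * \<bar>g 1\<bar> powr p) * (\<integral>\<^sup>+r\<in>{0<..1}. ennreal (r powr a) \<partial>lborel) +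
        ennreal (4 powr p * e powr (1 - p)) * (\<integral>\<^sup>+r. ennreal (r powr (e - 1)) * J r * indicator {0<..1} r \<partial>lborel)"
    proof -
      have [measurable]: "J \<in> borel_measurable lborel"
      proof -
        \<comment> \<open>With the moving end point turned into a condition on the pair
          \<open>(r, s)\<close>, the integrand is jointly measurable; the exchange of integrals
          below uses the same form.\<close>
        have "J = (\<lambda>r. \<integral>\<^sup>+s. ennreal (\<bar>w s\<bar> powr p * s powr ?c) * (if r \<le> s \<and> s \<le> 1 then 1 else 0) \<partial>lborel)"
          unfolding J_def wint_def by (intro ext nn_integral_cong) (auto split: split_indicator)
        also have "\<dots> \<in> borel_measurable lborel" by measurable
        finally show ?thesis .
      qed
      show ?thesis by (subst nn_integral_add) (auto simp: nn_integral_cmult)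
    qed
    also have "(\<integral>\<^sup>+r\<in>{0<..1}. ennreal (r powr a) \<partial>lborel) = ennreal (1 / (a + 1))"
      using a by (subst nn_integral_powr_from_0) auto
    also have "(\<integral>\<^sup>+r. ennreal (r powr (e - 1)) * J r * indicator {0<..1} r \<partial>lborel) = ennreal (1 / e) * wint p (a + p) {0<..1} w"
    proof -
      have "(\<integral>\<^sup>+r. ennreal (r powr (e - 1)) * J r * indicator {0<..1} r \<partial>lborel) =
        (\<integral>\<^sup>+r. (\<integral>\<^sup>+s. ennreal (r powr (e - 1)) * (ennreal (\<bar>w s\<bar> powr p * s powr ?c) * (if 0 < r \<and> r \<le> s \<and> s \<le> 1 then 1 else 0)) \<partial>lborel) \<partial>lborel)"
      proof (rule nn_integral_cong)
        fix r :: real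
        have "J r * indicator {0<..1} r = (\<integral>\<^sup>+s. ennreal (\<bar>w s\<bar> powr p * s powr ?c) * (if 0 < r \<and> r \<le> s \<and> s \<le> 1 then 1 else 0) \<partial>lborel)"
        proof -
          have "J r * indicator {0<..1} r = (\<integral>\<^sup>+s. ennreal (\<bar>w s\<bar> powr p * s powr ?c) * indicator {r..1} s * indicator {0<..1} r \<partial>lborel)"
            unfolding J_def wint_def by (rule nn_integral_multc[symmetric]) auto
          also have "\<dots> = (\<integral>\<^sup>+s. ennreal (\<bar>w s\<bar> powr p * s powr ?c) * (if 0 < r \<and> r \<le> s \<and> s \<le> 1 then 1 else 0) \<partial>lborel)"
            by (intro nn_integral_cong) (auto split: split_indicator)
          finally show ?thesis .
        qed
        then show "ennreal (r powr (e - 1)) * J r * indicator {0<..1} r = (\<integral>\<^sup>+s. ennreal (r powr (e - 1)) * (ennreal (\<bar>w s\<bar> powr p * s powr ?c) * (if 0 < r \<and> r \<le> s \<and> s \<le> 1 then 1 else 0)) \<partial>lborel)"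
          by (subst nn_integral_cmult) (auto simp: mult.assoc)
      qed
      also have "\<dots> = (\<integral>\<^sup>+s. (\<integral>\<^sup>+r. ennreal (r powr (e - 1)) * (ennreal (\<bar>w s\<bar> powr p * s powr ?c) * (if 0 < r \<and> r \<le> s \<and> s \<le> 1 then 1 else 0)) \<partial>lborel) \<partial>lborel)"
        by (rule lborel_pair.Fubini'[symmetric]) measurable
      also have "\<dots> = (\<integral>\<^sup>+s. ennreal (1 / e) * (ennreal (\<bar>w s\<bar> powr p * s powr (a + p)) * indicator {0<..1} s) \<partial>lborel)"
      proof (rule nn_integral_cong)
        fix s :: real
        have "(\<integral>\<^sup>+r. ennreal (r powr (e - 1)) * (ennreal (\<bar>w s\<bar> powr p * s powr ?c) * (if 0 < r \<and> r \<le> s \<and> s \<le> 1 then 1 else 0)) \<partial>lborel)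
          = (\<integral>\<^sup>+r. (ennreal (\<bar>w s\<bar> powr p * s powr ?c) * indicator {0<..1} s) * (ennreal (r powr (e - 1)) * indicator {0<..s} r) \<partial>lborel)"
          by (intro nn_integral_cong) (auto split: split_indicator simp: mult_ac)
        also have "\<dots> = (ennreal (\<bar>w s\<bar> powr p * s powr ?c) * indicator {0<..1} s) * (\<integral>\<^sup>+r\<in>{0<..s}. ennreal (r powr (e - 1)) \<partial>lborel)"
          by (rule nn_integral_cmult) auto
        also have "\<dots> = ennreal (1 / e) * (ennreal (\<bar>w s\<bar> powr p * s powr (a + p)) * indicator {0<..1} s)"
        proof (cases "s \<in> {0<..1}")
          case True
          have "e * p = a + 1" using p by (simp add: e_def)
          then have "?c + e = a + p" by (simp add: algebra_simps)
          then have "s powr ?c * s powr e = s powr (a + p)" by (simp flip: powr_add)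
          then have "\<bar>w s\<bar> powr p * s powr ?c * (s powr e / e) = 1 / e * (\<bar>w s\<bar> powr p * s powr (a + p))"
            by (simp add: mult.assoc)
          then show ?thesis
            using True e by (subst nn_integral_powr_from_0) (auto simp flip: ennreal_mult)
        qed auto
        finally show "(\<integral>\<^sup>+r. ennreal (r powr (e - 1)) * (ennreal (\<bar>w s\<bar> powr p * s powr ?c) * (if 0 < r \<and> r \<le> s \<and> s \<le> 1 then 1 else 0)) \<partial>lborel)
          = ennreal (1 / e) * (ennreal (\<bar>w s\<bar> powr p * s powr (a + p)) * indicator {0<..1} s)" .
      qed
      also have "\<dots> = ennreal (1 / e) * wint p (a + p) {0<..1} w"
        unfolding wint_def by (rule nn_integral_cmult) auto
      finally show ?thesis .
    qed
    also have "ennreal (2 powr p * \<bar>g 1\<bar> powr p) * ennreal (1 / (a + 1)) +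
        ennreal (4 powr p * e powr (1 - p)) * (ennreal (1 / e) * wint p (a + p) {0<..1} w) \<le>
        ennreal (2 powr p * \<bar>g 1\<bar> powr p) * ennreal (1 / (a + 1)) +
        ennreal (4 powr p * e powr (1 - p)) * (ennreal (1 / e) * ennreal A)"
      using wA by (intro add_mono mult_left_mono) auto
    also have "\<dots> = ennreal (2 powr p * \<bar>g 1\<bar> powr p / (a + 1) + 4 powr p * e powr (1 - p) / e * A)"
      using a e A by (simp flip: ennreal_mult ennreal_plus)
    also have "\<dots> \<le> ennreal (C * (\<bar>g 1\<bar> powr p + A))"
    proof (rule ennreal_leI)
      have "2 powr p / (a + 1) * \<bar>g 1\<bar> powr p \<le> C * \<bar>g 1\<bar> powr p"
        using e unfolding C_def by (intro mult_right_mono) auto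
      moreover have "4 powr p * e powr (1 - p) / e * A \<le> C * A"
        using a A unfolding C_def by (intro mult_right_mono) auto
      ultimately show "2 powr p * \<bar>g 1\<bar> powr p / (a + 1) + 4 powr p * e powr (1 - p) / e * A \<le> C * (\<bar>g 1\<bar> powr p + A)"
        by (simp add: algebra_simps)
    qed
    finally show "wint p a {0<..1} g \<le> ennreal (C * (\<bar>g 1\<bar> powr p + A))" .
  qed
qed

section \<open>Pointwise power bounds near 0, at 1 and near infinity\<close>

lemma powr_doubling:
  fixes s t c :: real
  assumes "0 < s" "0 < t" "s \<le> 2 * t" "t \<le> 2 * s"
  shows "s powr c \<le> 2 powr \<bar>c\<bar> * t powr c"
proof -
  have "ln s \<le> ln 2 + ln t" "ln t \<le> ln 2 + ln s"
    using assms by (simp_all flip: ln_mult_pos)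
  then have "\<bar>ln s - ln t\<bar> \<le> ln 2" by auto
  then have "\<bar>c\<bar> * \<bar>ln s - ln t\<bar> \<le> \<bar>c\<bar> * ln 2" by (intro mult_left_mono) auto
  then have "c * (ln s - ln t) \<le> \<bar>c\<bar> * ln 2" by (simp flip: abs_mult)
  then have "c * ln s \<le> \<bar>c\<bar> * ln 2 + c * ln t" by (simp add: algebra_simps)
  then have "exp (c * ln s) \<le> exp (\<bar>c\<bar> * ln 2 + c * ln t)" by simp
  then show ?thesis using assms by (simp add: powr_def exp_add)
qed

text \<open>On \<open>{x..x + h}\<close> with \<open>h \<le> x\<close> the weight
  \<open>r powr d\<close> differs from its value at \<open>x\<close> by a factor of at most
  \<open>2 powr |d|\<close>, whatever the sign of \<open>d\<close>, so it can be moved out of the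
  integral.\<close>

lemma primitive_weighted_local_bound:
  fixes p a c h x t M :: real
  assumes gw: "primitive g w" and p: "p \<ge> 1" and x: "0 < x" and h: "0 < h" "h \<le> x" and t: "t \<in> {x..x + h}"
    and M: "M \<ge> 0" and B: "wint p a {x..x + h} g \<le> ennreal M" and A: "wint p c {x..x + h} w \<le> ennreal M"
  shows "\<bar>g t\<bar> powr p \<le> 4 powr p * (2 powr \<bar>a\<bar> * x powr (- a) / h + 2 powr \<bar>c\<bar> * h powr (p - 1) * x powr (- c)) * M"
proof -
  note [measurable] = primitive_measurable[OF gw]
  have *: "wint p 0 {x..x + h} f \<le> ennreal (2 powr \<bar>d\<bar> * x powr (- d) * M)"
    if f: "wint p d {x..x + h} f \<le> ennreal M" "f \<in> borel_measurable borel" for f d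
  proof -
    have "wint p 0 {x..x + h} f \<le> ennreal (2 powr \<bar>d\<bar> * x powr (- d)) * wint p d {x..x + h} f"
    proof (rule wint_mono)
      fix r assume r: "r \<in> {x..x + h}"
      have "x powr d \<le> 2 powr \<bar>d\<bar> * r powr d" using r x h by (intro powr_doubling) auto
      then show "r powr 0 \<le> 2 powr \<bar>d\<bar> * x powr (- d) * r powr d"
        using r x by (simp add: powr_minus field_simps)
    qed (use f in auto)
    also have "\<dots> \<le> ennreal (2 powr \<bar>d\<bar> * x powr (- d)) * ennreal M"
      by (rule mult_left_mono[OF f(1)]) simp
    finally show ?thesis using M by (simp add: ennreal_mult)
  qed
  have "\<bar>g t\<bar> powr p \<le> 4 powr p * (2 powr \<bar>a\<bar> * x powr (- a) * M / h + h powr (p - 1) * (2 powr \<bar>c\<bar> * x powr (- c) * M))"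
    by (rule primitive_local_bound[OF gw p x h(1) t *[OF B] _ *[OF A]]) (use M in auto)
  then show ?thesis by (simp add: algebra_simps)
qed

lemma wint_subset_le:
  assumes "wint p a T g \<le> M" "S \<subseteq> T"
  shows "wint p a S g \<le> M"
proof -
  have "wint p a S g \<le> wint p a T g"
    unfolding wint_def using assms(2) by (intro nn_integral_mono) (auto split: split_indicator)
  with assms(1) show ?thesis by simp
qed

text \<open>Supplies the boundary value \<open>g 1\<close> in Hardy's inequality; on
  \<open>{1..2}\<close> no power of the base point survives.\<close>

lemma primitive_bound_at_1:
  fixes p a c :: real
  assumes p: "p \<ge> 1"
  shows "\<exists>C\<ge>0. \<forall>g w M. primitive g w \<longrightarrow> M \<ge> 0 \<longrightarrow> wint p a {0<..} g \<le> ennreal M \<longrightarrow>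
    wint p c {0<..} w \<le> ennreal M \<longrightarrow> \<bar>g 1\<bar> powr p \<le> C * M"
proof (intro exI[of _ "4 powr p * (2 powr \<bar>a\<bar> + 2 powr \<bar>c\<bar>)"] conjI allI impI)
  fix g w and M :: real
  assume "primitive g w" "M \<ge> 0" "wint p a {0<..} g \<le> ennreal M" "wint p c {0<..} w \<le> ennreal M"
  then show "\<bar>g 1\<bar> powr p \<le> 4 powr p * (2 powr \<bar>a\<bar> + 2 powr \<bar>c\<bar>) * M"
    using primitive_weighted_local_bound[of g w p 1 1 1 M a c] p
      wint_subset_le[of p a "{0<..}" g "ennreal M" "{1..2}"] wint_subset_le[of p c "{0<..}" w "ennreal M" "{1..2}"]
    by (simp add: subset_eq)
qed simp

text \<open>The interval is \<open>{r / 2..r}\<close>, which ends at \<open>r\<close> so as to stay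
  inside \<open>(0,1]\<close>. The weights \<open>a\<close> and \<open>a + p\<close> match: both
  terms of the local bound scale like \<open>r powr (- (a + 1))\<close>.\<close>

lemma primitive_bound_near_0:
  fixes p a :: real
  assumes p: "p \<ge> 1"
  shows "\<exists>C\<ge>0. \<forall>g w M. primitive g w \<longrightarrow> M \<ge> 0 \<longrightarrow> wint p a {0<..1} g \<le> ennreal M \<longrightarrow>
    wint p (a + p) {0<..1} w \<le> ennreal M \<longrightarrow> (\<forall>r\<in>{0<..1}. \<bar>g r\<bar> powr p \<le> C * M * r powr (- (a + 1)))"
proof (intro exI[of _ "4 powr p * (2 powr \<bar>a\<bar> + 2 powr \<bar>a + p\<bar>) * 2 powr (a + 1)"] conjI allI impI ballI)
  fix g w and M r :: real
  assume gw: "primitive g w" and M: "M \<ge> 0" and g: "wint p a {0<..1} g \<le> ennreal M"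
    and w: "wint p (a + p) {0<..1} w \<le> ennreal M" and r: "r \<in> {0<..1}"
  define x where "x = r / 2"
  have x: "x > 0" using r by (simp add: x_def)
  have sub: "{x..x + x} \<subseteq> {0<..1}" using r by (auto simp: x_def)
  have "\<bar>g r\<bar> powr p \<le> 4 powr p * (2 powr \<bar>a\<bar> * x powr (- a) / x + 2 powr \<bar>a + p\<bar> * x powr (p - 1) * x powr (- (a + p))) * M"
    by (rule primitive_weighted_local_bound[OF gw p x x _ _ M wint_subset_le[OF g sub] wint_subset_le[OF w sub]])
       (use r in \<open>auto simp: x_def\<close>)
  also have "2 powr \<bar>a\<bar> * x powr (- a) / x = 2 powr \<bar>a\<bar> * x powr (- (a + 1))"
  proof -
    have eq: "- (a + 1) = - a - 1" by simp
    show ?thesis unfolding eq using x by (simp add: powr_diff)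
  qed
  also have "2 powr \<bar>a + p\<bar> * x powr (p - 1) * x powr (- (a + p)) = 2 powr \<bar>a + p\<bar> * x powr (- (a + 1))"
    unfolding mult.assoc by (subst powr_add[symmetric]) (rule arg_cong[where f = "\<lambda>z. _ * x powr z"], simp)
  also have "x powr (- (a + 1)) = 2 powr (a + 1) * r powr (- (a + 1))"
    using r unfolding x_def by (subst powr_divide) (auto simp: powr_minus_divide powr_diff powr_add)
  finally show "\<bar>g r\<bar> powr p \<le> 4 powr p * (2 powr \<bar>a\<bar> + 2 powr \<bar>a + p\<bar>) * 2 powr (a + 1) * M * r powr (- (a + 1))"
    by (simp add: algebra_simps)
qed simp

text \<open>An interval of length \<open>r powr \<tau>\<close> turns the local bound into the powers
  \<open>r powr (- a - \<tau>)\<close> and \<open>r powr (\<tau> * (p - 1) - c)\<close>; the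
  hypotheses on \<open>\<delta>\<close> say that both are at most
  \<open>r powr (- \<delta>)\<close>, and \<open>\<tau> \<le> 1\<close> keeps the weights comparable
  on the interval. For \<open>p > 1\<close>, lowering \<open>\<tau>\<close> improves the second
  power at the expense of the first.\<close>

lemma primitive_bound_at_infinity:
  fixes p a c \<tau> \<delta> :: real
  assumes p: "p \<ge> 1" and \<tau>: "\<tau> \<le> 1" and \<delta>: "\<delta> \<le> a + \<tau>" "\<delta> \<le> c - \<tau> * (p - 1)"
  shows "\<exists>C\<ge>0. \<forall>g w M. primitive g w \<longrightarrow> M \<ge> 0 \<longrightarrow> wint p a {0<..} g \<le> ennreal M \<longrightarrow>
    wint p c {0<..} w \<le> ennreal M \<longrightarrow> (\<forall>r\<in>{1..}. \<bar>g r\<bar> powr p \<le> C * M * r powr (- \<delta>))"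
proof (intro exI[of _ "4 powr p * (2 powr \<bar>a\<bar> + 2 powr \<bar>c\<bar>)"] conjI allI impI ballI)
  fix g w and M r :: real
  assume gw: "primitive g w" and M: "M \<ge> 0" and g: "wint p a {0<..} g \<le> ennreal M"
    and w: "wint p c {0<..} w \<le> ennreal M" and r: "r \<in> {1..}"
  define h where "h = r powr \<tau>"
  have h: "0 < h" "h \<le> r" using r \<tau> powr_mono[of \<tau> 1 r] by (auto simp: h_def)
  have sub: "{r..r + h} \<subseteq> {0<..}" using r by auto
  have "\<bar>g r\<bar> powr p \<le> 4 powr p * (2 powr \<bar>a\<bar> * r powr (- a) / h + 2 powr \<bar>c\<bar> * h powr (p - 1) * r powr (- c)) * M"
    by (rule primitive_weighted_local_bound[OF gw p _ h _ M wint_subset_le[OF g sub] wint_subset_le[OF w sub]])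
       (use r h in auto)
  also have "\<dots> \<le> 4 powr p * (2 powr \<bar>a\<bar> * r powr (- \<delta>) + 2 powr \<bar>c\<bar> * r powr (- \<delta>)) * M"
  proof -
    have "r powr (- a) / h = r powr (- a - \<tau>)" by (simp add: h_def powr_diff)
    also have "\<dots> \<le> r powr (- \<delta>)" using r \<delta> by (intro powr_mono) auto
    finally have 1: "r powr (- a) / h \<le> r powr (- \<delta>)" .
    have "h powr (p - 1) * r powr (- c) = r powr (\<tau> * (p - 1) - c)"
      by (simp add: h_def powr_powr flip: powr_add)
    also have "\<dots> \<le> r powr (- \<delta>)" using r \<delta> by (intro powr_mono) auto
    finally have 2: "h powr (p - 1) * r powr (- c) \<le> r powr (- \<delta>)" .
    have "2 powr \<bar>a\<bar> * r powr (- a) / h \<le> 2 powr \<bar>a\<bar> * r powr (- \<delta>)"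
      "2 powr \<bar>c\<bar> * h powr (p - 1) * r powr (- c) \<le> 2 powr \<bar>c\<bar> * r powr (- \<delta>)"
      unfolding times_divide_eq_right[symmetric] mult.assoc
      by (rule mult_left_mono[OF 1] mult_left_mono[OF 2]; simp)+
    then show ?thesis using M by (intro mult_right_mono mult_left_mono add_mono) auto
  qed
  finally show "\<bar>g r\<bar> powr p \<le> 4 powr p * (2 powr \<bar>a\<bar> + 2 powr \<bar>c\<bar>) * M * r powr (- \<delta>)"
    by (simp add: algebra_simps)
qed simp

text \<open>On \<open>(0,1]\<close> a larger exponent makes the weight smaller, so \<open>w\<close>
  may be measured with \<open>c + p\<close> instead of \<open>b + p\<close>. This admits
  \<open>b = -1\<close>, where Hardy's inequality with \<open>b\<close> itself fails.\<close>

lemma Hardy_bound_near_0: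
  fixes p a0 b c :: real
  assumes p: "p \<ge> 1" and c: "c > -1" "b \<le> c"
  shows "\<exists>C\<ge>0. \<forall>g w M. primitive g w \<longrightarrow> M \<ge> 0 \<longrightarrow> wint p a0 {0<..} g \<le> ennreal M \<longrightarrow>
    wint p (b + p) {0<..} w \<le> ennreal M \<longrightarrow> wint p c {0<..1} g \<le> ennreal (C * M)"
proof -
  obtain C1 where C1: "C1 \<ge> 0" "\<And>g w A. \<lbrakk>primitive g w; A \<ge> 0; wint p (c + p) {0<..1} w \<le> ennreal A\<rbrakk> \<Longrightarrow>
    wint p c {0<..1} g \<le> ennreal (C1 * (\<bar>g 1\<bar> powr p + A))"
    using Hardy_near_0[OF p c(1)] by blast
  obtain C2 where C2: "C2 \<ge> 0" "\<And>g w M. \<lbrakk>primitive g w; M \<ge> 0; wint p a0 {0<..} g \<le> ennreal M;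
    wint p (b + p) {0<..} w \<le> ennreal M\<rbrakk> \<Longrightarrow> \<bar>g 1\<bar> powr p \<le> C2 * M"
    using primitive_bound_at_1[OF p, of a0 "b + p"] by blast
  show ?thesis
  proof (intro exI[of _ "C1 * (C2 + 1)"] conjI allI impI)
    fix g w and M :: real
    assume gw: "primitive g w" and M: "M \<ge> 0" and g: "wint p a0 {0<..} g \<le> ennreal M"
      and w: "wint p (b + p) {0<..} w \<le> ennreal M"
    have "wint p (c + p) {0<..1} w \<le> ennreal 1 * wint p (b + p) {0<..} w"
      using c primitive_measurable[OF gw] by (intro wint_mono) (auto intro: powr_mono')
    with w have "wint p (c + p) {0<..1} w \<le> ennreal M" by simp
    from C1(2)[OF gw M this] have "wint p c {0<..1} g \<le> ennreal (C1 * (\<bar>g 1\<bar> powr p + M))" .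
    also have "\<dots> \<le> ennreal (C1 * (C2 * M + M))"
      using C2(2)[OF gw M g w] C1(1) by (intro ennreal_leI mult_left_mono add_mono) auto
    finally show "wint p c {0<..1} g \<le> ennreal (C1 * (C2 + 1) * M)" by (simp add: algebra_simps)
  qed (use C1 C2 in auto)
qed

section \<open>Changing the weight and the power\<close>

lemma wint_Un_le:
  assumes [measurable]: "g \<in> borel_measurable borel" "S \<in> sets borel" "T \<in> sets borel"
  shows "wint p a (S \<union> T) g \<le> wint p a S g + wint p a T g"
proof -
  have "wint p a (S \<union> T) g \<le> (\<integral>\<^sup>+r. ennreal (\<bar>g r\<bar> powr p * r powr a) * indicator S r + ennreal (\<bar>g r\<bar> powr p * r powr a) * indicator T r \<partial>lborel)"
    unfolding wint_def by (intro nn_integral_mono) (auto split: split_indicator)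
  also have "\<dots> = wint p a S g + wint p a T g"
    unfolding wint_def by (subst nn_integral_add) auto
  finally show ?thesis .
qed

lemma wint_half_line_le:
  assumes "g \<in> borel_measurable borel" "wint p a {0<..1} g \<le> ennreal A" "wint p a {1<..} g \<le> ennreal B" "A \<ge> 0" "B \<ge> 0"
  shows "wint p a {0<..} g \<le> ennreal (A + B)"
proof -
  have "{(0::real)<..} = {0<..1} \<union> {1<..}" by auto
  then have "wint p a {0<..} g \<le> wint p a {0<..1} g + wint p a {1<..} g"
    using wint_Un_le[OF assms(1)] by simp
  also have "\<dots> \<le> ennreal (A + B)" using assms by (simp add: add_mono)
  finally show ?thesis .
qed

text \<open>The passage from one order of derivative to the next lower one: Hardy's inequality on
  \<open>(0,1]\<close>, and \<open>r powr b \<le> r powr a\<close> beyond 1.\<close>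

lemma wint_weight_reduction:
  fixes p a b :: real
  assumes p: "p \<ge> 1" and b: "b > -1" "b \<le> a"
  shows "\<exists>C\<ge>0. \<forall>g w M. primitive g w \<longrightarrow> M \<ge> 0 \<longrightarrow> wint p a {0<..} g \<le> ennreal M \<longrightarrow>
    wint p (b + p) {0<..} w \<le> ennreal M \<longrightarrow> wint p b {0<..} g \<le> ennreal (C * M)"
proof -
  obtain C where C: "C \<ge> 0" "\<And>g w M. \<lbrakk>primitive g w; M \<ge> 0; wint p a {0<..} g \<le> ennreal M;
    wint p (b + p) {0<..} w \<le> ennreal M\<rbrakk> \<Longrightarrow> wint p b {0<..1} g \<le> ennreal (C * M)"
    using Hardy_bound_near_0[OF p b(1), of b a] by auto
  show ?thesis
  proof (intro exI[of _ "C + 1"] conjI allI impI)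
    fix g w and M :: real
    assume gw: "primitive g w" and M: "M \<ge> 0" and g: "wint p a {0<..} g \<le> ennreal M"
      and w: "wint p (b + p) {0<..} w \<le> ennreal M"
    have "wint p b {1<..} g \<le> ennreal 1 * wint p a {0<..} g"
      using b primitive_measurable[OF gw] by (intro wint_mono) (auto intro: powr_mono)
    with g have 1: "wint p b {1<..} g \<le> ennreal M" by simp
    show "wint p b {0<..} g \<le> ennreal ((C + 1) * M)"
      using wint_half_line_le[OF _ C(2)[OF gw M g w] 1] M C(1) primitive_measurable[OF gw]
      by (simp add: algebra_simps)
  qed (use C in auto)
qed

text \<open>The bound on \<open>|g r| powr p\<close> is used with the power
  \<open>(q - p) / p\<close>, which shifts the weight exponent by \<open>- d * (q - p) / p\<close>.
  The factor \<open>c\<close> is kept for tails, where it becomes a negative power of the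
  radius.\<close>

lemma wint_interpolate:
  fixes p q K d c e \<theta> :: real
  assumes p: "p \<ge> 1" "p \<le> q" and K: "K \<ge> 0" and c: "c \<ge> 0"
    and S: "S \<subseteq> {0<..}" and [measurable]: "g \<in> borel_measurable borel" "S \<in> sets borel"
    and g: "\<And>r. r \<in> S \<Longrightarrow> \<bar>g r\<bar> powr p \<le> K * r powr (- d)"
    and le: "\<And>r. r \<in> S \<Longrightarrow> r powr (\<theta> - d * (q - p) / p) \<le> c * r powr e"
  shows "wint q \<theta> S g \<le> ennreal (K powr ((q - p) / p) * c) * wint p e S g"
proof -
  have "wint q \<theta> S g \<le> (\<integral>\<^sup>+r. ennreal (K powr ((q - p) / p) * c) * (ennreal (\<bar>g r\<bar> powr p * r powr e) * indicator S r) \<partial>lborel)"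
    unfolding wint_def
  proof (rule nn_integral_mono)
    fix r
    have "\<bar>g r\<bar> powr q * r powr \<theta> \<le> K powr ((q - p) / p) * c * (\<bar>g r\<bar> powr p * r powr e)" if r: "r \<in> S"
    proof -
      have r0: "r > 0" using r S by auto
      have "\<bar>g r\<bar> powr q * r powr \<theta> = (\<bar>g r\<bar> powr p) powr ((q - p) / p) * \<bar>g r\<bar> powr p * r powr \<theta>"
        using p by (simp add: powr_powr flip: powr_add)
      also have "\<dots> \<le> (K * r powr (- d)) powr ((q - p) / p) * \<bar>g r\<bar> powr p * r powr \<theta>"
        using g[OF r] p by (intro mult_right_mono powr_mono2) auto
      also have "\<dots> = K powr ((q - p) / p) * \<bar>g r\<bar> powr p * (r powr (- d * ((q - p) / p)) * r powr \<theta>)"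
        using K r0 by (simp add: powr_mult powr_powr)
      also have "r powr (- d * ((q - p) / p)) * r powr \<theta> = r powr (\<theta> - d * (q - p) / p)"
        by (subst powr_add[symmetric]) (rule arg_cong[where f = "(powr) r"], simp)
      also have "K powr ((q - p) / p) * \<bar>g r\<bar> powr p * r powr (\<theta> - d * (q - p) / p)
           \<le> K powr ((q - p) / p) * \<bar>g r\<bar> powr p * (c * r powr e)"
        using le[OF r] by (intro mult_left_mono) auto
      finally show ?thesis by (simp add: mult_ac)
    qed
    then show "ennreal (\<bar>g r\<bar> powr q * r powr \<theta>) * indicator S r \<le>
       ennreal (K powr ((q - p) / p) * c) * (ennreal (\<bar>g r\<bar> powr p * r powr e) * indicator S r)"
      using c by (auto split: split_indicator simp flip: ennreal_mult intro!: ennreal_leI)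
  qed
  also have "\<dots> = ennreal (K powr ((q - p) / p) * c) * wint p e S g"
    unfolding wint_def by (rule nn_integral_cmult) auto
  finally show ?thesis .
qed

text \<open>Near 0 the pointwise bound has exponent \<open>c + 1\<close>, and the comparison of
  weights amounts exactly to \<open>(c + 1) * q \<le> (\<theta> + 1) * p\<close>; for
  \<open>c = b > -1\<close> this bounds \<open>q\<close> by the critical Sobolev exponent. Beyond 1
  the decay exponent \<open>b + 1 \<ge> 0\<close> can only help, and \<open>\<theta> \<le> a\<close>
  suffices.\<close>

lemma wint_embedding:
  fixes p q a b c \<theta> :: real
  assumes p: "p \<ge> 1" "p \<le> q" and b: "-1 \<le> b" "b \<le> c" "b \<le> a" and \<theta>: "(c + 1) * q \<le> (\<theta> + 1) * p" "\<theta> \<le> a"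
  shows "\<exists>C\<ge>0. \<forall>g w M. primitive g w \<longrightarrow> M \<ge> 0 \<longrightarrow> wint p a {0<..} g \<le> ennreal M \<longrightarrow>
    wint p (b + p) {0<..} w \<le> ennreal M \<longrightarrow> wint p c {0<..1} g \<le> ennreal M \<longrightarrow>
    wint q \<theta> {0<..} g \<le> ennreal (C * M powr (q / p))"
proof -
  obtain C1 where C1: "C1 \<ge> 0" "\<And>g w M. \<lbrakk>primitive g w; M \<ge> 0; wint p c {0<..1} g \<le> ennreal M;
      wint p (c + p) {0<..1} w \<le> ennreal M\<rbrakk> \<Longrightarrow> \<forall>r\<in>{0<..1}. \<bar>g r\<bar> powr p \<le> C1 * M * r powr (- (c + 1))"
    using primitive_bound_near_0[OF p(1), of c] by metis
  obtain C2 where C2: "C2 \<ge> 0" "\<And>g w M. \<lbrakk>primitive g w; M \<ge> 0; wint p a {0<..} g \<le> ennreal M;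
      wint p (b + p) {0<..} w \<le> ennreal M\<rbrakk> \<Longrightarrow> \<forall>r\<in>{1..}. \<bar>g r\<bar> powr p \<le> C2 * M * r powr (- (b + 1))"
    using primitive_bound_at_infinity[OF p(1), of 1 "b + 1" a "b + p"] b by auto
  \<comment> \<open>\<open>M powr e\<close> stems from the pointwise bound and one more factor
    \<open>M\<close> from the integral; together they give \<open>M powr (q / p)\<close>.\<close>
  define e where "e = (q - p) / p"
  have e: "e \<ge> 0" using p by (simp add: e_def)
  show ?thesis
  proof (intro exI[of _ "C1 powr e + C2 powr e"] conjI allI impI)
    fix g w and M :: real
    assume gw: "primitive g w" and M: "M \<ge> 0" and g: "wint p a {0<..} g \<le> ennreal M"
      and w: "wint p (b + p) {0<..} w \<le> ennreal M" and gc: "wint p c {0<..1} g \<le> ennreal M"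
    note [measurable] = primitive_measurable[OF gw]
    have Mq: "M powr e * M = M powr (q / p)"
    proof (cases "M = 0")
      case False
      then have "M powr e * M = M powr (e + 1)" using M by (simp add: powr_add)
      also have "e + 1 = q / p" using p by (simp add: e_def field_simps)
      finally show ?thesis .
    qed (use p in auto)
    have "wint p (c + p) {0<..1} w \<le> ennreal 1 * wint p (b + p) {0<..} w"
      using b by (intro wint_mono) (auto intro: powr_mono')
    with w have wc: "wint p (c + p) {0<..1} w \<le> ennreal M" by simp
    have "wint q \<theta> {0<..1} g \<le> ennreal ((C1 * M) powr ((q - p) / p) * 1) * wint p c {0<..1} g"
    proof (rule wint_interpolate[OF p])
      have "c \<le> \<theta> - (c + 1) * (q - p) / p" using \<theta> p by (simp add: field_simps)
      then show "r powr (\<theta> - (c + 1) * (q - p) / p) \<le> 1 * r powr c" if "r \<in> {0<..1}" for r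
        using that by (auto intro: powr_mono')
      show "\<bar>g r\<bar> powr p \<le> C1 * M * r powr (- (c + 1))" if "r \<in> {0<..1}" for r
        using C1(2)[OF gw M gc wc] that by blast
    qed (use C1 M in auto)
    also have "\<dots> \<le> ennreal ((C1 * M) powr ((q - p) / p) * 1) * ennreal M"
      by (rule mult_left_mono[OF gc]) simp
    also have "\<dots> = ennreal (C1 powr e * M powr (q / p))"
      using M C1(1) by (simp add: powr_mult e_def[symmetric] mult.assoc Mq flip: ennreal_mult)
    finally have 1: "wint q \<theta> {0<..1} g \<le> ennreal (C1 powr e * M powr (q / p))" .
    have "wint q \<theta> {1<..} g \<le> ennreal ((C2 * M) powr ((q - p) / p) * 1) * wint p a {1<..} g"
    proof (rule wint_interpolate[OF p])
      have "\<theta> - (b + 1) * (q - p) / p \<le> a"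
      proof -
        have "(b + 1) * (q - p) / p \<ge> 0" using b p by auto
        then show ?thesis using \<theta> by linarith
      qed
      then show "r powr (\<theta> - (b + 1) * (q - p) / p) \<le> 1 * r powr a" if "r \<in> {1<..}" for r
        using that by (auto intro: powr_mono)
      show "\<bar>g r\<bar> powr p \<le> C2 * M * r powr (- (b + 1))" if "r \<in> {1<..}" for r
        using C2(2)[OF gw M g w] that by auto
    qed (use C2 M in auto)
    also have "\<dots> \<le> ennreal ((C2 * M) powr ((q - p) / p) * 1) * ennreal M"
      by (rule mult_left_mono[OF wint_subset_le[OF g]]) auto
    also have "\<dots> = ennreal (C2 powr e * M powr (q / p))"
      using M C2(1) by (simp add: powr_mult e_def[symmetric] mult.assoc Mq flip: ennreal_mult)
    finally have 2: "wint q \<theta> {1<..} g \<le> ennreal (C2 powr e * M powr (q / p))" .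
    show "wint q \<theta> {0<..} g \<le> ennreal ((C1 powr e + C2 powr e) * M powr (q / p))"
      using wint_half_line_le[OF _ 1 2] by (simp add: algebra_simps)
  qed auto
qed

subsection \<open>Compactness\<close>

lemma primitive_continuous:
  assumes gw: "primitive g w"
  shows "continuous_on {0<..} g"
proof (rule continuous_at_imp_continuous_on, intro ballI)
  fix x :: real assume "x \<in> {0<..}"
  then have x: "x > 0" by simp
  have w: "set_integrable lborel {x / 2..y} w" "g y = g (x / 2) + (LINT r:{x / 2..y}|lborel. w r)" if "x / 2 \<le> y" for y
    using gw that x unfolding primitive_def by (auto simp: algebra_simps)
  have "continuous_on {x / 2..2 * x} (\<lambda>y. g (x / 2) + integral {x / 2..y} w)"
  proof (rule continuous_on_add[OF continuous_on_const indefinite_integral_continuous_1])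
    show "w integrable_on {x / 2..2 * x}"
      using w(1)[of "2 * x"] x by (simp add: set_borel_integral_eq_integral(1))
  qed
  also have "?this \<longleftrightarrow> continuous_on {x / 2..2 * x} g"
  proof (intro continuous_on_cong refl)
    fix y assume "y \<in> {x / 2..2 * x}"
    then show "g (x / 2) + integral {x / 2..y} w = g y"
      using w[of y] set_borel_integral_eq_integral(2)[of "{x / 2..y}" w] by simp
  qed
  finally have "continuous_on {x / 2<..<2 * x} g"
    by (rule continuous_on_subset) auto
  then show "isCont g x" using x by (simp add: continuous_on_eq_continuous_at)
qed

lemma primitive_exists:
  assumes [measurable]: "w \<in> borel_measurable borel"
    and int: "\<And>x y. 0 < x \<Longrightarrow> x \<le> y \<Longrightarrow> set_integrable lborel {x..y} w"
  shows "\<exists>g. primitive g w \<and> g 1 = c"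
proof -
  \<comment> \<open>Two integrals stand for one oriented integral from 1, because
    \<open>integral {1..x} w\<close> is 0 for \<open>x < 1\<close> and
    \<open>integral {x..1} w\<close> is 0 for \<open>x > 1\<close>. The value 0 on the nonpositive
    axis makes \<open>g\<close> Borel on the whole line.\<close>
  define g where "g x = (if x \<le> 0 then 0 else c + integral {1..x} w - integral {x..1} w)" for x
  have w: "w integrable_on {x..y}" if "0 < x" for x y
    using int[OF that, of y] by (cases "x \<le> y") (auto intro: set_borel_integral_eq_integral(1))
  have null: "integral {x..y} w = 0" if "y \<le> x" for x y
    using that by (cases "x = y") auto
  have diff: "g y - g x = integral {x..y} w" if "0 < x" "x \<le> y" for x y
  proof -
    consider "y \<le> 1" | "x \<le> 1" "1 \<le> y" | "1 \<le> x" by linarith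
    then show ?thesis
    proof cases
      case 1
      then have "integral {x..1} w = integral {x..y} w + integral {y..1} w"
        using that w by (simp add: Henstock_Kurzweil_Integration.integral_combine)
      moreover have "integral {1..x} w = 0" "integral {1..y} w = 0"
        using 1 that by (auto intro!: null)
      ultimately show ?thesis using that by (simp add: g_def)
    next
      case 2
      then have "integral {x..y} w = integral {x..1} w + integral {1..y} w"
        using that w by (simp add: Henstock_Kurzweil_Integration.integral_combine)
      moreover have "integral {1..x} w = 0" "integral {y..1} w = 0"
        using 2 that by (auto intro!: null)
      ultimately show ?thesis using that by (simp add: g_def)
    next
      case 3
      then have "integral {1..y} w = integral {1..x} w + integral {x..y} w"
        using that w by (simp add: Henstock_Kurzweil_Integration.integral_combine)
      moreover have "integral {x..1} w = 0" "integral {y..1} w = 0"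
        using 3 that by (auto intro!: null)
      ultimately show ?thesis using that by (simp add: g_def)
    qed
  qed
  have eq: "set_integrable lborel {x..y} w \<and> g y - g x = (LINT r:{x..y}|lborel. w r)" if "0 < x" "x \<le> y" for x y
    using diff[OF that] int[OF that] by (simp add: set_borel_integral_eq_integral)
  have "continuous_on {0<..} g"
  proof (rule continuous_at_imp_continuous_on, intro ballI)
    fix x :: real assume "x \<in> {0<..}"
    then have x: "x > 0" by simp
    have "continuous_on {x / 2..2 * x} (\<lambda>y. g (x / 2) + integral {x / 2..y} w)"
      by (rule continuous_on_add[OF continuous_on_const indefinite_integral_continuous_1[OF w]]) (use x in simp)
    also have "?this \<longleftrightarrow> continuous_on {x / 2..2 * x} g"
    proof (intro continuous_on_cong refl)
      fix y assume "y \<in> {x / 2..2 * x}"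
      then show "g (x / 2) + integral {x / 2..y} w = g y"
        using diff[of "x / 2" y] x by simp
    qed
    finally have "continuous_on {x / 2<..<2 * x} g"
      by (rule continuous_on_subset) auto
    then show "isCont g x" using x by (simp add: continuous_on_eq_continuous_at)
  qed
  then have "(\<lambda>x. if x \<in> {0<..} then g x else 0) \<in> borel_measurable borel"
    by (intro borel_measurable_continuous_on_if) auto
  also have "(\<lambda>x. if x \<in> {0<..} then g x else 0) = g" by (auto simp: g_def)
  finally have "primitive g w" using eq by (simp add: primitive_def)
  moreover have "g 1 = c" by (simp add: g_def)
  ultimately show ?thesis by blast
qed

text \<open>Composition with \<open>exp\<close> moves the functions to the whole line, and
  \<open>arctan\<close> supplies the uniform bound that Helly's theorem requires. The bound on
  \<open>F n x\<close> at each point keeps the limit strictly between \<open>- pi / 2\<close> and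
  \<open>pi / 2\<close>, so that \<open>tan\<close> undoes the \<open>arctan\<close>. The
  exceptional points come from the discontinuities of the monotone limit, which are
  countable.\<close>

lemma Helly_selection_half_line:
  fixes F :: "nat \<Rightarrow> real \<Rightarrow> real"
  assumes cont: "\<And>n. continuous_on {0<..} (F n)"
    and mono: "\<And>n x y. 0 < x \<Longrightarrow> x \<le> y \<Longrightarrow> F n x \<le> F n y"
    and bdd: "\<And>x. 0 < x \<Longrightarrow> \<exists>B. \<forall>n. \<bar>F n x\<bar> \<le> B"
  shows "\<exists>s. strict_mono (s :: nat \<Rightarrow> nat) \<and> (\<exists>N. countable N \<and>
    (\<forall>x. 0 < x \<longrightarrow> x \<notin> N \<longrightarrow> convergent (\<lambda>n. F (s n) x)))"
proof -
  define f where "f n t = arctan (F n (exp t))" for n t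
  have "\<exists>s. strict_mono (s::nat \<Rightarrow> nat) \<and> (\<exists>H. (\<forall>x. continuous (at_right x) H) \<and> mono H \<and> (\<forall>x. \<bar>H x\<bar> \<le> pi / 2) \<and>
    (\<forall>x. continuous (at x) H \<longrightarrow> (\<lambda>n. f (s n) x) \<longlonglongrightarrow> H x))"
  proof (rule Helly_selection)
    fix n x
    have "continuous_on UNIV (f n)"
      unfolding f_def by (intro continuous_intros continuous_on_compose2[OF cont]) auto
    then show "continuous (at_right x) (f n)"
      by (simp add: continuous_on_eq_continuous_within continuous_at_imp_continuous_within)
    show "mono (f n)" unfolding f_def by (intro monoI arctan_monotone' mono) auto
    show "\<bar>f n x\<bar> \<le> pi / 2"
      using arctan_bounded[of "F n (exp x)"] by (auto simp: f_def abs_le_iff)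
  qed
  then obtain s H where s: "strict_mono s" and H: "mono H"
    and lim: "\<And>t. isCont H t \<Longrightarrow> (\<lambda>n. f (s n) t) \<longlonglongrightarrow> H t" by blast
  show ?thesis
  proof (intro exI[of _ s] conjI s exI[of _ "exp ` {t. \<not> isCont H t}"] allI impI)
    show "countable (exp ` {t. \<not> isCont H t})"
      by (intro countable_image mono_ctble_discont H)
    fix x :: real assume x: "0 < x" "x \<notin> exp ` {t. \<not> isCont H t}"
    then have "isCont H (ln x)" by (metis (mono_tags, lifting) exp_ln imageI mem_Collect_eq)
    from lim[OF this] have l: "(\<lambda>n. arctan (F (s n) x)) \<longlonglongrightarrow> H (ln x)"
      using x by (simp add: f_def)
    obtain B where B: "\<And>n. \<bar>F n x\<bar> \<le> B" using bdd[OF x(1)] by blast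
    have ar: "arctan (F (s n) x) \<le> arctan B" "- arctan B \<le> arctan (F (s n) x)" for n
      using B[of "s n"] by (auto simp: abs_le_iff arctan_le_iff simp flip: arctan_minus)
    have "H (ln x) \<le> arctan B" "- arctan B \<le> H (ln x)"
      using ar by (auto intro: LIMSEQ_le_const[OF l] LIMSEQ_le_const2[OF l])
    then have "cos (H (ln x)) \<noteq> 0"
      using arctan_bounded[of B] by (intro less_imp_neq[symmetric] cos_gt_zero_pi) auto
    then have "(\<lambda>n. tan (arctan (F (s n) x))) \<longlonglongrightarrow> tan (H (ln x))"
      by (intro isCont_tendsto_compose[OF _ l] isCont_tan)
    then show "convergent (\<lambda>n. F (s n) x)" by (auto simp: tan_arctan convergent_def)
  qed
qed

text \<open>If \<open>F n\<close> is the primitive of \<open>|w n|\<close> vanishing at 1, then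
  \<open>|g n y - g n x| \<le> F n y - F n x\<close> for \<open>x \<le> y\<close>, which makes
  \<open>F n + g n\<close> increasing. A second extraction inside the first lets both converge off a
  countable set, and \<open>g n\<close> is their difference.\<close>

lemma primitive_subseq_convergent_AE:
  fixes g w :: "nat \<Rightarrow> real \<Rightarrow> real"
  assumes gw: "\<And>n. primitive (g n) (w n)"
    and g: "\<And>x. 0 < x \<Longrightarrow> \<exists>B. \<forall>n. \<bar>g n x\<bar> \<le> B"
    and w: "\<And>x y. 0 < x \<Longrightarrow> x \<le> y \<Longrightarrow> \<exists>B\<ge>0. \<forall>n. (\<integral>\<^sup>+r\<in>{x..y}. ennreal \<bar>w n r\<bar> \<partial>lborel) \<le> ennreal B"
  shows "\<exists>s v. strict_mono (s :: nat \<Rightarrow> nat) \<and> v \<in> borel_measurable borel \<and>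
    (AE x in lborel. x > 0 \<longrightarrow> (\<lambda>n. g (s n) x) \<longlonglongrightarrow> v x)"
proof -
  have "\<exists>F. primitive F (\<lambda>x. \<bar>w n x\<bar>) \<and> F 1 = 0" for n
  proof (rule primitive_exists)
    show "(\<lambda>x. \<bar>w n x\<bar>) \<in> borel_measurable borel"
      using primitive_measurable[OF gw, of n] by auto
    show "set_integrable lborel {x..y} (\<lambda>x. \<bar>w n x\<bar>)" if "0 < x" "x \<le> y" for x y
      using gw[of n] that by (intro set_integrable_abs) (auto simp: primitive_def)
  qed
  then obtain F where F: "\<And>n. primitive (F n) (\<lambda>x. \<bar>w n x\<bar>)" "\<And>n. F n 1 = 0" by metis
  have diff: "\<bar>g n y - g n x\<bar> \<le> F n y - F n x" if "0 < x" "x \<le> y" for n x y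
  proof -
    have "F n y - F n x = (LINT r:{x..y}|lborel. \<bar>w n r\<bar>)" "g n y - g n x = (LINT r:{x..y}|lborel. w n r)"
      using F(1)[of n] gw[of n] that by (auto simp: primitive_def)
    moreover have "\<bar>LINT r:{x..y}|lborel. w n r\<bar> \<le> (LINT r:{x..y}|lborel. \<bar>w n r\<bar>)"
      unfolding set_lebesgue_integral_def using integral_abs_bound[of lborel "\<lambda>r. indicator {x..y} r *\<^sub>R w n r"]
      by (simp add: abs_mult)
    ultimately show ?thesis by simp
  qed
  have Fb: "\<exists>B. \<forall>n. \<bar>F n x\<bar> \<le> B" if "0 < x" for x
  proof -
    have "0 < min 1 x" "min 1 x \<le> max 1 x" using that by auto
    from w[OF this] obtain B where B: "B \<ge> 0" "\<And>n. (\<integral>\<^sup>+r\<in>{min 1 x..max 1 x}. ennreal \<bar>w n r\<bar> \<partial>lborel) \<le> ennreal B"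
      by blast
    have "\<bar>F n x\<bar> \<le> \<bar>F n 1\<bar> + B" for n
      by (rule primitive_diff_le[OF F(1) \<open>0 < min 1 x\<close>, where y = "max 1 x"]) (use B in auto)
    then show ?thesis using F(2) by (intro exI[of _ B]) auto
  qed
  obtain s1 N1 where s1: "strict_mono (s1 :: nat \<Rightarrow> nat)" "countable N1"
    "\<And>x. 0 < x \<Longrightarrow> x \<notin> N1 \<Longrightarrow> convergent (\<lambda>n. F (s1 n) x)"
  proof -
    have "\<exists>s. strict_mono (s :: nat \<Rightarrow> nat) \<and> (\<exists>N. countable N \<and>
      (\<forall>x. 0 < x \<longrightarrow> x \<notin> N \<longrightarrow> convergent (\<lambda>n. F (s n) x)))"
    proof (rule Helly_selection_half_line)
      show "F n x \<le> F n y" if "0 < x" "x \<le> y" for n x y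
        using diff[OF that, of n] by linarith
    qed (use primitive_continuous[OF F(1)] Fb in blast)+
    then show ?thesis using that by blast
  qed
  obtain s2 N2 where s2: "strict_mono (s2 :: nat \<Rightarrow> nat)" "countable N2"
    "\<And>x. 0 < x \<Longrightarrow> x \<notin> N2 \<Longrightarrow> convergent (\<lambda>n. F (s1 (s2 n)) x + g (s1 (s2 n)) x)"
  proof -
    have "\<exists>s. strict_mono (s :: nat \<Rightarrow> nat) \<and> (\<exists>N. countable N \<and>
      (\<forall>x. 0 < x \<longrightarrow> x \<notin> N \<longrightarrow> convergent (\<lambda>n. F (s1 (s n)) x + g (s1 (s n)) x)))"
    proof (rule Helly_selection_half_line)
      show "continuous_on {0<..} (\<lambda>x. F (s1 n) x + g (s1 n) x)" for n
        by (intro continuous_intros primitive_continuous[OF F(1)] primitive_continuous[OF gw])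
      show "F (s1 n) x + g (s1 n) x \<le> F (s1 n) y + g (s1 n) y" if "0 < x" "x \<le> y" for n x y
        using diff[OF that, of "s1 n"] by auto
      fix x :: real assume x: "0 < x"
      obtain B1 B2 where B: "\<And>n. \<bar>F n x\<bar> \<le> B1" "\<And>n. \<bar>g n x\<bar> \<le> B2" using Fb[OF x] g[OF x] by blast
      have "\<bar>F (s1 n) x + g (s1 n) x\<bar> \<le> B1 + B2" for n
        using B(1)[of "s1 n"] B(2)[of "s1 n"] by linarith
      then show "\<exists>B. \<forall>n. \<bar>F (s1 n) x + g (s1 n) x\<bar> \<le> B" by blast
    qed
    then show ?thesis using that by blast
  qed
  define s where "s = s1 \<circ> s2"
  have conv: "convergent (\<lambda>n. g (s n) x)" if "0 < x" "x \<notin> N1 \<union> N2" for x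
  proof -
    have "convergent (\<lambda>n. F (s1 (s2 n)) x)"
      using convergent_subseq_convergent[OF s1(3) s2(1), of x] that by (simp add: o_def)
    from convergent_diff[OF s2(3)[of x] this] show ?thesis using that by (simp add: s_def)
  qed
  \<comment> \<open>Where the sequence diverges \<open>lim\<close> has an unspecified value, but
    always the same one, so \<open>v\<close> is still Borel.\<close>
  define v where "v x = lim (\<lambda>n. g (s n) x)" for x
  have [measurable]: "g n \<in> borel_measurable borel" for n using primitive_measurable[OF gw] by blast
  have "v \<in> borel_measurable borel" unfolding v_def by measurable
  moreover have "AE x in lborel. x > 0 \<longrightarrow> (\<lambda>n. g (s n) x) \<longlonglongrightarrow> v x"
  proof (rule AE_I'[of "N1 \<union> N2"])
    show "N1 \<union> N2 \<in> null_sets lborel" using s1 s2 by (intro countable_imp_null_set_lborel) auto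
    show "{x \<in> space lborel. \<not> (x > 0 \<longrightarrow> (\<lambda>n. g (s n) x) \<longlonglongrightarrow> v x)} \<subseteq> N1 \<union> N2"
      using conv by (auto simp: v_def convergent_LIMSEQ_iff)
  qed
  moreover have "strict_mono s" using s1 s2 by (auto simp: s_def strict_mono_o)
  ultimately show ?thesis by blast
qed

section \<open>Convergence in the weighted integrals\<close>

lemma tendsto_abs_powr_mult:
  fixes f :: "nat \<Rightarrow> real"
  assumes "f \<longlonglongrightarrow> l" "q > 0"
  shows "(\<lambda>n. \<bar>f n\<bar> powr q * c) \<longlonglongrightarrow> \<bar>l\<bar> powr q * c"
  using assms by (intro tendsto_mult_right tendsto_powr' tendsto_rabs tendsto_const) auto

lemma wint_Fatou:
  fixes g :: "nat \<Rightarrow> real \<Rightarrow> real"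
  assumes [measurable]: "\<And>n. g n \<in> borel_measurable borel" "v \<in> borel_measurable borel" "S \<in> sets borel"
    and lim: "AE x in lborel. x > 0 \<longrightarrow> (\<lambda>n. g n x) \<longlonglongrightarrow> v x" and S: "S \<subseteq> {0<..}" and q: "q > 0"
    and le: "\<And>n. wint q \<theta> S (g n) \<le> B"
  shows "wint q \<theta> S v \<le> B"
proof -
  have "wint q \<theta> S v \<le> (\<integral>\<^sup>+r. liminf (\<lambda>n. ennreal (\<bar>g n r\<bar> powr q * r powr \<theta>) * indicator S r) \<partial>lborel)"
    unfolding wint_def
  proof (rule nn_integral_mono_AE, use lim in eventually_elim)
    case (elim r)
    show ?case
    proof (cases "r \<in> S")
      case True
      then have "(\<lambda>n. ennreal (\<bar>g n r\<bar> powr q * r powr \<theta>)) \<longlonglongrightarrow> ennreal (\<bar>v r\<bar> powr q * r powr \<theta>)"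
        using elim S q by (intro tendsto_ennrealI tendsto_abs_powr_mult) auto
      from lim_imp_Liminf[OF _ this] True show ?thesis by simp
    qed auto
  qed
  also have "\<dots> \<le> liminf (\<lambda>n. wint q \<theta> S (g n))"
    unfolding wint_def by (rule nn_integral_liminf) auto
  also have "\<dots> \<le> liminf (\<lambda>n. B)"
    by (intro Liminf_mono always_eventually allI le)
  finally show ?thesis by (simp add: Liminf_const)
qed

lemma wint_diff_le:
  assumes [measurable]: "g \<in> borel_measurable borel" "v \<in> borel_measurable borel" "S \<in> sets borel" and q: "q \<ge> 0"
  shows "wint q \<theta> S (\<lambda>r. g r - v r) \<le> ennreal (2 powr q) * (wint q \<theta> S g + wint q \<theta> S v)"
proof -
  have "wint q \<theta> S (\<lambda>r. g r - v r) \<le> (\<integral>\<^sup>+r. ennreal (2 powr q) * (ennreal (\<bar>g r\<bar> powr q * r powr \<theta>) * indicator S r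
      + ennreal (\<bar>v r\<bar> powr q * r powr \<theta>) * indicator S r) \<partial>lborel)"
    unfolding wint_def
  proof (rule nn_integral_mono)
    fix r
    have "\<bar>g r - v r\<bar> powr q \<le> (\<bar>g r\<bar> + \<bar>v r\<bar>) powr q" using q by (intro powr_mono2) auto
    also have "\<dots> \<le> 2 powr q * (\<bar>g r\<bar> powr q + \<bar>v r\<bar> powr q)" using q by (intro powr_add_le) auto
    finally have "\<bar>g r - v r\<bar> powr q * r powr \<theta> \<le> 2 powr q * (\<bar>g r\<bar> powr q + \<bar>v r\<bar> powr q) * r powr \<theta>"
      by (intro mult_right_mono) auto
    then show "ennreal (\<bar>g r - v r\<bar> powr q * r powr \<theta>) * indicator S r \<le> ennreal (2 powr q) * (ennreal (\<bar>g r\<bar> powr q * r powr \<theta>) * indicator S r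
      + ennreal (\<bar>v r\<bar> powr q * r powr \<theta>) * indicator S r)"
      by (auto split: split_indicator intro!: ennreal_leI simp: algebra_simps simp flip: ennreal_mult ennreal_plus)
  qed
  also have "\<dots> = ennreal (2 powr q) * (wint q \<theta> S g + wint q \<theta> S v)"
    unfolding wint_def by (subst nn_integral_cmult, measurable, subst nn_integral_add) auto
  finally show ?thesis .
qed

text \<open>Almost everywhere on \<open>S\<close> the limit inherits the bound \<open>D\<close>, so
  \<open>2 powr q * 2 * D\<close> dominates the differences.\<close>

lemma wint_diff_tendsto_0:
  fixes g :: "nat \<Rightarrow> real \<Rightarrow> real"
  assumes [measurable]: "\<And>n. g n \<in> borel_measurable borel" "v \<in> borel_measurable borel" "S \<in> sets borel" "D \<in> borel_measurable borel"
    and lim: "AE x in lborel. x > 0 \<longrightarrow> (\<lambda>n. g n x) \<longlonglongrightarrow> v x" and S: "S \<subseteq> {0<..}" and q: "q > 0"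
    and D: "\<And>n r. r \<in> S \<Longrightarrow> \<bar>g n r\<bar> powr q * r powr \<theta> \<le> D r"
    and fin: "(\<integral>\<^sup>+r\<in>S. ennreal (D r) \<partial>lborel) < \<infinity>"
  shows "(\<lambda>n. wint q \<theta> S (\<lambda>r. g n r - v r)) \<longlonglongrightarrow> 0"
proof -
  have "(\<lambda>n. wint q \<theta> S (\<lambda>r. g n r - v r)) \<longlonglongrightarrow> (\<integral>\<^sup>+r. 0 \<partial>(lborel :: real measure))"
    unfolding wint_def
  proof (rule nn_integral_dominated_convergence)
    show "(\<integral>\<^sup>+r. ennreal (2 powr q * 2) * (ennreal (D r) * indicator S r) \<partial>lborel) < \<infinity>"
      using fin by (simp add: nn_integral_cmult ennreal_mult_less_top)
    show "AE r in lborel. (\<lambda>n. ennreal (\<bar>g n r - v r\<bar> powr q * r powr \<theta>) * indicator S r) \<longlonglongrightarrow> 0"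
      using lim
    proof eventually_elim
      case (elim r)
      show ?case
      proof (cases "r \<in> S")
        case True
        then have "(\<lambda>n. g n r - v r) \<longlonglongrightarrow> 0" using elim S by (auto simp: LIM_zero_iff)
        from tendsto_ennrealI[OF tendsto_abs_powr_mult[OF this q, of "r powr \<theta>"]] show ?thesis using True q by simp
      qed auto
    qed
    show "AE r in lborel. ennreal (\<bar>g n r - v r\<bar> powr q * r powr \<theta>) * indicator S r
        \<le> ennreal (2 powr q * 2) * (ennreal (D r) * indicator S r)" for n
      using lim
    proof eventually_elim
      case (elim r)
      show ?case
      proof (cases "r \<in> S")
        case True
        then have "(\<lambda>n. \<bar>g n r\<bar> powr q * r powr \<theta>) \<longlonglongrightarrow> \<bar>v r\<bar> powr q * r powr \<theta>"
          using elim S q by (intro tendsto_abs_powr_mult) auto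
        from LIMSEQ_le_const2[OF this] have v: "\<bar>v r\<bar> powr q * r powr \<theta> \<le> D r" using D[OF True] by auto
        have "0 \<le> \<bar>v r\<bar> powr q * r powr \<theta>" by simp
        with v have D0: "D r \<ge> 0" by linarith
        have "\<bar>g n r - v r\<bar> powr q \<le> (\<bar>g n r\<bar> + \<bar>v r\<bar>) powr q" using q by (intro powr_mono2) auto
        also have "\<dots> \<le> 2 powr q * (\<bar>g n r\<bar> powr q + \<bar>v r\<bar> powr q)" using q by (intro powr_add_le) auto
        finally have "\<bar>g n r - v r\<bar> powr q * r powr \<theta> \<le> 2 powr q * (\<bar>g n r\<bar> powr q + \<bar>v r\<bar> powr q) * r powr \<theta>"
          by (intro mult_right_mono) auto
        also have "\<dots> = 2 powr q * (\<bar>g n r\<bar> powr q * r powr \<theta> + \<bar>v r\<bar> powr q * r powr \<theta>)" by (simp add: algebra_simps)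
        also have "\<dots> \<le> 2 powr q * (D r + D r)" using v D[OF True] by (intro mult_left_mono add_mono) auto
        finally show ?thesis using True D0 by (auto intro!: ennreal_leI simp flip: ennreal_mult)
      qed auto
    qed
  qed auto
  then show ?thesis by simp
qed

text \<open>Only a bound common to a family is wanted, so \<open>|w| \<le> 1 + |w| powr p\<close>
  takes the place of Hoelder's inequality. For \<open>c \<ge> 0\<close> the weight on
  \<open>{x..y}\<close> is at least \<open>x powr c\<close>.\<close>

lemma nn_integral_abs_le_wint:
  fixes p c x y :: real
  assumes p: "p \<ge> 1" and c: "c \<ge> 0" and x: "0 < x" "x \<le> y" and [measurable]: "w \<in> borel_measurable borel"
    and w: "wint p c {0<..} w \<le> ennreal M" "M \<ge> 0"
  shows "(\<integral>\<^sup>+r\<in>{x..y}. ennreal \<bar>w r\<bar> \<partial>lborel) \<le> ennreal ((y - x) + x powr (- c) * M)"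
proof -
  have "(\<integral>\<^sup>+r\<in>{x..y}. ennreal \<bar>w r\<bar> \<partial>lborel) \<le> (\<integral>\<^sup>+r. indicator {x..y} r + ennreal (\<bar>w r\<bar> powr p * r powr 0) * indicator {x..y} r \<partial>lborel)"
  proof (rule nn_integral_mono)
    fix r
    have "\<bar>w r\<bar> \<le> 1 + \<bar>w r\<bar> powr p"
    proof (cases "\<bar>w r\<bar> \<le> 1")
      case False
      then have "\<bar>w r\<bar> powr 1 \<le> \<bar>w r\<bar> powr p" using p by (intro powr_mono) auto
      then show ?thesis by simp
    qed (smt (verit) powr_ge_zero)
    then have "r \<in> {x..y} \<Longrightarrow> ennreal \<bar>w r\<bar> \<le> 1 + ennreal (\<bar>w r\<bar> powr p * r powr 0)"
      using x by (auto simp flip: ennreal_1 ennreal_plus intro!: ennreal_leI)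
    then show "ennreal \<bar>w r\<bar> * indicator {x..y} r \<le> indicator {x..y} r + ennreal (\<bar>w r\<bar> powr p * r powr 0) * indicator {x..y} r"
      by (auto split: split_indicator)
  qed
  also have "\<dots> = ennreal (y - x) + wint p 0 {x..y} w"
    unfolding wint_def using x by (subst nn_integral_add) auto
  also have "wint p 0 {x..y} w \<le> ennreal (x powr (- c)) * wint p c {0<..} w"
  proof (rule wint_mono)
    fix r assume r: "r \<in> {x..y}"
    have "x powr c \<le> r powr c" using r x c by (intro powr_mono2) auto
    then show "r powr 0 \<le> x powr (- c) * r powr c" using x r by (simp add: powr_minus field_simps)
  qed (use x in auto)
  also have "\<dots> \<le> ennreal (x powr (- c)) * ennreal M" by (rule mult_left_mono[OF w(1)]) simp
  finally show ?thesis using x w(2) by (simp add: ennreal_mult ennreal_plus add_left_mono)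
qed

text \<open>Near 0 the strict inequality between \<open>(c + 1) * q\<close> and
  \<open>(\<theta> + 1) * p\<close> makes the power that dominates
  \<open>|g n r| powr q * r powr \<theta>\<close> integrable. At infinity \<open>\<delta>\<close> is
  the decay exponent of \<open>|g n| powr p\<close>, and \<open>\<eta>\<close> is what remains of
  the weight exponent; it yields the factor \<open>R powr (- \<eta>)\<close> for the integrals over
  \<open>{R<..}\<close>.\<close>

lemma wint_compactness:
  fixes p q a b c \<theta> \<tau> \<delta> \<eta> :: real
  assumes p: "p \<ge> 1" "p \<le> q" and b: "-1 \<le> b" "b \<le> c" "b \<le> a" and \<theta>: "(c + 1) * q < (\<theta> + 1) * p" "\<theta> \<le> a"
    and \<tau>: "\<tau> \<le> 1" "\<delta> \<le> a + \<tau>" "\<delta> \<le> b + p - \<tau> * (p - 1)"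
    and \<eta>: "\<eta> > 0" "\<theta> - \<delta> * (q - p) / p + \<eta> \<le> a"
    and gw: "\<And>n. primitive (g n) (w n)" and M: "M \<ge> 0"
    and g: "\<And>n. wint p a {0<..} (g n) \<le> ennreal M" and w: "\<And>n. wint p (b + p) {0<..} (w n) \<le> ennreal M"
    and gc: "\<And>n. wint p c {0<..1} (g n) \<le> ennreal M"
  shows "\<exists>s v. strict_mono (s :: nat \<Rightarrow> nat) \<and> v \<in> borel_measurable borel \<and> wint q \<theta> {0<..} v < \<infinity> \<and>
    (\<lambda>n. wint q \<theta> {0<..} (\<lambda>r. g (s n) r - v r)) \<longlonglongrightarrow> 0"
proof -
  have [measurable]: "g n \<in> borel_measurable borel" "w n \<in> borel_measurable borel" for n
    using primitive_measurable[OF gw] by auto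
  have q0: "q > 0" using p by simp
  have wc: "wint p (c + p) {0<..1} (w n) \<le> ennreal M" for n
  proof -
    have "wint p (c + p) {0<..1} (w n) \<le> ennreal 1 * wint p (b + p) {0<..} (w n)"
      using b by (intro wint_mono) (auto intro: powr_mono')
    with w[of n] show ?thesis by simp
  qed
  obtain K where K: "K \<ge> 0" "\<And>n r. r \<in> {0<..1} \<Longrightarrow> \<bar>g n r\<bar> powr p \<le> K * r powr (- (c + 1))"
      "\<And>n r. r \<in> {1..} \<Longrightarrow> \<bar>g n r\<bar> powr p \<le> K * r powr (- \<delta>)"
  proof -
    obtain C1 where C1: "C1 \<ge> 0" "\<And>n r. r\<in>{0<..1} \<Longrightarrow> \<bar>g n r\<bar> powr p \<le> C1 * M * r powr (- (c + 1))"
      using primitive_bound_near_0[OF p(1), of c] gw M gc wc by blast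
    obtain C2 where C2: "C2 \<ge> 0" "\<And>n r. r\<in>{1..} \<Longrightarrow> \<bar>g n r\<bar> powr p \<le> C2 * M * r powr (- \<delta>)"
      using primitive_bound_at_infinity[OF p(1) \<tau>] gw M g w by blast
    have le: "C1 * M * x powr y \<le> max C1 C2 * M * x powr y" "C2 * M * x powr y \<le> max C1 C2 * M * x powr y" for x y
      using M by (auto intro!: mult_right_mono)
    show ?thesis
    proof (rule that[of "max C1 C2 * M"])
      show "0 \<le> max C1 C2 * M" using C1(1) M by simp
      show "\<bar>g n r\<bar> powr p \<le> max C1 C2 * M * r powr (- (c + 1))" if "r \<in> {0<..1}" for n r
        by (rule order_trans[OF C1(2)[OF that] le(1)])
      show "\<bar>g n r\<bar> powr p \<le> max C1 C2 * M * r powr (- \<delta>)" if "r \<in> {1..}" for n r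
        by (rule order_trans[OF C2(2)[OF that] le(2)])
    qed
  qed
  define K' where "K' = K powr (q / p)"
  have bnd: "\<bar>g n r\<bar> powr q * r powr \<theta> \<le> K' * r powr (\<theta> - d * q / p)"
    if "\<bar>g n r\<bar> powr p \<le> K * r powr (- d)" "r > 0" for n r d
  proof -
    have "\<bar>g n r\<bar> powr q = (\<bar>g n r\<bar> powr p) powr (q / p)" using p by (simp add: powr_powr)
    also have "\<dots> \<le> (K * r powr (- d)) powr (q / p)" using that p by (intro powr_mono2) auto
    also have "\<dots> = K' * r powr (- d * q / p)" using K by (simp add: powr_mult powr_powr K'_def)
    finally have "\<bar>g n r\<bar> powr q * r powr \<theta> \<le> K' * r powr (- d * q / p) * r powr \<theta>"
      by (rule mult_right_mono) simp
    also have "\<dots> = K' * r powr (\<theta> - d * q / p)"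
      unfolding mult.assoc powr_add[symmetric] by simp
    finally show ?thesis .
  qed
  have "\<exists>s v. strict_mono (s :: nat \<Rightarrow> nat) \<and> v \<in> borel_measurable borel \<and>
    (AE x in lborel. x > 0 \<longrightarrow> (\<lambda>n. g (s n) x) \<longlonglongrightarrow> v x)"
  proof (rule primitive_subseq_convergent_AE[OF gw])
    fix x :: real assume x: "0 < x"
    have "\<exists>d. \<forall>n. \<bar>g n x\<bar> powr p \<le> K * x powr (- d)"
    proof (cases "x \<le> 1")
      case True
      then show ?thesis using K(2) x by (intro exI[of _ "c + 1"]) auto
    next
      case False
      then show ?thesis using K(3) by (intro exI[of _ \<delta>]) auto
    qed
    then obtain d where d: "\<And>n. \<bar>g n x\<bar> powr p \<le> K * x powr (- d)" by blast
    have "\<bar>g n x\<bar> \<le> (K * x powr (- d)) powr (1 / p)" for n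
    proof -
      have "(\<bar>g n x\<bar> powr p) powr (1 / p) \<le> (K * x powr (- d)) powr (1 / p)"
        using d p by (intro powr_mono2) auto
      then show ?thesis using p by (simp add: powr_powr)
    qed
    then show "\<exists>B. \<forall>n. \<bar>g n x\<bar> \<le> B" by blast
  next
    fix x y :: real assume x: "0 < x" "x \<le> y"
    show "\<exists>B\<ge>0. \<forall>n. (\<integral>\<^sup>+r\<in>{x..y}. ennreal \<bar>w n r\<bar> \<partial>lborel) \<le> ennreal B"
      using nn_integral_abs_le_wint[OF p(1) _ x _ w M] b p M x
      by (intro exI[of _ "(y - x) + x powr (- (b + p)) * M"]) auto
  qed
  then obtain s v where s: "strict_mono (s :: nat \<Rightarrow> nat)" and vb[measurable]: "v \<in> borel_measurable borel"
    and lim: "AE x in lborel. x > 0 \<longrightarrow> (\<lambda>n. g (s n) x) \<longlonglongrightarrow> v x" by blast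
  have v: "wint q \<theta> {0<..} v < \<infinity>"
  proof -
    obtain C where C: "\<And>n. wint q \<theta> {0<..} (g n) \<le> ennreal (C * M powr (q / p))"
      using wint_embedding[OF p b less_imp_le[OF \<theta>(1)] \<theta>(2)] gw M g w gc by blast
    have "wint q \<theta> {0<..} v \<le> ennreal (C * M powr (q / p))"
      by (rule wint_Fatou[OF _ _ _ lim]) (use C q0 in auto)
    then show ?thesis by (rule le_less_trans) simp
  qed
  have tail: "wint q \<theta> {R<..} (\<lambda>r. g (s n) r - v r) \<le> ennreal (2 powr q * (2 * (K powr ((q - p) / p) * R powr (- \<eta>) * M)))"
    if R: "R \<ge> 1" for R n
  proof -
    let ?B = "K powr ((q - p) / p) * R powr (- \<eta>) * M"
    have B: "wint q \<theta> {R<..} (g n) \<le> ennreal ?B" for n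
    proof -
      have "wint q \<theta> {R<..} (g n) \<le> ennreal (K powr ((q - p) / p) * R powr (- \<eta>)) * wint p a {R<..} (g n)"
      proof (rule wint_interpolate[OF p K(1)])
        fix r assume r: "r \<in> {R<..}"
        then show "\<bar>g n r\<bar> powr p \<le> K * r powr (- \<delta>)" using K(3) R by auto
        have "r powr (\<theta> - \<delta> * (q - p) / p) \<le> r powr (- \<eta> + a)" using r R \<eta> by (intro powr_mono) auto
        also have "\<dots> = r powr (- \<eta>) * r powr a" by (rule powr_add)
        also have "\<dots> \<le> R powr (- \<eta>) * r powr a" using r R \<eta> by (intro mult_right_mono powr_mono2') auto
        finally show "r powr (\<theta> - \<delta> * (q - p) / p) \<le> R powr (- \<eta>) * r powr a" .
      qed (use R in auto)
      also have "\<dots> \<le> ennreal (K powr ((q - p) / p) * R powr (- \<eta>)) * ennreal M"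
        using R by (intro mult_left_mono wint_subset_le[OF g]) auto
      finally show ?thesis using M by (simp add: ennreal_mult)
    qed
    have "wint q \<theta> {R<..} v \<le> ennreal ?B"
      by (rule wint_Fatou[OF _ _ _ lim]) (use B q0 R in auto)
    then have "wint q \<theta> {R<..} (g (s n)) + wint q \<theta> {R<..} v \<le> ennreal ?B + ennreal ?B"
      using B by (intro add_mono) auto
    then have "ennreal (2 powr q) * (wint q \<theta> {R<..} (g (s n)) + wint q \<theta> {R<..} v) \<le> ennreal (2 powr q) * (ennreal ?B + ennreal ?B)"
      by (rule mult_left_mono) simp
    with wint_diff_le[of "g (s n)" v "{R<..}" q \<theta>] q0
    have "wint q \<theta> {R<..} (\<lambda>r. g (s n) r - v r) \<le> ennreal (2 powr q) * (ennreal ?B + ennreal ?B)" by auto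
    also have "\<dots> = ennreal (2 powr q * (2 * ?B))" using M by (simp flip: ennreal_mult ennreal_plus)
    finally show ?thesis .
  qed
  have loc: "(\<lambda>n. wint q \<theta> {0<..R} (\<lambda>r. g (s n) r - v r)) \<longlonglongrightarrow> 0" if R: "R \<ge> 1" for R
  proof -
    define e1 where "e1 = \<theta> - (c + 1) * q / p"
    define e2 where "e2 = \<theta> - \<delta> * q / p"
    \<comment> \<open>This is \<open>(c + 1) * q < (\<theta> + 1) * p\<close> divided by
      \<open>p\<close>.\<close>
    have e1: "e1 > -1" using \<theta> p by (simp add: e1_def field_simps)
    \<comment> \<open>The first summand dominates on \<open>(0,1]\<close>, the constant one on
      \<open>(1,R]\<close>, whatever the sign of \<open>e2\<close>.\<close>
    let ?D = "\<lambda>r. K' * (r powr e1 + R powr \<bar>e2\<bar>)"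
    show ?thesis
    proof (rule wint_diff_tendsto_0[OF _ _ _ _ lim, where D = ?D])
      fix n r assume r: "r \<in> {0<..R}"
      have K': "K' \<ge> 0" by (simp add: K'_def)
      show "\<bar>g (s n) r\<bar> powr q * r powr \<theta> \<le> ?D r"
      proof (cases "r \<le> 1")
        case True
        then have "\<bar>g (s n) r\<bar> powr q * r powr \<theta> \<le> K' * r powr e1"
          unfolding e1_def using r K(2) by (intro bnd) auto
        also have "\<dots> \<le> ?D r" using K' by (intro mult_left_mono) auto
        finally show ?thesis .
      next
        case False
        then have "\<bar>g (s n) r\<bar> powr q * r powr \<theta> \<le> K' * r powr e2"
          unfolding e2_def using r K(3) by (intro bnd) auto
        also have "r powr e2 \<le> R powr \<bar>e2\<bar>"
        proof -
          have "r powr e2 \<le> r powr \<bar>e2\<bar>" using False by (intro powr_mono) auto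
          also have "\<dots> \<le> R powr \<bar>e2\<bar>" using False r by (intro powr_mono2) auto
          finally show ?thesis .
        qed
        also have "K' * R powr \<bar>e2\<bar> \<le> ?D r" using K' by (intro mult_left_mono) auto
        finally show ?thesis using K' by (simp add: mult_left_mono)
      qed
    next
      have K': "K' \<ge> 0" by (simp add: K'_def)
      have "(\<integral>\<^sup>+r\<in>{0<..R}. ennreal (?D r) \<partial>lborel) = (\<integral>\<^sup>+r. ennreal K' * (ennreal (r powr e1) * indicator {0<..R} r)
          + ennreal (K' * R powr \<bar>e2\<bar>) * indicator {0<..R} r \<partial>lborel)"
        using K' by (intro nn_integral_cong) (auto split: split_indicator simp: algebra_simps ennreal_mult ennreal_plus)
      also have "\<dots> = ennreal K' * (\<integral>\<^sup>+r\<in>{0<..R}. ennreal (r powr e1) \<partial>lborel) + ennreal (K' * R powr \<bar>e2\<bar>) * ennreal R"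
        using R by (subst nn_integral_add) (auto simp: nn_integral_cmult)
      also have "\<dots> < \<infinity>"
        using R e1 by (subst nn_integral_powr_from_0) (auto simp: ennreal_mult_less_top)
      finally show "(\<integral>\<^sup>+r\<in>{0<..R}. ennreal (?D r) \<partial>lborel) < \<infinity>" .
    qed (use q0 in auto)
  qed
  have "(\<lambda>n. wint q \<theta> {0<..} (\<lambda>r. g (s n) r - v r)) \<longlonglongrightarrow> 0"
  proof (rule order_tendstoI)
    fix y :: ennreal assume y: "0 < y"
    \<comment> \<open>A positive real number below \<open>y\<close>, which may be infinite; one half
      of it is spent on the tail beyond \<open>R\<close>, the other on the bounded part.\<close>
    define z where "z = (if y = \<infinity> then 1 else enn2real y)"
    have z: "z > 0" "ennreal z \<le> y"
      unfolding atomize_conj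
    proof (cases y)
      case (real r)
      then show "z > 0 \<and> ennreal z \<le> y" using y by (simp add: z_def)
    qed (simp add: z_def)
    let ?t = "\<lambda>R. 2 powr q * (2 * (K powr ((q - p) / p) * R powr (- \<eta>) * M))"
    have "((\<lambda>R. R powr (- \<eta>)) \<longlongrightarrow> 0) at_top"
      using \<eta>(1) by (intro tendsto_neg_powr filterlim_ident) simp
    then have "(?t \<longlongrightarrow> 2 powr q * (2 * (K powr ((q - p) / p) * 0 * M))) at_top"
      by (intro tendsto_mult tendsto_const)
    then have "(?t \<longlongrightarrow> 0) at_top" by simp
    from order_tendstoD(2)[OF this, of "z / 2"] z
    have "eventually (\<lambda>R. ?t R < z / 2 \<and> R \<ge> 1) at_top"
      by (intro eventually_conj eventually_ge_at_top) auto
    then obtain R where R: "?t R < z / 2" "R \<ge> 1"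
      using eventually_happens' trivial_limit_at_top_linorder by blast
    have "eventually (\<lambda>n. wint q \<theta> {0<..R} (\<lambda>r. g (s n) r - v r) < ennreal (z / 2)) sequentially"
      using z by (intro order_tendstoD(2)[OF loc[OF R(2)]]) auto
    then show "eventually (\<lambda>n. wint q \<theta> {0<..} (\<lambda>r. g (s n) r - v r) < y) sequentially"
    proof eventually_elim
      case (elim n)
      have eq: "{0<..} = {0<..R} \<union> {R<..}" using R(2) by auto
      have "wint q \<theta> {0<..} (\<lambda>r. g (s n) r - v r) \<le> wint q \<theta> {0<..R} (\<lambda>r. g (s n) r - v r) + wint q \<theta> {R<..} (\<lambda>r. g (s n) r - v r)"
        unfolding eq by (rule wint_Un_le) auto
      also have "\<dots> \<le> wint q \<theta> {0<..R} (\<lambda>r. g (s n) r - v r) + ennreal (z / 2)"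
        by (intro add_left_mono order_trans[OF tail[OF R(2)]] ennreal_leI less_imp_le R(1))
      also have "\<dots> < ennreal (z / 2) + ennreal (z / 2)"
        using elim ennreal_add_left_cancel_less[of "ennreal (z / 2)"] by (simp add: add.commute)
      also have "ennreal (z / 2) + ennreal (z / 2) = ennreal z"
        using z by (subst ennreal_plus[symmetric]) auto
      also note z(2)
      finally show ?case .
    qed
  qed simp
  with s v vb show ?thesis by blast
qed

subsection \<open>Test functions and weak derivatives\<close>

text \<open>A statement about the iterates \<open>(deriv ^^ n) f\<close> of a product has no direct
  induction. Peeling off one derivative at a time, with \<open>f\<close> arbitrary, turns the
  product rule into the induction step.\<close>

primrec diff_upto :: "nat \<Rightarrow> (real \<Rightarrow> real) \<Rightarrow> bool" where
  "diff_upto 0 f \<longleftrightarrow> True"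
| "diff_upto (Suc n) f \<longleftrightarrow> (\<forall>x. f differentiable at x) \<and> diff_upto n (deriv f)"

definition smooth :: "(real \<Rightarrow> real) \<Rightarrow> bool" where
  "smooth f \<longleftrightarrow> (\<forall>n x. (deriv ^^ n) f differentiable at x)"

lemma diff_upto_iff: "diff_upto n f \<longleftrightarrow> (\<forall>m<n. \<forall>x. (deriv ^^ m) f differentiable at x)"
proof (induction n arbitrary: f)
  case (Suc n)
  have "(\<forall>m<Suc n. P m) \<longleftrightarrow> P 0 \<and> (\<forall>m<n. P (Suc m))" for P
    using less_Suc_eq_0_disj by auto
  then show ?case by (simp add: Suc funpow_Suc_right del: funpow.simps(2))
qed simp

lemma smooth_iff_diff_upto: "smooth f \<longleftrightarrow> (\<forall>n. diff_upto n f)"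
  by (auto simp: smooth_def diff_upto_iff)

lemma diff_upto_Suc_imp: "diff_upto (Suc n) f \<Longrightarrow> diff_upto n f"
  by (simp add: diff_upto_iff del: diff_upto.simps)

lemma diff_upto_intro:
  assumes "\<And>x. (f has_real_derivative f' x) (at x)" "diff_upto n f'"
  shows "diff_upto (Suc n) f"
proof -
  have "deriv f = f'" using assms(1) by (intro ext DERIV_imp_deriv)
  then show ?thesis using assms real_differentiable_def by auto
qed

lemma diff_upto_deriv:
  assumes "diff_upto (Suc n) f"
  shows "(f has_real_derivative deriv f x) (at x)" "diff_upto n (deriv f)"
  using assms by (auto simp: DERIV_deriv_iff_real_differentiable)

lemma diff_upto_const: "diff_upto n (\<lambda>x. c)"
proof (induction n arbitrary: c)
  case (Suc n)
  show ?case by (rule diff_upto_intro[where f' = "\<lambda>x. 0"]) (auto simp: Suc)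
qed simp

lemma diff_upto_add: "diff_upto n f \<Longrightarrow> diff_upto n g \<Longrightarrow> diff_upto n (\<lambda>x. f x + g x)"
proof (induction n arbitrary: f g)
  case (Suc n)
  show ?case
    by (rule diff_upto_intro[OF DERIV_add[OF diff_upto_deriv(1)[OF Suc.prems(1)] diff_upto_deriv(1)[OF Suc.prems(2)]]])
       (intro Suc.IH diff_upto_deriv(2) Suc.prems)
qed simp

lemma diff_upto_mult: "diff_upto n f \<Longrightarrow> diff_upto n g \<Longrightarrow> diff_upto n (\<lambda>x. f x * g x)"
proof (induction n arbitrary: f g)
  case (Suc n)
  show ?case
    by (rule diff_upto_intro[OF DERIV_mult[OF diff_upto_deriv(1)[OF Suc.prems(1)] diff_upto_deriv(1)[OF Suc.prems(2)]]])
       (intro diff_upto_add Suc.IH diff_upto_deriv(2)[OF Suc.prems(1)] diff_upto_deriv(2)[OF Suc.prems(2)]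
          diff_upto_Suc_imp[OF Suc.prems(1)] diff_upto_Suc_imp[OF Suc.prems(2)])
qed simp

lemma diff_upto_affine: "diff_upto n f \<Longrightarrow> diff_upto n (\<lambda>x. f (c * x + d))"
proof (induction n arbitrary: f)
  case (Suc n)
  have "((\<lambda>x. f (c * x + d)) has_real_derivative deriv f (c * x + d) * c) (at x)" for x
    by (rule DERIV_chain'[where g = f and f = "\<lambda>x. c * x + d"])
       (auto intro!: derivative_eq_intros diff_upto_deriv(1)[OF Suc.prems])
  then show ?case
    by (rule diff_upto_intro) (intro diff_upto_mult diff_upto_const Suc.IH diff_upto_deriv(2) Suc.prems)
qed simp

text \<open>For \<open>k = 0\<close> and \<open>c > 0\<close> this is the classical smooth function
  that is flat at 0. The powers of \<open>1 / x\<close> make the derivative of a member a linear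
  combination of members, which gives smoothness by induction.\<close>

definition exp_recip :: "real \<Rightarrow> nat \<Rightarrow> real \<Rightarrow> real" where
  "exp_recip c k x = (if x > 0 then (1 / x) ^ k * exp (- c / x) else 0)"

lemma exp_recip_tendsto_0:
  assumes c: "c > 0"
  shows "(exp_recip c k \<longlongrightarrow> 0) (at 0)"
proof (rule filterlim_split_at_real)
  show "(exp_recip c k \<longlongrightarrow> 0) (at_left 0)"
    by (rule tendsto_eventually) (auto simp: exp_recip_def eventually_at_filter)
  \<comment> \<open>In the variable \<open>y = 1 / x\<close> the claim is that the exponential
    outgrows every power.\<close>
  have "((\<lambda>y. (c * y) ^ k / exp (c * y)) \<longlongrightarrow> 0) at_top"
    by (rule filterlim_compose[OF tendsto_power_div_exp_0])
       (use c in \<open>auto intro!: filterlim_tendsto_pos_mult_at_top filterlim_ident\<close>)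
  from tendsto_mult_right[OF this, of "1 / c ^ k"]
  have "((\<lambda>y. y ^ k * exp (- (c * y))) \<longlongrightarrow> 0) at_top"
    using c by (simp add: power_mult_distrib exp_minus field_simps)
  then have "((\<lambda>x. (inverse x) ^ k * exp (- (c * inverse x))) \<longlongrightarrow> 0) (at_right 0)"
    by (rule filterlim_compose[OF _ filterlim_inverse_at_top_right])
  then show "(exp_recip c k \<longlongrightarrow> 0) (at_right 0)"
    by (rule Lim_transform_eventually) (auto simp: exp_recip_def eventually_at_filter divide_inverse)
qed

lemma exp_recip_deriv:
  assumes c: "c > 0"
  shows "(exp_recip c k has_real_derivative (c * exp_recip c (k + 2) x + - real k * exp_recip c (k + 1) x)) (at x)"
proof -
  consider "x > 0" | "x < 0" | "x = 0" by linarith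
  then show ?thesis
  proof cases
    case 1
    have "((\<lambda>x. (1 / x) ^ k * exp (- c / x)) has_real_derivative
      (c * exp_recip c (k + 2) x + - real k * exp_recip c (k + 1) x)) (at x)"
    proof -
      have d1: "((\<lambda>x. 1 / x) has_real_derivative - ((1 / x)\<^sup>2)) (at x)"
        using 1 by (auto intro!: derivative_eq_intros simp: power2_eq_square)
      have d2: "((\<lambda>x. - c / x) has_real_derivative c * (1 / x)\<^sup>2) (at x)"
        using 1 by (auto intro!: derivative_eq_intros simp: power2_eq_square)
      \<comment> \<open>\<open>k - Suc 0\<close> is truncated at \<open>k = 0\<close>, where the
        factor \<open>real k\<close> makes both sides vanish.\<close>
      have k: "real k * (- (y\<^sup>2) * y ^ (k - Suc 0)) = - real k * y ^ (k + 1)" for y :: real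
        by (cases k) (auto simp: power2_eq_square algebra_simps)
      have "((\<lambda>x. (1 / x) ^ k * exp (- c / x)) has_real_derivative
          real k * (- ((1 / x)\<^sup>2) * (1 / x) ^ (k - Suc 0)) * exp (- c / x) + exp (- c / x) * (c * (1 / x)\<^sup>2) * (1 / x) ^ k) (at x)"
        by (rule DERIV_mult[OF DERIV_power[OF d1] DERIV_chain'[OF d2 DERIV_exp]])
      also have "real k * (- ((1 / x)\<^sup>2) * (1 / x) ^ (k - Suc 0)) * exp (- c / x) + exp (- c / x) * (c * (1 / x)\<^sup>2) * (1 / x) ^ k
          = c * exp_recip c (k + 2) x + - real k * exp_recip c (k + 1) x"
        unfolding k exp_recip_def using 1 by (simp add: power_add power2_eq_square mult_ac)
      finally show ?thesis .
    qed
    then show ?thesis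
      by (rule has_field_derivative_transform_within_open[where S = "{0<..}"]) (use 1 in \<open>auto simp: exp_recip_def\<close>)
  next
    case 2
    have "((\<lambda>x. 0) has_real_derivative (c * exp_recip c (k + 2) x + - real k * exp_recip c (k + 1) x)) (at x)"
      using 2 by (simp add: exp_recip_def)
    then show ?thesis
      by (rule has_field_derivative_transform_within_open[where S = "{..<0}"]) (use 2 in \<open>auto simp: exp_recip_def\<close>)
  next
    case 3
    \<comment> \<open>For \<open>h \<noteq> 0\<close> the difference quotient at 0 is
      \<open>exp_recip c (Suc k) h\<close>.\<close>
    have "((\<lambda>h. (exp_recip c k (0 + h) - exp_recip c k 0) / h) \<longlongrightarrow> 0) (at 0)"
      by (rule Lim_transform_eventually[OF exp_recip_tendsto_0[OF c, of "Suc k"]])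
         (auto simp: exp_recip_def eventually_at_filter)
    then show ?thesis unfolding 3 DERIV_def by (simp add: exp_recip_def)
  qed
qed

lemma diff_upto_exp_recip: "c > 0 \<Longrightarrow> diff_upto n (exp_recip c k)"
proof (induction n arbitrary: k)
  case (Suc n)
  show ?case
    by (rule diff_upto_intro[OF exp_recip_deriv[OF Suc.prems]])
       (intro diff_upto_add diff_upto_mult diff_upto_const Suc)
qed simp

lemma test_functions_iff:
  "\<phi> \<in> test_functions \<longleftrightarrow> smooth \<phi> \<and> (\<exists>A B. 0 < A \<and> A < B \<and> (\<forall>x. x \<notin> {A..B} \<longrightarrow> \<phi> x = 0))"
proof (intro iffI; (elim conjE exE)?)
  assume "\<phi> \<in> test_functions"
  then have \<phi>: "smooth \<phi>" "compact (closure {x. \<phi> x \<noteq> 0})" "closure {x. \<phi> x \<noteq> 0} \<subseteq> {0<..}"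
    by (auto simp: test_functions_def smooth_def)
  let ?K = "closure {x. \<phi> x \<noteq> 0}"
  have "\<exists>A B. 0 < A \<and> A < B \<and> (\<forall>x. x \<notin> {A..B} \<longrightarrow> \<phi> x = 0)"
  proof (cases "?K = {}")
    case True
    then have "\<phi> x = 0" for x by auto
    then show ?thesis by (intro exI[of _ 1] exI[of _ 2]) auto
  next
    case False
    obtain A where A: "A \<in> ?K" "\<And>x. x \<in> ?K \<Longrightarrow> A \<le> x" using compact_attains_inf[OF \<phi>(2) False] by blast
    obtain B where B: "B \<in> ?K" "\<And>x. x \<in> ?K \<Longrightarrow> x \<le> B" using compact_attains_sup[OF \<phi>(2) False] by blast
    \<comment> \<open>\<open>B + 1\<close> instead of \<open>B\<close> keeps the left end strictly
      below the right one.\<close>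
    have "\<phi> x = 0" if "x \<notin> {A..B + 1}" for x
    proof (rule ccontr)
      assume "\<phi> x \<noteq> 0"
      then have "x \<in> ?K" by (intro subsetD[OF closure_subset]) simp
      from A(2)[OF this] B(2)[OF this] that show False by auto
    qed
    moreover have "0 < A" "A < B + 1" using A B \<phi>(3) by fastforce+
    ultimately show ?thesis by blast
  qed
  with \<phi> show "smooth \<phi> \<and> (\<exists>A B. 0 < A \<and> A < B \<and> (\<forall>x. x \<notin> {A..B} \<longrightarrow> \<phi> x = 0))" by blast
next
  fix A B :: real assume *: "smooth \<phi>" "0 < A" "A < B" "\<forall>x. x \<notin> {A..B} \<longrightarrow> \<phi> x = 0"
  then have sub: "closure {x. \<phi> x \<noteq> 0} \<subseteq> {A..B}" by (intro closure_minimal) auto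
  then have "compact (closure {x. \<phi> x \<noteq> 0})"
    by (metis bounded_closed_interval bounded_subset closed_closure compact_eq_bounded_closed)
  with sub * show "\<phi> \<in> test_functions" by (force simp: test_functions_def smooth_def)
qed

lemma test_function_continuous:
  assumes "\<phi> \<in> test_functions"
  shows "continuous_on S \<phi>" "\<phi> \<in> borel_measurable borel"
proof -
  have "(deriv ^^ 0) \<phi> differentiable at x" for x using assms unfolding test_functions_def by blast
  then have *: "isCont \<phi> x" for x by (simp add: differentiable_imp_continuous_within)
  then show "continuous_on S \<phi>" by (simp add: continuous_at_imp_continuous_on)
  show "\<phi> \<in> borel_measurable borel"
    using * by (intro borel_measurable_continuous_onI) (simp add: continuous_at_imp_continuous_on)
qed

lemma test_function_deriv:
  assumes "\<phi> \<in> test_functions"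
  shows "deriv \<phi> \<in> test_functions" "(\<phi> has_real_derivative deriv \<phi> x) (at x)"
proof -
  obtain A B where *: "smooth \<phi>" "0 < A" "A < B" "\<And>x. x \<notin> {A..B} \<Longrightarrow> \<phi> x = 0"
    using assms by (auto simp: test_functions_iff)
  have "smooth (deriv \<phi>)" using * by (simp add: smooth_iff_diff_upto) (metis diff_upto.simps(2))
  moreover have "deriv \<phi> x = 0" if "x \<notin> {A..B}" for x
  proof (rule DERIV_imp_deriv)
    have "open (- {A..B})" by auto
    then show "(\<phi> has_real_derivative 0) (at x)"
      by (rule has_field_derivative_transform_within_open[OF DERIV_const[of 0]]) (use that * in auto)
  qed
  ultimately show "deriv \<phi> \<in> test_functions" using * by (auto simp: test_functions_iff)
  have "diff_upto (Suc 0) \<phi>" using * unfolding smooth_iff_diff_upto by blast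
  then show "(\<phi> has_real_derivative deriv \<phi> x) (at x)" by (rule diff_upto_deriv)
qed

lemma test_functions_add_cmult:
  assumes "\<phi> \<in> test_functions" "\<psi> \<in> test_functions"
  shows "(\<lambda>x. \<phi> x + c * \<psi> x) \<in> test_functions"
proof -
  obtain A B where *: "smooth \<phi>" "0 < A" "A < B" "\<And>x. x \<notin> {A..B} \<Longrightarrow> \<phi> x = 0"
    using assms by (auto simp: test_functions_iff)
  obtain A' B' where **: "smooth \<psi>" "0 < A'" "A' < B'" "\<And>x. x \<notin> {A'..B'} \<Longrightarrow> \<psi> x = 0"
    using assms by (auto simp: test_functions_iff)
  have "smooth (\<lambda>x. \<phi> x + c * \<psi> x)"
    using * ** by (auto simp: smooth_iff_diff_upto intro!: diff_upto_add diff_upto_mult diff_upto_const)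
  moreover have "\<phi> x + c * \<psi> x = 0" if "x \<notin> {min A A'..max B B'}" for x
  proof -
    have "x \<notin> {A..B}" "x \<notin> {A'..B'}" using that by auto
    then show ?thesis using * ** by simp
  qed
  ultimately show ?thesis
    unfolding test_functions_iff using * ** by (intro conjI exI[of _ "min A A'"] exI[of _ "max B B'"]) auto
qed

text \<open>The antiderivative normalised at \<open>A\<close> vanishes to the left of the support;
  to the right of it, it equals the total integral of \<open>\<psi>\<close>, which is zero.\<close>

lemma test_function_primitive:
  assumes \<psi>: "\<psi> \<in> test_functions" and zero: "(LINT x|lborel. \<psi> x) = 0"
  shows "\<exists>\<phi>\<in>test_functions. deriv \<phi> = \<psi>"
proof -
  obtain A B where *: "smooth \<psi>" "0 < A" "A < B" "\<And>x. x \<notin> {A..B} \<Longrightarrow> \<psi> x = 0"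
    using assms by (auto simp: test_functions_iff)
  have "isCont \<psi> x" for x
    using test_function_continuous(1)[OF \<psi>, of UNIV] by (simp add: continuous_on_eq_continuous_at)
  then obtain F where F: "\<And>x. (F has_vector_derivative \<psi> x) (at x)"
    using einterval_antiderivative[of "-\<infinity>" "\<infinity>" \<psi>] by auto
  define \<phi> where "\<phi> x = F x - F A" for x
  have D: "(\<phi> has_real_derivative \<psi> x) (at x)" for x
    unfolding \<phi>_def using F[of x] by (auto intro!: derivative_eq_intros simp: has_real_derivative_iff_has_vector_derivative)
  then have d: "deriv \<phi> = \<psi>" by (intro ext DERIV_imp_deriv)
  have AB: "F B - F A = 0"
  proof -
    have "(LINT x:{A..B}|lborel. \<psi> x) = F B - F A"
      unfolding set_lebesgue_integral_def
      by (rule integral_FTC_Icc)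
         (use * F test_function_continuous(1)[OF \<psi>] in \<open>auto intro: has_vector_derivative_at_within\<close>)
    moreover have "(LINT x:{A..B}|lborel. \<psi> x) = (LINT x|lborel. \<psi> x)"
      unfolding set_lebesgue_integral_def
      by (intro Bochner_Integration.integral_cong) (use * in \<open>auto split: split_indicator\<close>)
    ultimately show ?thesis using zero by simp
  qed
  have cst: "F x = F y" if "x < y" "{x<..<y} \<inter> {A..B} = {}" for x y
  proof -
    have "F y = F x"
    proof (rule DERIV_isconst_end[OF that(1)])
      show "continuous_on {x..y} F"
        using F by (intro continuous_at_imp_continuous_on ballI) (metis has_vector_derivative_continuous)
      show "DERIV F z :> 0" if "x < z" "z < y" for z
      proof -
        have "z \<notin> {A..B}" using that \<open>_ = {}\<close> by (metis IntI empty_iff greaterThanLessThan_iff)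
        then show ?thesis using F[of z] *(4)[of z] by (simp add: has_real_derivative_iff_has_vector_derivative)
      qed
    qed
    then show ?thesis by simp
  qed
  have "\<phi> x = 0" if "x \<notin> {A..B}" for x
  proof (cases "x < A")
    case True
    have "{x<..<A} \<inter> {A..B} = {}" by auto
    from cst[OF True this] show ?thesis by (simp add: \<phi>_def)
  next
    case False
    then have x: "B < x" using that by auto
    have "{B<..<x} \<inter> {A..B} = {}" by auto
    from cst[OF x this] AB show ?thesis by (simp add: \<phi>_def)
  qed
  moreover have "smooth \<phi>"
    unfolding smooth_iff_diff_upto
  proof
    fix n
    have "\<phi> differentiable at x" for x using D real_differentiable_def by blast
    then show "diff_upto n \<phi>"
      using * by (cases n) (auto simp: d smooth_iff_diff_upto)
  qed
  ultimately have "\<phi> \<in> test_functions" using * by (auto simp: test_functions_iff)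
  with d show ?thesis by blast
qed

text \<open>On \<open>(a, b)\<close> this is \<open>exp (-c / (x - a) - c / (b - x))\<close>, which tends to \<open>1\<close> as \<open>c = 1 / (n + 1)\<close> tends to \<open>0\<close>.\<close>

definition bump :: "real \<Rightarrow> real \<Rightarrow> nat \<Rightarrow> real \<Rightarrow> real" where
  "bump a b n x = exp_recip (1 / Suc n) 0 (x - a) * exp_recip (1 / Suc n) 0 (b - x)"

lemma bump_test_function:
  assumes "0 < a" "a < b"
  shows "bump a b n \<in> test_functions"
proof -
  let ?f = "exp_recip (1 / Suc n) 0"
  have "smooth (\<lambda>x. ?f (1 * x + - a) * ?f (- 1 * x + b))"
    unfolding smooth_iff_diff_upto
    by (intro allI diff_upto_mult diff_upto_affine[where f = ?f] diff_upto_exp_recip) simp_all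
  also have "(\<lambda>x. ?f (1 * x + - a) * ?f (- 1 * x + b)) = bump a b n" by (simp add: bump_def fun_eq_iff)
  finally have "smooth (bump a b n)" .
  moreover have "bump a b n x = 0" if "x \<notin> {a..b}" for x
    using that by (auto simp: bump_def exp_recip_def)
  ultimately show ?thesis using assms by (auto simp: test_functions_iff)
qed

lemma bump_bounds: "0 \<le> bump a b n x" "bump a b n x \<le> indicator {a..b} x"
  by (auto simp: bump_def exp_recip_def split: split_indicator intro!: mult_le_one)

lemma bump_tendsto: "(\<lambda>n. bump a b n x) \<longlonglongrightarrow> indicator {a<..<b} x"
proof (cases "x \<in> {a<..<b}")
  case True
  have *: "(\<lambda>n. 1 / real (Suc n)) \<longlonglongrightarrow> 0" by (rule LIMSEQ_Suc[OF lim_const_over_n])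
  have "(\<lambda>n. exp (- (1 / real (Suc n)) / (x - a)) * exp (- (1 / real (Suc n)) / (b - x))) \<longlonglongrightarrow> exp (- 0 / (x - a)) * exp (- 0 / (b - x))"
    using True by (intro tendsto_intros *) auto
  then show ?thesis using True by (simp add: bump_def exp_recip_def)
qed (auto simp: bump_def exp_recip_def)

text \<open>Local integrability for Borel functions and \<open>lborel\<close>. Closed intervals
  suffice, since every compact subset of \<open>(0,\<infinity>)\<close> lies in one with positive
  left end.\<close>

definition borel_loc_int :: "(real \<Rightarrow> real) \<Rightarrow> bool" where
  "borel_loc_int u \<longleftrightarrow> u \<in> borel_measurable borel \<and>
     (\<forall>x y. 0 < x \<longrightarrow> x \<le> y \<longrightarrow> set_integrable lborel {x..y} u)"

lemma borel_loc_int_diff: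
  "borel_loc_int u \<Longrightarrow> borel_loc_int v \<Longrightarrow> borel_loc_int (\<lambda>x. u x - v x)"
  by (auto simp: borel_loc_int_def intro: set_integral_diff(1))

lemma borel_loc_int_const: "borel_loc_int (\<lambda>x. c)"
  by (auto simp: borel_loc_int_def set_integrable_def)

lemma borel_loc_int_primitive:
  assumes "primitive g w"
  shows "borel_loc_int g" "borel_loc_int w"
proof -
  have "set_integrable lborel {x..y} g" if "0 < x" for x y
    using that by (intro borel_integrable_compact[unfolded] borel_integrable_atLeastAtMost')
      (auto intro: continuous_on_subset[OF primitive_continuous[OF assms]])
  then show "borel_loc_int g" "borel_loc_int w"
    using assms by (auto simp: borel_loc_int_def primitive_def)
qed

lemma integrable_mult_bounded_support:
  assumes u: "borel_loc_int u" and [measurable]: "\<phi> \<in> borel_measurable borel"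
    and A: "0 < A" "A \<le> B" and \<phi>: "\<And>x. \<bar>\<phi> x\<bar> \<le> C * indicator {A..B} x"
  shows "integrable lborel (\<lambda>x. u x * \<phi> x)"
proof (rule Bochner_Integration.integrable_bound)
  have [measurable]: "u \<in> borel_measurable borel" using u by (simp add: borel_loc_int_def)
  show "(\<lambda>x. u x * \<phi> x) \<in> borel_measurable lborel" by measurable
  show "integrable lborel (\<lambda>x. C * (indicator {A..B} x *\<^sub>R u x))"
    using u A by (auto simp: borel_loc_int_def set_integrable_def)
  show "AE x in lborel. norm (u x * \<phi> x) \<le> norm (C * (indicator {A..B} x *\<^sub>R u x))"
  proof (rule AE_I2)
    fix x
    have "\<bar>u x\<bar> * \<bar>\<phi> x\<bar> \<le> \<bar>u x\<bar> * (\<bar>C\<bar> * indicator {A..B} x)"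
      using \<phi>[of x] by (intro mult_left_mono) (auto split: split_indicator)
    then show "norm (u x * \<phi> x) \<le> norm (C * (indicator {A..B} x *\<^sub>R u x))"
      by (simp add: abs_mult mult_ac)
  qed
qed

text \<open>The support interval is enlarged to \<open>{A / 2..B + 1}\<close> so that
  \<open>\<phi>\<close> vanishes at the end points too; integration by parts then has no boundary
  terms.\<close>

lemma test_function_bounded_support:
  assumes "\<phi> \<in> test_functions"
  obtains A B C where "0 < A" "A < B" "\<And>x. x \<notin> {A<..<B} \<Longrightarrow> \<phi> x = 0" "\<And>x. \<bar>\<phi> x\<bar> \<le> C * indicator {A..B} x"
proof -
  obtain A B where *: "0 < A" "A < B" "\<And>x. x \<notin> {A..B} \<Longrightarrow> \<phi> x = 0"
    using assms by (auto simp: test_functions_iff)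
  have "compact (\<phi> ` {A / 2..B + 1})"
    by (intro compact_continuous_image test_function_continuous assms) auto
  then have "bounded (\<phi> ` {A / 2..B + 1})" by (rule compact_imp_bounded)
  then obtain C where "\<forall>y\<in>\<phi> ` {A / 2..B + 1}. norm y \<le> C" unfolding bounded_iff by blast
  then have C: "\<And>x. x \<in> {A / 2..B + 1} \<Longrightarrow> \<bar>\<phi> x\<bar> \<le> C" by auto
  show ?thesis
    by (rule that[of "A / 2" "B + 1" C]) (use * C in \<open>auto split: split_indicator\<close>)
qed

lemma integrable_mult_test_function:
  assumes "borel_loc_int u" "\<phi> \<in> test_functions"
  shows "integrable lborel (\<lambda>x. u x * \<phi> x)"
proof -
  obtain A B C where *: "0 < A" "A < B" "\<And>x. x \<notin> {A<..<B} \<Longrightarrow> \<phi> x = 0" "\<And>x. \<bar>\<phi> x\<bar> \<le> C * indicator {A..B} x"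
    using test_function_bounded_support[OF assms(2)] by blast
  show ?thesis
    by (rule integrable_mult_bounded_support[OF assms(1) _ _ _ *(4)])
       (use * test_function_continuous[OF assms(2)] in auto)
qed

section \<open>The fundamental lemma and functions with vanishing weak derivative\<close>

lemma bump_integral_tendsto:
  assumes u: "borel_loc_int u" and a: "0 < a" "a < b"
  shows "(\<lambda>n. LINT x|lborel. u x * bump a b n x) \<longlonglongrightarrow> (LINT x:{a<..<b}|lborel. u x)"
proof -
  have [measurable]: "u \<in> borel_measurable borel" "bump a b n \<in> borel_measurable borel" for n
    using u test_function_continuous(2)[OF bump_test_function[OF a]] by (auto simp: borel_loc_int_def)
  have "(\<lambda>n. LINT x|lborel. u x * bump a b n x) \<longlonglongrightarrow> (LINT x|lborel. u x * indicator {a<..<b} x)"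
  proof (rule integral_dominated_convergence[where w = "\<lambda>x. \<bar>indicator {a..b} x *\<^sub>R u x\<bar>"])
    show "integrable lborel (\<lambda>x. \<bar>indicator {a..b} x *\<^sub>R u x\<bar>)"
      using u a by (intro integrable_abs) (auto simp: borel_loc_int_def set_integrable_def)
    show "AE x in lborel. (\<lambda>n. u x * bump a b n x) \<longlonglongrightarrow> u x * indicator {a<..<b} x"
      by (intro AE_I2 tendsto_mult_left bump_tendsto)
    show "AE x in lborel. norm (u x * bump a b n x) \<le> \<bar>indicator {a..b} x *\<^sub>R u x\<bar>" for n
    proof (rule AE_I2)
      fix x
      have "\<bar>u x\<bar> * bump a b n x \<le> \<bar>u x\<bar> * indicator {a..b} x"
        using bump_bounds(2)[of a b n x] by (intro mult_left_mono) auto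
      then show "norm (u x * bump a b n x) \<le> \<bar>indicator {a..b} x *\<^sub>R u x\<bar>"
        using bump_bounds(1)[of a b n x] by (simp add: abs_mult mult.commute)
    qed
  qed auto
  then show ?thesis by (simp add: set_lebesgue_integral_def mult.commute)
qed

text \<open>Cut off to \<open>(A,B)\<close>, the positive and the negative part of \<open>u\<close>
  are densities of two finite measures that agree on all rays \<open>{x<..}\<close>. Such measures
  coincide, so the two parts agree almost everywhere and \<open>u\<close> vanishes there.\<close>

lemma AE_zero_if_interval_integrals_zero:
  assumes u: "borel_loc_int u" and zero: "\<And>a b. 0 < a \<Longrightarrow> a < b \<Longrightarrow> (LINT x:{a<..<b}|lborel. u x) = 0"
  shows "AE x in lborel. x > 0 \<longrightarrow> u x = 0"
proof -
  have [measurable]: "u \<in> borel_measurable borel" using u by (auto simp: borel_loc_int_def)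
  have *: "AE x in lborel. x \<in> {A<..<B} \<longrightarrow> u x = 0" if A: "0 < A" for A B
  proof -
    define f where "f x = indicator {A<..<B} x * u x" for x
    have [measurable]: "f \<in> borel_measurable borel" unfolding f_def[abs_def] by measurable
    have f: "integrable lborel f"
    proof -
      have "set_integrable lborel {A..max A B} u" using u A unfolding borel_loc_int_def by simp
      then have "set_integrable lborel {A<..<B} u" by (rule set_integrable_subset) auto
      then show ?thesis unfolding f_def[abs_def] set_integrable_def by simp
    qed
    have "density lborel (\<lambda>x. ennreal (f x)) = density lborel (\<lambda>x. ennreal (- f x))"
    proof (rule measure_eqI_lessThan)
      fix x :: real
      define h where "h y = indicator {x<..} y * f y" for y
      have h: "integrable lborel h"
        unfolding h_def[abs_def] using integrable_mult_indicator[OF _ f, of "{x<..}"] by simp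
      \<comment> \<open>A ray cut by \<open>(A,B)\<close> is empty or an open interval, over which
        the integral of \<open>u\<close> is zero by hypothesis.\<close>
      have h_eq: "h = (\<lambda>y. indicator {max x A<..<B} y * u y)" by (auto simp: h_def f_def split: split_indicator)
      have "(LINT y|lborel. h y) = 0"
      proof (cases "max x A < B")
        case True
        then show ?thesis using zero[of "max x A" B] A by (simp add: h_eq set_lebesgue_integral_def)
      qed (auto simp: h_eq)
      then have "enn2real (\<integral>\<^sup>+y. ennreal (h y) \<partial>lborel) = enn2real (\<integral>\<^sup>+y. ennreal (- h y) \<partial>lborel)"
        using real_lebesgue_integral_def[OF h] by simp
      moreover have fin: "(\<integral>\<^sup>+y. ennreal (h y) \<partial>lborel) \<noteq> \<infinity>" "(\<integral>\<^sup>+y. ennreal (- h y) \<partial>lborel) \<noteq> \<infinity>"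
        using h unfolding real_integrable_def by blast+
      \<comment> \<open>\<open>enn2real\<close> sends infinity to 0, so cancelling it requires
        finiteness.\<close>
      moreover have enn: "X = Y" if "enn2real X = enn2real Y" "X \<noteq> \<infinity>" "Y \<noteq> \<infinity>" for X Y :: ennreal
        using that by (cases X; cases Y) auto
      ultimately have eq: "(\<integral>\<^sup>+y. ennreal (h y) \<partial>lborel) = (\<integral>\<^sup>+y. ennreal (- h y) \<partial>lborel)"
        by (intro enn)
      have e1: "emeasure (density lborel (\<lambda>x. ennreal (f x))) {x<..} = (\<integral>\<^sup>+y. ennreal (h y) \<partial>lborel)"
        by (subst emeasure_density) (auto simp: h_def intro!: nn_integral_cong split: split_indicator)
      have e2: "emeasure (density lborel (\<lambda>x. ennreal (- f x))) {x<..} = (\<integral>\<^sup>+y. ennreal (- h y) \<partial>lborel)"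
        by (subst emeasure_density) (auto simp: h_def intro!: nn_integral_cong split: split_indicator)
      note e = e1 e2
      show "emeasure (density lborel (\<lambda>x. ennreal (f x))) {x<..} = emeasure (density lborel (\<lambda>x. ennreal (- f x))) {x<..}"
        using e eq by simp
      show "emeasure (density lborel (\<lambda>x. ennreal (f x))) {x<..} < \<infinity>"
        using e fin by (simp add: less_top)
    qed auto
    then have "AE x in lborel. ennreal (f x) = ennreal (- f x)"
      by (intro sigma_finite_measure.density_unique_iff[OF sigma_finite_lborel, THEN iffD1]) auto
    then show ?thesis
    proof eventually_elim
      case (elim x)
      show ?case
      proof
        assume x: "x \<in> {A<..<B}"
        show "u x = 0"
          using elim x by (cases "f x \<ge> 0") (auto simp: f_def ennreal_neg)
      qed
    qed
  qed
  have "AE x in lborel. \<forall>n::nat. x \<in> {1 / Suc n<..<Suc n} \<longrightarrow> u x = 0"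
    unfolding AE_all_countable using * by auto
  then show ?thesis
  proof eventually_elim
    case (elim x)
    show ?case
    proof
      assume x: "x > 0"
      obtain n1 :: nat where n1: "inverse (Suc n1) < x" using reals_Archimedean[OF x] by blast
      obtain n2 :: nat where n2: "x < real n2" using reals_Archimedean2 by blast
      define n where "n = max n1 n2"
      have "1 / Suc n \<le> 1 / Suc n1" "real n2 \<le> Suc n" by (auto simp: n_def field_simps)
      with n1 n2 have "x \<in> {1 / Suc n<..<Suc n}" by (auto simp: inverse_eq_divide)
      with elim show "u x = 0" by blast
    qed
  qed
qed

lemma fundamental_lemma_of_variations:
  assumes u: "borel_loc_int u" and zero: "\<And>\<phi>. \<phi> \<in> test_functions \<Longrightarrow> (LINT x|lborel. u x * \<phi> x) = 0"
  shows "AE x in lborel. x > 0 \<longrightarrow> u x = 0"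
proof (rule AE_zero_if_interval_integrals_zero[OF u])
  fix a b :: real assume a: "0 < a" "a < b"
  show "(LINT x:{a<..<b}|lborel. u x) = 0"
    using bump_integral_tendsto[OF u a] zero[OF bump_test_function[OF a]] by (simp add: LIMSEQ_const_iff)
qed

text \<open>The lemma of du Bois-Reymond. A test function minus a suitable multiple of a fixed bump
  has integral zero and is thus the derivative of a test function, so \<open>u - c\<close> is
  orthogonal to every test function.\<close>

lemma AE_const_if_weak_deriv_zero:
  assumes u: "borel_loc_int u" and zero: "\<And>\<phi>. \<phi> \<in> test_functions \<Longrightarrow> (LINT x|lborel. u x * deriv \<phi> x) = 0"
  shows "\<exists>c. AE x in lborel. x > 0 \<longrightarrow> u x = c"
proof -
  \<comment> \<open>The limit is the length of \<open>(1,2)\<close>, so some bump has a positive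
    integral.\<close>
  have "(\<lambda>n. LINT x|lborel. bump 1 2 n x) \<longlonglongrightarrow> 1"
    using bump_integral_tendsto[OF borel_loc_int_const[of 1], of 1 2] by (simp add: set_lebesgue_integral_def)
  from order_tendstoD(1)[OF this, of 0] obtain n where n: "(LINT x|lborel. bump 1 2 n x) > 0"
    by (auto simp: eventually_sequentially)
  define I where "I = (LINT x|lborel. bump 1 2 n x)"
  define c where "c = (LINT x|lborel. u x * bump 1 2 n x) / I"
  have b: "bump 1 2 n \<in> test_functions" by (rule bump_test_function) auto
  have int1: "integrable lborel \<phi>" if "\<phi> \<in> test_functions" for \<phi>
    using integrable_mult_test_function[OF borel_loc_int_const[of 1] that] by simp
  have "AE x in lborel. x > 0 \<longrightarrow> u x - c = 0"
  proof (rule fundamental_lemma_of_variations)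
    show "borel_loc_int (\<lambda>x. u x - c)" by (intro borel_loc_int_diff u borel_loc_int_const)
    fix \<phi> assume \<phi>: "\<phi> \<in> test_functions"
    define J where "J = (LINT x|lborel. \<phi> x)"
    let ?\<psi> = "\<lambda>x. \<phi> x + (- J / I) * bump 1 2 n x"
    have \<psi>: "?\<psi> \<in> test_functions" by (rule test_functions_add_cmult[OF \<phi> b])
    have "(LINT x|lborel. ?\<psi> x) = J + (- J / I) * I"
      unfolding J_def I_def using int1[OF \<phi>] int1[OF b]
      by (subst Bochner_Integration.integral_add) auto
    also have "\<dots> = 0" using n by (simp add: I_def)
    finally obtain \<xi> where \<xi>: "\<xi> \<in> test_functions" "deriv \<xi> = ?\<psi>"
      using test_function_primitive[OF \<psi>] by blast
    from zero[OF \<xi>(1)] have "0 = (LINT x|lborel. u x * ?\<psi> x)" by (simp add: \<xi>(2))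
    also have "\<dots> = (LINT x|lborel. u x * \<phi> x + (- J / I) * (u x * bump 1 2 n x))"
      by (simp add: algebra_simps)
    also have "\<dots> = (LINT x|lborel. u x * \<phi> x) + (- J / I) * (LINT x|lborel. u x * bump 1 2 n x)"
      using integrable_mult_test_function[OF u \<phi>] integrable_mult_test_function[OF u b]
      by (subst Bochner_Integration.integral_add) auto
    finally have *: "(LINT x|lborel. u x * \<phi> x) = c * J" by (simp add: c_def)
    have "(LINT x|lborel. (u x - c) * \<phi> x) = (LINT x|lborel. u x * \<phi> x - c * \<phi> x)"
      by (simp add: algebra_simps)
    also have "\<dots> = (LINT x|lborel. u x * \<phi> x) - c * J"
      unfolding J_def using integrable_mult_test_function[OF u \<phi>] int1[OF \<phi>]
      by (subst Bochner_Integration.integral_diff) auto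
    finally show "(LINT x|lborel. (u x - c) * \<phi> x) = 0" using * by simp
  qed
  then show ?thesis by auto
qed

text \<open>In general \<open>g\<close> is differentiable only almost everywhere, so no product rule
  is used. Instead \<open>g x\<close> is written as \<open>g A\<close> plus the integral of
  \<open>w\<close> over \<open>{A..x}\<close>, the order of integration is exchanged, and the inner
  integral of \<open>deriv \<phi>\<close> over \<open>{t..B}\<close> is
  \<open>- \<phi> t\<close>.\<close>

lemma primitive_integration_by_parts:
  assumes gw: "primitive g w" and \<phi>: "\<phi> \<in> test_functions"
  shows "(LINT x|lborel. g x * deriv \<phi> x) = - (LINT x|lborel. w x * \<phi> x)"
proof -
  note [measurable] = primitive_measurable[OF gw]
  have [measurable]: "\<phi> \<in> borel_measurable borel" "deriv \<phi> \<in> borel_measurable borel"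
    using \<phi> test_function_deriv test_function_continuous by blast+
  obtain A B C where *: "0 < A" "A < B" "\<And>x. x \<notin> {A<..<B} \<Longrightarrow> deriv \<phi> x = 0" "\<And>x. \<bar>deriv \<phi> x\<bar> \<le> C * indicator {A..B} x"
    and \<phi>0: "\<And>x. x \<notin> {A<..<B} \<Longrightarrow> \<phi> x = 0"
  proof -
    obtain A B C where *: "0 < A" "A < B" "\<And>x. x \<notin> {A<..<B} \<Longrightarrow> \<phi> x = 0" "\<And>x. \<bar>\<phi> x\<bar> \<le> C * indicator {A..B} x"
      using test_function_bounded_support[OF \<phi>] by blast
    obtain A' B' C' where **: "0 < A'" "A' < B'" "\<And>x. x \<notin> {A'<..<B'} \<Longrightarrow> deriv \<phi> x = 0" "\<And>x. \<bar>deriv \<phi> x\<bar> \<le> C' * indicator {A'..B'} x"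
      using test_function_bounded_support[OF test_function_deriv(1)[OF \<phi>]] by blast
    \<comment> \<open>At the midpoint the indicator is 1, so \<open>C'\<close> bounds an absolute
      value; the sign is needed to enlarge the interval.\<close>
    have C': "C' \<ge> 0" using **(4)[of "(A' + B') / 2"] **(2) by (auto split: split_indicator_asm)
    show ?thesis
    proof (rule that[of "min A A'" "max B B'" C'])
      show "\<bar>deriv \<phi> x\<bar> \<le> C' * indicator {min A A'..max B B'} x" for x
        using **(4)[of x] C' by (auto split: split_indicator_asm split_indicator)
      show "0 < min A A'" "min A A' < max B B'" using * ** by auto
      fix x assume "x \<notin> {min A A'<..<max B B'}"
      then have "x \<notin> {A<..<B}" "x \<notin> {A'<..<B'}" by auto
      then show "deriv \<phi> x = 0" "\<phi> x = 0" using *(3) **(3) by auto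
    qed
  qed
  have FTC: "(LINT x:{t..B}|lborel. deriv \<phi> x) = - \<phi> t" if "t \<le> B" for t
  proof -
    have "(LINT x:{t..B}|lborel. deriv \<phi> x) = \<phi> B - \<phi> t"
      unfolding set_lebesgue_integral_def
      by (rule integral_FTC_Icc[OF that])
         (use test_function_deriv[OF \<phi>] test_function_continuous(1)
          in \<open>auto simp: has_real_derivative_iff_has_vector_derivative intro: has_vector_derivative_at_within\<close>)
    then show ?thesis using \<phi>0[of B] by simp
  qed
  have w: "set_integrable lborel {A..B} w" using gw * by (auto simp: primitive_def)
  have d: "integrable lborel (deriv \<phi>)"
    using integrable_mult_test_function[OF borel_loc_int_const[of 1] test_function_deriv(1)[OF \<phi>]] by simp
  let ?f = "\<lambda>x t. deriv \<phi> x * (if A \<le> t \<and> t \<le> x then 1 else 0) * (indicator {A..B} t * w t)"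
  have int: "integrable (lborel \<Otimes>\<^sub>M lborel) (\<lambda>(x, t). ?f x t)"
  proof (rule Bochner_Integration.integrable_bound)
    show "integrable (lborel \<Otimes>\<^sub>M lborel) (\<lambda>(x, t). deriv \<phi> x * (indicator {A..B} t * w t))"
    proof (rule lborel_pair.Fubini_integrable)
      have "integrable lborel (\<lambda>x. \<bar>deriv \<phi> x\<bar> * (LINT t|lborel. \<bar>indicator {A..B} t * w t\<bar>))"
        by (intro integrable_mult_left integrable_abs d)
      then show "integrable lborel (\<lambda>x. LINT t|lborel. norm (case (x, t) of (x, t) \<Rightarrow> deriv \<phi> x * (indicator {A..B} t * w t)))"
        by (simp add: abs_mult)
      show "AE x in lborel. integrable lborel (\<lambda>t. case (x, t) of (x, t) \<Rightarrow> deriv \<phi> x * (indicator {A..B} t * w t))"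
        using w by (auto simp: set_integrable_def)
    qed measurable
  qed (auto simp: abs_mult split: split_indicator)
  have "(LINT x|lborel. g x * deriv \<phi> x) = (LINT x|lborel. g A * deriv \<phi> x + (LINT t|lborel. ?f x t))"
  proof (rule Bochner_Integration.integral_cong[OF refl])
    fix x
    show "g x * deriv \<phi> x = g A * deriv \<phi> x + (LINT t|lborel. ?f x t)"
    proof (cases "x \<in> {A<..<B}")
      case True
      then have "g x = g A + (LINT r:{A..x}|lborel. w r)"
        using gw * by (auto simp: primitive_def algebra_simps)
      also have "(LINT r:{A..x}|lborel. w r) = (LINT t|lborel. (if A \<le> t \<and> t \<le> x then 1 else 0) * (indicator {A..B} t * w t))"
        unfolding set_lebesgue_integral_def using True
        by (intro Bochner_Integration.integral_cong) (auto split: split_indicator)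
      finally have gx: "g x = g A + (LINT t|lborel. (if A \<le> t \<and> t \<le> x then 1 else 0) * (indicator {A..B} t * w t))" .
      show ?thesis
        unfolding gx mult.assoc[of "deriv \<phi> x"] integral_mult_right_zero by (simp add: distrib_left mult.commute)
    qed (use * in auto)
  qed
  also have "\<dots> = g A * (LINT x|lborel. deriv \<phi> x) + (LINT x|lborel. LINT t|lborel. ?f x t)"
    using d lborel_pair.integrable_fst'[OF int] by (subst Bochner_Integration.integral_add) auto
  also have "(LINT x|lborel. deriv \<phi> x) = (LINT x:{A..B}|lborel. deriv \<phi> x)"
    unfolding set_lebesgue_integral_def
    by (intro Bochner_Integration.integral_cong) (use * in \<open>auto split: split_indicator\<close>)
  also have "\<dots> = 0" using FTC[of A] * \<phi>0[of A] by simp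
  also have "(LINT x|lborel. LINT t|lborel. ?f x t) = (LINT t|lborel. LINT x|lborel. ?f x t)"
    by (rule lborel_pair.Fubini_integral[OF int, symmetric])
  also have "\<dots> = (LINT t|lborel. - (w t * \<phi> t))"
  proof (rule Bochner_Integration.integral_cong[OF refl])
    fix t
    show "(LINT x|lborel. ?f x t) = - (w t * \<phi> t)"
    proof (cases "t \<in> {A..B}")
      case True
      have "(LINT x|lborel. ?f x t) = (LINT x|lborel. w t * (indicator {t..B} x *\<^sub>R deriv \<phi> x))"
        by (intro Bochner_Integration.integral_cong) (use True *(3) in \<open>auto split: split_indicator\<close>)
      also have "\<dots> = w t * (LINT x:{t..B}|lborel. deriv \<phi> x)"
        by (simp add: set_lebesgue_integral_def)
      finally have eq: "(LINT x|lborel. ?f x t) = w t * (LINT x:{t..B}|lborel. deriv \<phi> x)" .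
      show ?thesis unfolding eq using FTC[of t] True by simp
    next
      case False
      then have "indicator {A..B} t = (0 :: real)" by simp
      moreover have "\<phi> t = 0" using False by (intro \<phi>0) auto
      ultimately show ?thesis by simp
    qed
  qed
  finally show ?thesis by simp
qed

text \<open>A primitive \<open>h\<close> of \<open>w\<close> has the same weak derivative as
  \<open>v\<close>, so \<open>v - h\<close> is almost everywhere a constant \<open>c\<close>;
  \<open>g\<close> is the primitive of \<open>w\<close> shifted by that constant.\<close>

lemma weak_deriv_primitive_borel:
  assumes v: "borel_loc_int v" and w: "borel_loc_int w"
    and eq: "\<And>\<phi>. \<phi> \<in> test_functions \<Longrightarrow> (LINT x|lborel. v x * deriv \<phi> x) = - (LINT x|lborel. w x * \<phi> x)"
  shows "\<exists>g. primitive g w \<and> (AE x in lborel. x > 0 \<longrightarrow> v x = g x)"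
proof -
  obtain h where h: "primitive h w" "h 1 = 0"
    using primitive_exists[of w 0] w by (auto simp: borel_loc_int_def)
  have "\<exists>c. AE x in lborel. x > 0 \<longrightarrow> v x - h x = c"
  proof (rule AE_const_if_weak_deriv_zero)
    show "borel_loc_int (\<lambda>x. v x - h x)" by (intro borel_loc_int_diff v borel_loc_int_primitive[OF h(1)])
    fix \<phi> assume \<phi>: "\<phi> \<in> test_functions"
    note \<phi>' = test_function_deriv(1)[OF \<phi>]
    have "(LINT x|lborel. (v x - h x) * deriv \<phi> x) = (LINT x|lborel. v x * deriv \<phi> x - h x * deriv \<phi> x)"
      by (simp add: algebra_simps)
    also have "\<dots> = (LINT x|lborel. v x * deriv \<phi> x) - (LINT x|lborel. h x * deriv \<phi> x)"
      using integrable_mult_test_function[OF v \<phi>'] integrable_mult_test_function[OF borel_loc_int_primitive(1)[OF h(1)] \<phi>']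
      by (rule Bochner_Integration.integral_diff)
    finally show "(LINT x|lborel. (v x - h x) * deriv \<phi> x) = 0"
      using eq[OF \<phi>] primitive_integration_by_parts[OF h(1) \<phi>] by simp
  qed
  then obtain c where c: "AE x in lborel. x > 0 \<longrightarrow> v x - h x = c" by blast
  obtain g where g: "primitive g w" "g 1 = c"
    using primitive_exists[of w c] w by (auto simp: borel_loc_int_def)
  have gh: "g x = h x + c" if "x > 0" for x
  proof (cases "1 \<le> x")
    case True
    then have "g x - g 1 = h x - h 1" using g(1) h(1) by (simp add: primitive_def)
    then show ?thesis using g h by simp
  next
    case False
    then have "g 1 - g x = h 1 - h x" using g(1) h(1) that by (simp add: primitive_def)
    then show ?thesis using g h by simp
  qed
  have "AE x in lborel. x > 0 \<longrightarrow> v x = g x"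
    using c by eventually_elim (auto simp: gh)
  with g show ?thesis by blast
qed

section \<open>Borel representatives of Lebesgue measurable functions\<close>

lemma borel_measurable_lebesgue_AE:
  fixes f g :: "real \<Rightarrow> real"
  assumes f: "f \<in> borel_measurable borel" and eq: "AE x in lborel. f x = g x"
  shows "g \<in> borel_measurable lebesgue"
proof (rule measurableI)
  fix S :: "real set" assume S: "S \<in> sets borel"
  have "f -` S \<in> sets borel" by (rule measurable_sets_borel[OF f S])
  then have 1: "f -` S \<in> sets lebesgue" by (intro sets_completionI_sets) simp
  have 2: "AE x in lebesgue. x \<in> f -` S \<longleftrightarrow> x \<in> g -` S"
    using eq unfolding AE_completion_iff by eventually_elim auto
  have "g -` S \<in> sets lebesgue"
    by (rule completion.in_sets_AE[OF 2 1]) simp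
  then show "g -` S \<inter> space lebesgue \<in> sets lebesgue" by simp
qed simp

text \<open>The spaces are defined with Lebesgue measurable functions, while the estimates,
  Tonelli's theorem in particular, are carried out for Borel functions and \<open>lborel\<close>.
  The values of \<open>u\<close> at nonpositive arguments are left free.\<close>

definition borel_version :: "(real \<Rightarrow> real) \<Rightarrow> (real \<Rightarrow> real) \<Rightarrow> bool" where
  "borel_version u v \<longleftrightarrow> v \<in> borel_measurable borel \<and> (AE x in lborel. x > 0 \<longrightarrow> u x = v x)"

lemma borel_version_measurable:
  assumes "borel_version u v"
  shows "(\<lambda>x. indicator {0<..} x * u x) \<in> borel_measurable lebesgue"
proof (rule borel_measurable_lebesgue_AE)
  show "(\<lambda>x. indicator {0<..} x * v x) \<in> borel_measurable borel"
    using assms by (auto simp: borel_version_def)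
  have "AE x in lborel. x > 0 \<longrightarrow> u x = v x" using assms by (simp add: borel_version_def)
  then show "AE x in lborel. indicator {0<..} x * v x = indicator {0<..} x * u x"
    by eventually_elim (auto split: split_indicator)
qed

text \<open>A general integrand \<open>F x (u x)\<close> covers both the weighted powers in the
  norms and the products with test functions.\<close>

lemma set_integral_borel_version:
  fixes F :: "real \<Rightarrow> real \<Rightarrow> real"
  assumes u: "borel_version u v" and F[measurable]: "case_prod F \<in> borel_measurable (borel \<Otimes>\<^sub>M borel)"
  shows "set_integrable lebesgue {0<..} (\<lambda>x. F x (u x)) \<longleftrightarrow> set_integrable lborel {0<..} (\<lambda>x. F x (v x))"
    and "(LINT x:{0<..}|lebesgue. F x (u x)) = (LINT x:{0<..}|lborel. F x (v x))"
proof -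
  have [measurable]: "v \<in> borel_measurable borel" and ae: "AE x in lborel. x > 0 \<longrightarrow> u x = v x"
    using u by (auto simp: borel_version_def)
  let ?f = "\<lambda>x. indicator {0<..} x *\<^sub>R F x (u x)" and ?g = "\<lambda>x. indicator {0<..} x *\<^sub>R F x (v x)"
  have g: "?g \<in> borel_measurable borel" by measurable
  have eq: "AE x in lborel. ?g x = ?f x"
    using ae by eventually_elim (auto split: split_indicator)
  have f: "?f \<in> borel_measurable lebesgue"
    by (rule borel_measurable_lebesgue_AE[OF g eq])
  have g': "?g \<in> borel_measurable lebesgue" using g by (intro measurable_completion) simp
  have eq': "AE x in lebesgue. ?f x = ?g x"
    unfolding AE_completion_iff using eq by eventually_elim (rule sym)
  have "integrable lebesgue ?f \<longleftrightarrow> integrable lebesgue ?g"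
    by (rule integrable_cong_AE[OF f g' eq'])
  also have "\<dots> \<longleftrightarrow> integrable lborel ?g" by (rule integrable_completion) (use g in simp)
  finally show "set_integrable lebesgue {0<..} (\<lambda>x. F x (u x)) \<longleftrightarrow> set_integrable lborel {0<..} (\<lambda>x. F x (v x))"
    by (simp add: set_integrable_def)
  have "integral\<^sup>L lebesgue ?f = integral\<^sup>L lebesgue ?g"
    by (rule integral_cong_AE[OF f g' eq'])
  also have "\<dots> = integral\<^sup>L lborel ?g" by (rule integral_completion) (use g in simp)
  finally show "(LINT x:{0<..}|lebesgue. F x (u x)) = (LINT x:{0<..}|lborel. F x (v x))"
    by (simp add: set_lebesgue_integral_def)
qed

lemma Lw_borel_version:
  assumes u: "borel_version u v"
  shows "u \<in> Lw q \<theta> \<longleftrightarrow> wint q \<theta> {0<..} v < \<infinity>"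
    and "Lw_norm q \<theta> u = enn2real (wint q \<theta> {0<..} v) powr (1 / q)"
proof -
  have [measurable]: "v \<in> borel_measurable borel" using u by (simp add: borel_version_def)
  let ?g = "\<lambda>x. indicator {0<..} x * (\<bar>v x\<bar> powr q * x powr \<theta>)"
  have w: "(\<integral>\<^sup>+x. ennreal (?g x) \<partial>lborel) = wint q \<theta> {0<..} v"
    unfolding wint_def by (intro nn_integral_cong) (auto split: split_indicator)
  have F: "case_prod (\<lambda>x y. \<bar>y\<bar> powr q * x powr \<theta>) \<in> borel_measurable (borel \<Otimes>\<^sub>M borel)"
    by measurable
  have m: "u \<in> borel_measurable (lebesgue_on {0<..})"
    using borel_version_measurable[OF u] by (subst borel_measurable_restrict_space_iff) auto
  have "set_integrable lborel {0<..} (\<lambda>x. \<bar>v x\<bar> powr q * x powr \<theta>) \<longleftrightarrow> wint q \<theta> {0<..} v < \<infinity>"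
    unfolding set_integrable_def w[symmetric] by (simp add: integrable_iff_bounded)
  then show "u \<in> Lw q \<theta> \<longleftrightarrow> wint q \<theta> {0<..} v < \<infinity>"
    using set_integral_borel_version(1)[OF u F] m by (simp add: Lw_def)
  have "(LINT x:{0<..}|lborel. \<bar>v x\<bar> powr q * x powr \<theta>) = enn2real (wint q \<theta> {0<..} v)"
    unfolding set_lebesgue_integral_def w[symmetric] by (simp add: integral_eq_nn_integral)
  then show "Lw_norm q \<theta> u = enn2real (wint q \<theta> {0<..} v) powr (1 / q)"
    using set_integral_borel_version(2)[OF u F] by (simp add: Lw_norm_def)
qed

text \<open>Cut off to \<open>[1 / (n + 1), n + 1]\<close>, \<open>u\<close> is integrable and hence
  measurable, and so is the pointwise limit on the half line; a function measurable for the
  completion agrees almost everywhere with a Borel one.\<close>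

lemma borel_version_exists:
  assumes u: "locally_integrable u"
  shows "\<exists>v. borel_version u v \<and> borel_loc_int v"
proof -
  have int: "integrable lebesgue (\<lambda>x. indicator {a..b} x *\<^sub>R u x)" if "0 < a" for a b
  proof -
    have "compact {a..b} \<and> {a..b} \<subseteq> {0<..}" using that by auto
    with u show ?thesis unfolding locally_integrable_def set_integrable_def by blast
  qed
  have "(\<lambda>x. indicator {0<..} x * u x) \<in> borel_measurable lebesgue"
  proof (rule borel_measurable_LIMSEQ_real)
    show "(\<lambda>x. indicator {1 / real (Suc n)..real (Suc n)} x *\<^sub>R u x) \<in> borel_measurable lebesgue" for n
      by (rule borel_measurable_integrable[OF int]) simp
    fix x :: real
    show "(\<lambda>n. indicator {1 / real (Suc n)..real (Suc n)} x *\<^sub>R u x) \<longlonglongrightarrow> indicator {0<..} x * u x"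
    proof (cases "x > 0")
      case True
      have "eventually (\<lambda>n. 1 / real (Suc n) < x) sequentially"
        by (rule order_tendstoD(2)[OF LIMSEQ_Suc[OF lim_const_over_n] True])
      moreover have "eventually (\<lambda>n. real n \<ge> x) sequentially"
        using eventually_ge_at_top[of "nat \<lceil>x\<rceil>"] by eventually_elim linarith
      ultimately have "eventually (\<lambda>n. indicator {1 / real (Suc n)..real (Suc n)} x *\<^sub>R u x = indicator {0<..} x * u x) sequentially"
        by eventually_elim (use True in auto)
      then show ?thesis by (rule tendsto_eventually)
    next
      case False
      have "indicator {1 / real (Suc n)..real (Suc n)} x = (0 :: real)" for n
      proof -
        have "0 < 1 / real (Suc n)" by simp
        with False have "x < 1 / real (Suc n)" by linarith
        then show ?thesis by simp
      qed
      then show ?thesis using False by simp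
    qed
  qed
  from completion_ex_borel_measurable_real[OF this] obtain v where [measurable]: "v \<in> borel_measurable borel"
    and v: "AE x in lborel. indicator {0<..} x * u x = v x" by auto
  have uv: "borel_version u v"
    unfolding borel_version_def using v by (auto elim!: eventually_mono)
  have "set_integrable lborel {x..y} v" if "0 < x" for x y
  proof -
    have "integrable lebesgue (\<lambda>r. indicator {x..y} r *\<^sub>R u r) \<longleftrightarrow> integrable lebesgue (\<lambda>r. indicator {x..y} r *\<^sub>R v r)"
    proof (rule integrable_cong_AE)
      show "(\<lambda>r. indicator {x..y} r *\<^sub>R u r) \<in> borel_measurable lebesgue"
        by (rule borel_measurable_integrable[OF int[OF that]])
      show "(\<lambda>r. indicator {x..y} r *\<^sub>R v r) \<in> borel_measurable lebesgue"
        by (intro measurable_completion) simp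
      show "AE r in lebesgue. indicator {x..y} r *\<^sub>R u r = indicator {x..y} r *\<^sub>R v r"
        unfolding AE_completion_iff using v by eventually_elim (use that in \<open>auto split: split_indicator split_indicator_asm\<close>)
    qed
    also have "integrable lebesgue (\<lambda>r. indicator {x..y} r *\<^sub>R v r) \<longleftrightarrow> integrable lborel (\<lambda>r. indicator {x..y} r *\<^sub>R v r)"
      by (rule integrable_completion) simp
    finally show ?thesis using int[OF that, of y] by (simp add: set_integrable_def)
  qed
  with uv show ?thesis by (auto simp: borel_loc_int_def)
qed

lemma test_function_funpow_deriv:
  "\<phi> \<in> test_functions \<Longrightarrow> (deriv ^^ j) \<phi> \<in> test_functions"
  by (induction j) (auto intro: test_function_deriv)

lemma integral_test_function_borel_version:
  assumes u: "borel_version u v" and \<phi>: "\<phi> \<in> test_functions"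
  shows "(LINT r:{0<..}|lebesgue. u r * \<phi> r) = (LINT r|lborel. v r * \<phi> r)"
proof -
  have [measurable]: "\<phi> \<in> borel_measurable borel" by (rule test_function_continuous(2)[OF \<phi>])
  have "\<phi> r = 0" if "r \<le> 0" for r
    using \<phi> that by (auto simp: test_functions_iff)
  then have "(LINT r:{0<..}|lborel. v r * \<phi> r) = (LINT r|lborel. v r * \<phi> r)"
    unfolding set_lebesgue_integral_def by (intro Bochner_Integration.integral_cong) (auto split: split_indicator)
  moreover have "case_prod (\<lambda>x y. y * \<phi> x) \<in> borel_measurable (borel \<Otimes>\<^sub>M borel)"
    by measurable
  ultimately show ?thesis
    using set_integral_borel_version(2)[OF u, of "\<lambda>x y. y * \<phi> x"] by simp
qed

lemma has_weak_deriv_borel: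
  assumes "has_weak_deriv j u v" "borel_version u ub" "borel_version v vb" "\<phi> \<in> test_functions"
  shows "(LINT r|lborel. ub r * (deriv ^^ j) \<phi> r) = (-1) ^ j * (LINT r|lborel. vb r * \<phi> r)"
  using assms integral_test_function_borel_version[OF assms(3,4)]
    integral_test_function_borel_version[OF assms(2) test_function_funpow_deriv[OF assms(4)], of j]
  by (simp add: has_weak_deriv_def)

text \<open>Links the derivative picked by \<open>weak_deriv\<close>, which determines
  \<open>X_norm\<close>, with the witness in the definition of \<open>X_space\<close>: they have the
  same Borel versions.\<close>

lemma has_weak_deriv_unique:
  assumes u: "has_weak_deriv j u v" and u': "has_weak_deriv j u v'" and v: "borel_version v vb"
  shows "borel_version v' vb"
proof -
  have "locally_integrable u" "locally_integrable v'" "locally_integrable v"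
    using u u' by (auto simp: has_weak_deriv_def)
  then obtain ub vb' vb'' where ub: "borel_version u ub" and vb': "borel_version v' vb'" "borel_loc_int vb'"
    and vb'': "borel_version v vb''" "borel_loc_int vb''"
    using borel_version_exists by meson
  have "AE x in lborel. x > 0 \<longrightarrow> vb' x - vb'' x = 0"
  proof (rule fundamental_lemma_of_variations)
    show "borel_loc_int (\<lambda>x. vb' x - vb'' x)" by (intro borel_loc_int_diff vb' vb'')
    fix \<phi> assume \<phi>: "\<phi> \<in> test_functions"
    have "(-1) ^ j * (LINT r|lborel. vb' r * \<phi> r) = (-1) ^ j * (LINT r|lborel. vb'' r * \<phi> r)"
      using has_weak_deriv_borel[OF u ub vb''(1) \<phi>] has_weak_deriv_borel[OF u' ub vb'(1) \<phi>] by simp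
    then have *: "(LINT r|lborel. vb' r * \<phi> r) = (LINT r|lborel. vb'' r * \<phi> r)" by simp
    have "(LINT r|lborel. (vb' r - vb'' r) * \<phi> r) = (LINT r|lborel. vb' r * \<phi> r - vb'' r * \<phi> r)"
      by (simp add: algebra_simps)
    also have "\<dots> = (LINT r|lborel. vb' r * \<phi> r) - (LINT r|lborel. vb'' r * \<phi> r)"
      by (intro Bochner_Integration.integral_diff integrable_mult_test_function vb' vb'' \<phi>)
    finally show "(LINT r|lborel. (vb' r - vb'' r) * \<phi> r) = 0" using * by simp
  qed
  moreover have "AE x in lborel. x > 0 \<longrightarrow> v x = vb x" "AE x in lborel. x > 0 \<longrightarrow> v' x = vb' x"
    "AE x in lborel. x > 0 \<longrightarrow> v x = vb'' x"
    using v vb' vb'' by (auto simp: borel_version_def)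
  ultimately have "AE x in lborel. x > 0 \<longrightarrow> v' x = vb x"
    by eventually_elim auto
  with v show ?thesis by (simp add: borel_version_def)
qed

lemma primitive_cong_AE:
  assumes gw: "primitive g w" and [measurable]: "w' \<in> borel_measurable borel"
    and eq: "AE x in lborel. x > 0 \<longrightarrow> w x = w' x"
  shows "primitive g w'"
proof -
  note [measurable] = primitive_measurable[OF gw]
  have "set_integrable lborel {x..y} w' \<and> g y - g x = (LINT r:{x..y}|lborel. w' r)" if "0 < x" "x \<le> y" for x y
  proof -
    have eq': "AE r in lborel. indicator {x..y} r *\<^sub>R w r = indicator {x..y} r *\<^sub>R w' r"
      using eq by eventually_elim (use that in \<open>auto split: split_indicator\<close>)
    have "integrable lborel (\<lambda>r. indicator {x..y} r *\<^sub>R w r) \<longleftrightarrow> integrable lborel (\<lambda>r. indicator {x..y} r *\<^sub>R w' r)"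
      by (rule integrable_cong_AE[OF _ _ eq']) auto
    moreover have "(LINT r|lborel. indicator {x..y} r *\<^sub>R w r) = (LINT r|lborel. indicator {x..y} r *\<^sub>R w' r)"
      by (rule integral_cong_AE[OF _ _ eq']) auto
    ultimately show ?thesis
      using gw that by (simp add: primitive_def set_integrable_def set_lebesgue_integral_def)
  qed
  with gw show ?thesis by (simp add: primitive_def)
qed

text \<open>Below order \<open>k\<close> every weak derivative has a continuous version that is a
  primitive of the next one; at order \<open>k\<close> any Borel version serves.\<close>

lemma X_space_borel_versions:
  assumes u: "u \<in> X_space k p \<alpha>" and p: "p \<ge> 1"
  shows "\<exists>G. borel_version u (G 0) \<and> (\<forall>j<k. primitive (G j) (G (Suc j))) \<and>
    (\<forall>j\<le>k. wint p (\<alpha> j) {0<..} (G j) \<le> ennreal (X_norm k p \<alpha> u powr p))"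
proof -
  have wd: "has_weak_deriv j u (weak_deriv j u)" if "j \<le> k" for j
    unfolding weak_deriv_def
    by (rule someI_ex[where P = "has_weak_deriv j u"]) (use u that in \<open>auto simp: X_space_def\<close>)
  have "\<exists>W. borel_version (weak_deriv j u) W \<and> borel_loc_int W" if "j \<le> k" for j
    using borel_version_exists wd[OF that] by (simp add: has_weak_deriv_def)
  then obtain W where W: "\<And>j. j \<le> k \<Longrightarrow> borel_version (weak_deriv j u) (W j)" "\<And>j. j \<le> k \<Longrightarrow> borel_loc_int (W j)"
    by metis
  have u0: "borel_version u (W 0)"
  proof (rule has_weak_deriv_unique[OF wd _ W(1)])
    show "has_weak_deriv 0 u u" using wd[of 0] by (simp add: has_weak_deriv_def)
  qed auto
  have "\<exists>g. primitive g (W (Suc j)) \<and> (AE x in lborel. x > 0 \<longrightarrow> W j x = g x)" if j: "j < k" for j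
  proof (rule weak_deriv_primitive_borel)
    show "borel_loc_int (W j)" "borel_loc_int (W (Suc j))" using W j by auto
    fix \<phi> assume \<phi>: "\<phi> \<in> test_functions"
    \<comment> \<open>The identity of order \<open>j\<close> for \<open>deriv \<phi>\<close> and
      that of order \<open>j + 1\<close> for \<open>\<phi>\<close> have the same left side, so each
      weak derivative is the weak derivative of its predecessor.\<close>
    have 1: "(LINT r|lborel. W 0 r * (deriv ^^ j) (deriv \<phi>) r) = (-1) ^ j * (LINT r|lborel. W j r * deriv \<phi> r)"
      by (rule has_weak_deriv_borel[OF wd u0 W(1) test_function_deriv(1)[OF \<phi>]]) (use j in auto)
    have 2: "(LINT r|lborel. W 0 r * (deriv ^^ Suc j) \<phi> r) = (-1) ^ Suc j * (LINT r|lborel. W (Suc j) r * \<phi> r)"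
      by (rule has_weak_deriv_borel[OF wd u0 W(1) \<phi>]) (use j in auto)
    have "(-1) ^ j * (LINT r|lborel. W j r * deriv \<phi> r) = (-1) ^ j * (- (LINT r|lborel. W (Suc j) r * \<phi> r))"
      using 1 2 by (simp add: funpow_Suc_right del: funpow.simps(2))
    then show "(LINT x|lborel. W j x * deriv \<phi> x) = - (LINT x|lborel. W (Suc j) x * \<phi> x)"
      by (subst (asm) mult_left_cancel) auto
  qed
  then obtain g where g: "\<And>j. j < k \<Longrightarrow> primitive (g j) (W (Suc j))"
    "\<And>j. j < k \<Longrightarrow> AE x in lborel. x > 0 \<longrightarrow> W j x = g j x" by metis
  define G where "G j = (if j < k then g j else W k)" for j
  have WG: "AE x in lborel. x > 0 \<longrightarrow> W j x = G j x" if "j \<le> k" for j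
    using g(2)[of j] that by (auto simp: G_def)
  have G[measurable]: "G j \<in> borel_measurable borel" for j
    using primitive_measurable(1)[OF g(1)[of j]] W(2)[of k] by (auto simp: G_def borel_loc_int_def)
  have GB: "borel_version f (G j)" if "borel_version f (W j)" "j \<le> k" for f j
  proof -
    have "AE x in lborel. x > 0 \<longrightarrow> f x = W j x" using that(1) by (simp add: borel_version_def)
    with WG[OF that(2)] have "AE x in lborel. x > 0 \<longrightarrow> f x = G j x" by eventually_elim auto
    with G show ?thesis by (simp add: borel_version_def)
  qed
  have "primitive (G j) (G (Suc j))" if "j < k" for j
    using primitive_cong_AE[OF g(1)[OF that] G WG[of "Suc j"]] that by (simp add: G_def)
  moreover have "wint p (\<alpha> j) {0<..} (G j) \<le> ennreal (X_norm k p \<alpha> u powr p)" if j: "j \<le> k" for j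
  proof -
    \<comment> \<open>Finiteness must be known separately, because \<open>enn2real\<close>, and with
      it \<open>Lw_norm\<close>, is 0 for an infinite integral. It comes from the witness in
      \<open>X_space\<close>.\<close>
    have fin: "wint p (\<alpha> i) {0<..} (G i) < \<infinity>" if i: "i \<le> k" for i
    proof -
      obtain v where v: "has_weak_deriv i u v" "v \<in> Lw p (\<alpha> i)" using u i unfolding X_space_def by blast
      have "borel_version v (G i)"
        by (rule has_weak_deriv_unique[OF wd[OF that] v(1) GB[OF W(1)]]) (use that in auto)
      from Lw_borel_version(1)[OF this] v show ?thesis by blast
    qed
    have nrm: "Lw_norm p (\<alpha> i) (weak_deriv i u) powr p = enn2real (wint p (\<alpha> i) {0<..} (G i))" if "i \<le> k" for i
      using Lw_borel_version(2)[OF GB[OF W(1)[OF that] that], of p "\<alpha> i"] p by (simp add: powr_powr)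
    have "wint p (\<alpha> j) {0<..} (G j) = ennreal (enn2real (wint p (\<alpha> j) {0<..} (G j)))"
      using fin[OF j] by simp
    also have "\<dots> = ennreal (Lw_norm p (\<alpha> j) (weak_deriv j u) powr p)" by (simp add: nrm[OF j])
    also have "\<dots> \<le> ennreal (\<Sum>j\<le>k. Lw_norm p (\<alpha> j) (weak_deriv j u) powr p)"
      using j by (intro ennreal_leI member_le_sum) auto
    also have "(\<Sum>j\<le>k. Lw_norm p (\<alpha> j) (weak_deriv j u) powr p) = X_norm k p \<alpha> u powr p"
      using p by (simp add: X_norm_def powr_powr sum_nonneg)
    finally show ?thesis .
  qed
  moreover have "borel_version u (G 0)" using GB[OF u0] by simp
  ultimately show ?thesis by blast
qed

subsection \<open>The embeddings\<close>

text \<open>Each step lowers the order by one and the exponent by \<open>p\<close>. Since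
  \<open>i < k\<close>, every exponent reached is at least
  \<open>\<alpha> k - real k * p + p \<ge> 0\<close>, so Hardy's inequality never becomes critical
  here.\<close>

lemma wint_derivative_reduction:
  fixes p :: real and \<alpha> :: "nat \<Rightarrow> real"
  assumes p: "p \<ge> 1" and \<alpha>: "\<forall>j<k. \<alpha> j \<ge> \<alpha> k - real (k - j) * p" and b: "\<alpha> k - real k * p \<ge> -1" and i: "i < k"
  shows "\<exists>C\<ge>0. \<forall>G M. (\<forall>j<k. primitive (G j) (G (Suc j))) \<longrightarrow> M \<ge> 0 \<longrightarrow>
    (\<forall>j\<le>k. wint p (\<alpha> j) {0<..} (G j) \<le> ennreal M) \<longrightarrow>
    wint p (\<alpha> k - real i * p) {0<..} (G (k - i)) \<le> ennreal (C * M)"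
  using i
proof (induction i)
  case 0
  show ?case by (intro exI[of _ 1]) auto
next
  case (Suc i)
  obtain C where C: "C \<ge> 0" "\<And>G M. \<lbrakk>\<forall>j<k. primitive (G j) (G (Suc j)); M \<ge> 0;
    \<forall>j\<le>k. wint p (\<alpha> j) {0<..} (G j) \<le> ennreal M\<rbrakk> \<Longrightarrow> wint p (\<alpha> k - real i * p) {0<..} (G (k - i)) \<le> ennreal (C * M)"
    using Suc.IH Suc.prems by auto
  define j where "j = k - Suc i"
  define \<beta> where "\<beta> = \<alpha> k - real (Suc i) * p"
  have j: "j < k" "Suc j = k - i" "k - j = Suc i" using Suc.prems by (auto simp: j_def)
  have "real (Suc i) + 1 \<le> real k" using Suc.prems by linarith
  then have "(real (Suc i) + 1) * p \<le> real k * p" using p by (intro mult_right_mono) auto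
  then have \<beta>: "\<beta> > -1" using b p by (simp add: \<beta>_def algebra_simps)
  have \<beta>2: "\<beta> \<le> \<alpha> j" using \<alpha> j unfolding \<beta>_def by (metis j(3))
  obtain D where D: "D \<ge> 0" "\<And>g w M. \<lbrakk>primitive g w; M \<ge> 0; wint p (\<alpha> j) {0<..} g \<le> ennreal M;
    wint p (\<beta> + p) {0<..} w \<le> ennreal M\<rbrakk> \<Longrightarrow> wint p \<beta> {0<..} g \<le> ennreal (D * M)"
    using wint_weight_reduction[OF p \<beta> \<beta>2] by blast
  show ?case
  proof (intro exI[of _ "D * max 1 C"] conjI allI impI)
    fix G and M :: real
    assume G: "\<forall>j<k. primitive (G j) (G (Suc j))" and M: "M \<ge> 0" and le: "\<forall>j\<le>k. wint p (\<alpha> j) {0<..} (G j) \<le> ennreal M"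
    \<comment> \<open>\<open>max 1 C\<close> gives \<open>G j\<close> and \<open>G (Suc j)\<close> a
      common bound.\<close>
    let ?M = "max 1 C * M"
    have M1: "1 * M \<le> ?M" "C * M \<le> ?M" using M by (intro mult_right_mono; simp)+
    have 1: "wint p (\<alpha> j) {0<..} (G j) \<le> ennreal ?M"
      by (rule order_trans[of _ "ennreal M"]) (use le j M1 in \<open>auto intro: ennreal_leI\<close>)
    have "wint p (\<alpha> k - real i * p) {0<..} (G (Suc j)) \<le> ennreal (C * M)" using C(2)[OF G M le] j by simp
    also have "\<dots> \<le> ennreal ?M" by (rule ennreal_leI[OF M1(2)])
    also have "\<alpha> k - real i * p = \<beta> + p" by (simp add: \<beta>_def algebra_simps)
    finally have 2: "wint p (\<beta> + p) {0<..} (G (Suc j)) \<le> ennreal ?M" .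
    have "wint p \<beta> {0<..} (G j) \<le> ennreal (D * ?M)"
      by (rule D(2)[OF _ _ 1 2]) (use G j M in auto)
    then show "wint p (\<alpha> k - real (Suc i) * p) {0<..} (G (k - Suc i)) \<le> ennreal (D * max 1 C * M)"
      by (simp add: \<beta>_def j_def mult.assoc)
  qed (use D in auto)
qed

text \<open>If \<open>c = \<alpha> 0\<close>, the last bound is contained in the norm; otherwise it
  comes from Hardy's inequality, which requires \<open>c > -1\<close>. The first alternative serves
  the case \<open>\<theta> = \<alpha> 0 = -1\<close>.\<close>

lemma X_space_reduction:
  fixes p c :: real and \<alpha> :: "nat \<Rightarrow> real"
  assumes k: "k \<ge> 1" and p: "p \<ge> 1" and \<alpha>: "\<forall>j<k. \<alpha> j \<ge> \<alpha> k - real (k - j) * p"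
    and b: "b = \<alpha> k - real k * p" "b \<ge> -1" and c: "c = \<alpha> 0 \<or> c > -1 \<and> b \<le> c"
  shows "\<exists>C\<ge>0. \<forall>u\<in>X_space k p \<alpha>. \<exists>g w. borel_version u g \<and> primitive g w \<and>
    wint p (\<alpha> 0) {0<..} g \<le> ennreal (C * X_norm k p \<alpha> u powr p) \<and>
    wint p (b + p) {0<..} w \<le> ennreal (C * X_norm k p \<alpha> u powr p) \<and>
    wint p c {0<..1} g \<le> ennreal (C * X_norm k p \<alpha> u powr p)"
proof -
  obtain C where C: "C \<ge> 0" "\<And>G M. \<lbrakk>\<forall>j<k. primitive (G j) (G (Suc j)); M \<ge> 0;
    \<forall>j\<le>k. wint p (\<alpha> j) {0<..} (G j) \<le> ennreal M\<rbrakk> \<Longrightarrow> wint p (\<alpha> k - real (k - 1) * p) {0<..} (G (k - (k - 1))) \<le> ennreal (C * M)"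
    using wint_derivative_reduction[OF p \<alpha>, of "k - 1"] b k by auto
  have bp: "\<alpha> k - real (k - 1) * p = b + p" using k by (simp add: b of_nat_diff algebra_simps)
  have "\<exists>D\<ge>0. \<forall>g w M. primitive g w \<longrightarrow> M \<ge> 0 \<longrightarrow> wint p (\<alpha> 0) {0<..} g \<le> ennreal M \<longrightarrow>
    wint p (b + p) {0<..} w \<le> ennreal M \<longrightarrow> wint p c {0<..1} g \<le> ennreal (D * M)"
  proof (cases "c = \<alpha> 0")
    case True
    then show ?thesis by (intro exI[of _ 1]) (auto intro: wint_subset_le)
  next
    case False
    then show ?thesis using Hardy_bound_near_0[OF p, of c b "\<alpha> 0"] c by blast
  qed
  then obtain D where D: "D \<ge> 0" "\<And>g w M. \<lbrakk>primitive g w; M \<ge> 0; wint p (\<alpha> 0) {0<..} g \<le> ennreal M;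
    wint p (b + p) {0<..} w \<le> ennreal M\<rbrakk> \<Longrightarrow> wint p c {0<..1} g \<le> ennreal (D * M)" by blast
  let ?C = "max 1 C" let ?D = "max 1 D * ?C"
  show ?thesis
  proof (intro exI[of _ ?D] conjI ballI)
    fix u assume u: "u \<in> X_space k p \<alpha>"
    let ?N = "X_norm k p \<alpha> u powr p"
    from X_space_borel_versions[OF u p] obtain G where G: "borel_version u (G 0)" "\<forall>j<k. primitive (G j) (G (Suc j))"
      "\<forall>j\<le>k. wint p (\<alpha> j) {0<..} (G j) \<le> ennreal ?N" by blast
    have N: "?N \<le> ?C * ?N" "C * ?N \<le> ?C * ?N" "?C * ?N \<le> ?D * ?N" "D * (?C * ?N) \<le> ?D * ?N"
    proof -
      show "?N \<le> ?C * ?N" "C * ?N \<le> ?C * ?N" using mult_right_mono[of 1 ?C ?N] by (auto intro: mult_right_mono)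
      have "1 * (?C * ?N) \<le> max 1 D * (?C * ?N)" "D * (?C * ?N) \<le> max 1 D * (?C * ?N)"
        by (intro mult_right_mono; simp)+
      then show "?C * ?N \<le> ?D * ?N" "D * (?C * ?N) \<le> ?D * ?N" by (simp_all add: mult.assoc)
    qed
    have "wint p (\<alpha> 0) {0<..} (G 0) \<le> ennreal ?N" using G(3) by blast
    then have g: "wint p (\<alpha> 0) {0<..} (G 0) \<le> ennreal (?C * ?N)"
      by (rule order_trans[OF _ ennreal_leI[OF N(1)]])
    have "wint p (b + p) {0<..} (G 1) \<le> ennreal (C * ?N)" using C(2)[OF G(2) _ G(3)] k bp by simp
    then have w: "wint p (b + p) {0<..} (G 1) \<le> ennreal (?C * ?N)"
      by (rule order_trans[OF _ ennreal_leI[OF N(2)]])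
    have prim: "primitive (G 0) (G 1)" using G(2) k by auto
    have "wint p c {0<..1} (G 0) \<le> ennreal (D * (?C * ?N))"
      by (rule D(2)[OF prim _ g w]) simp
    then have "wint p c {0<..1} (G 0) \<le> ennreal (?D * ?N)"
      by (rule order_trans[OF _ ennreal_leI[OF N(4)]])
    then show "\<exists>g w. borel_version u g \<and> primitive g w \<and>
      wint p (\<alpha> 0) {0<..} g \<le> ennreal (?D * ?N) \<and>
      wint p (b + p) {0<..} w \<le> ennreal (?D * ?N) \<and> wint p c {0<..1} g \<le> ennreal (?D * ?N)"
      using G(1) prim order_trans[OF g ennreal_leI[OF N(3)]] order_trans[OF w ennreal_leI[OF N(3)]] by blast
  qed simp
qed

lemma X_norm_nonneg: "X_norm k p \<alpha> u \<ge> 0"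
  by (simp add: X_norm_def)

text \<open>The bound \<open>D * M powr (q / p)\<close> is homogeneous: for \<open>M\<close> a
  multiple of the \<open>p\<close>-th power of the norm, its \<open>q\<close>-th root is a multiple
  of the norm.\<close>

lemma X_space_continuous_embedding:
  fixes p q c \<theta> :: real and \<alpha> :: "nat \<Rightarrow> real"
  assumes k: "k \<ge> 1" and p: "p \<ge> 1" and \<alpha>: "\<forall>j<k. \<alpha> j \<ge> \<alpha> k - real (k - j) * p"
    and b: "b = \<alpha> k - real k * p" "b \<ge> -1" and c: "c = \<alpha> 0 \<or> c > -1" "b \<le> c"
    and q: "p \<le> q" "(c + 1) * q \<le> (\<theta> + 1) * p" and \<theta>: "\<theta> \<le> \<alpha> 0"
  shows "continuous_embedding (X_space k p \<alpha>) (X_norm k p \<alpha>) (Lw q \<theta>) (Lw_norm q \<theta>)"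
proof -
  have c': "c = \<alpha> 0 \<or> c > -1 \<and> b \<le> c" using c by blast
  have b0: "b \<le> \<alpha> 0" using \<alpha>[rule_format, of 0] k by (simp add: b)
  obtain C where C: "C \<ge> 0" "\<And>u. u \<in> X_space k p \<alpha> \<Longrightarrow> \<exists>g w. borel_version u g \<and> primitive g w \<and>
    wint p (\<alpha> 0) {0<..} g \<le> ennreal (C * X_norm k p \<alpha> u powr p) \<and>
    wint p (b + p) {0<..} w \<le> ennreal (C * X_norm k p \<alpha> u powr p) \<and>
    wint p c {0<..1} g \<le> ennreal (C * X_norm k p \<alpha> u powr p)"
    using X_space_reduction[OF k p \<alpha> b c'] by blast
  obtain D where D: "D \<ge> 0" "\<And>g w M. \<lbrakk>primitive g w; M \<ge> 0; wint p (\<alpha> 0) {0<..} g \<le> ennreal M;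
    wint p (b + p) {0<..} w \<le> ennreal M; wint p c {0<..1} g \<le> ennreal M\<rbrakk> \<Longrightarrow>
    wint q \<theta> {0<..} g \<le> ennreal (D * M powr (q / p))"
    using wint_embedding[OF p q(1) b(2) c(2) b0 q(2) \<theta>] by blast
  have *: "u \<in> Lw q \<theta> \<and> Lw_norm q \<theta> u \<le> (D * C powr (q / p)) powr (1 / q) * X_norm k p \<alpha> u"
    if u: "u \<in> X_space k p \<alpha>" for u
  proof -
    let ?N = "X_norm k p \<alpha> u"
    obtain g w where g: "borel_version u g" "primitive g w" "wint p (\<alpha> 0) {0<..} g \<le> ennreal (C * ?N powr p)"
      "wint p (b + p) {0<..} w \<le> ennreal (C * ?N powr p)" "wint p c {0<..1} g \<le> ennreal (C * ?N powr p)"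
      using C(2)[OF u] by blast
    have le: "wint q \<theta> {0<..} g \<le> ennreal (D * (C * ?N powr p) powr (q / p))"
      by (rule D(2)[OF g(2) _ g(3-5)]) (use C(1) in auto)
    then have fin: "wint q \<theta> {0<..} g < \<infinity>" by (rule le_less_trans) simp
    have "enn2real (wint q \<theta> {0<..} g) \<le> D * (C * ?N powr p) powr (q / p)"
      using enn2real_mono[OF le] D(1) by simp
    also have "\<dots> = D * C powr (q / p) * ?N powr q"
      using C(1) p by (simp add: powr_mult powr_powr)
    finally have "Lw_norm q \<theta> u \<le> (D * C powr (q / p) * ?N powr q) powr (1 / q)"
      unfolding Lw_borel_version(2)[OF g(1)] using p q by (intro powr_mono2) auto
    also have "\<dots> = (D * C powr (q / p)) powr (1 / q) * ?N"
      using D(1) p q X_norm_nonneg[of k p \<alpha> u] by (simp add: powr_mult powr_powr)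
    finally show ?thesis using Lw_borel_version(1)[OF g(1)] fin by blast
  qed
  then show ?thesis unfolding continuous_embedding_def by blast
qed

text \<open>The parameters \<open>\<tau>\<close> and \<open>\<delta>\<close> of the decay at
  infinity stay free because the cases of the theorem choose them differently. The gap in the last
  hypothesis becomes the gain in the tail estimate.\<close>

lemma X_space_compact_embedding:
  fixes p q c \<theta> \<tau> \<delta> \<eta> :: real and \<alpha> :: "nat \<Rightarrow> real"
  assumes k: "k \<ge> 1" and p: "p \<ge> 1" and \<alpha>: "\<forall>j<k. \<alpha> j \<ge> \<alpha> k - real (k - j) * p"
    and b: "b = \<alpha> k - real k * p" "b \<ge> -1" and c: "c > -1" "b \<le> c"
    and q: "p \<le> q" "(c + 1) * q < (\<theta> + 1) * p" and \<theta>: "\<theta> \<le> \<alpha> 0"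
    and \<tau>: "\<tau> \<le> 1" "\<delta> \<le> \<alpha> 0 + \<tau>" "\<delta> \<le> b + p - \<tau> * (p - 1)"
    and \<eta>: "\<theta> - \<delta> * (q - p) / p < \<alpha> 0"
  shows "compact_embedding (X_space k p \<alpha>) (X_norm k p \<alpha>) (Lw q \<theta>) (Lw_norm q \<theta>)"
  unfolding compact_embedding_def
proof (intro conjI allI impI)
  show "continuous_embedding (X_space k p \<alpha>) (X_norm k p \<alpha>) (Lw q \<theta>) (Lw_norm q \<theta>)"
    by (rule X_space_continuous_embedding[OF k p \<alpha> b _ c(2) q(1) _ \<theta>]) (use c q in auto)
  fix u :: "nat \<Rightarrow> real \<Rightarrow> real"
  assume "(\<forall>n. u n \<in> X_space k p \<alpha>) \<and> (\<exists>M. \<forall>n. X_norm k p \<alpha> (u n) \<le> M)"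
  then obtain M where u: "\<And>n. u n \<in> X_space k p \<alpha>" and M: "\<And>n. X_norm k p \<alpha> (u n) \<le> M" by blast
  have c': "c = \<alpha> 0 \<or> c > -1 \<and> b \<le> c" using c by blast
  have b0: "b \<le> \<alpha> 0" using \<alpha>[rule_format, of 0] k by (simp add: b)
  obtain C where C: "C \<ge> 0" "\<And>u. u \<in> X_space k p \<alpha> \<Longrightarrow> \<exists>g w. borel_version u g \<and> primitive g w \<and>
    wint p (\<alpha> 0) {0<..} g \<le> ennreal (C * X_norm k p \<alpha> u powr p) \<and>
    wint p (b + p) {0<..} w \<le> ennreal (C * X_norm k p \<alpha> u powr p) \<and>
    wint p c {0<..1} g \<le> ennreal (C * X_norm k p \<alpha> u powr p)"
    using X_space_reduction[OF k p \<alpha> b c'] by blast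
  let ?K = "C * M powr p"
  have le: "ennreal (C * X_norm k p \<alpha> (u n) powr p) \<le> ennreal ?K" for n
    using C(1) M[of n] p X_norm_nonneg by (intro ennreal_leI mult_left_mono powr_mono2) auto
  have "\<exists>g w. borel_version (u n) g \<and> primitive g w \<and> wint p (\<alpha> 0) {0<..} g \<le> ennreal ?K \<and>
    wint p (b + p) {0<..} w \<le> ennreal ?K \<and> wint p c {0<..1} g \<le> ennreal ?K" for n
    using C(2)[OF u, of n] order_trans[OF _ le[of n]] by blast
  then obtain g w where g: "\<And>n. borel_version (u n) (g n)" "\<And>n. primitive (g n) (w n)"
    "\<And>n. wint p (\<alpha> 0) {0<..} (g n) \<le> ennreal ?K" "\<And>n. wint p (b + p) {0<..} (w n) \<le> ennreal ?K"
    "\<And>n. wint p c {0<..1} (g n) \<le> ennreal ?K" by metis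
  define \<eta> where "\<eta> = \<alpha> 0 - (\<theta> - \<delta> * (q - p) / p)"
  have "\<exists>s v. strict_mono (s :: nat \<Rightarrow> nat) \<and> v \<in> borel_measurable borel \<and> wint q \<theta> {0<..} v < \<infinity> \<and>
    (\<lambda>n. wint q \<theta> {0<..} (\<lambda>r. g (s n) r - v r)) \<longlonglongrightarrow> 0"
    by (rule wint_compactness[OF p q(1) b(2) c(2) b0 q(2) \<theta> \<tau> _ _ g(2) _ g(3-5), where \<eta> = \<eta>])
       (use \<eta> C(1) in \<open>auto simp: \<eta>_def\<close>)
  then obtain s v where s: "strict_mono (s :: nat \<Rightarrow> nat)" and v: "v \<in> borel_measurable borel" "wint q \<theta> {0<..} v < \<infinity>"
    and lim: "(\<lambda>n. wint q \<theta> {0<..} (\<lambda>r. g (s n) r - v r)) \<longlonglongrightarrow> 0" by blast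
  have "borel_version v v" using v by (simp add: borel_version_def)
  then have vL: "v \<in> Lw q \<theta>" using v Lw_borel_version(1) by blast
  have "borel_version (\<lambda>r. u n r - v r) (\<lambda>r. g n r - v r)" for n
    using g(1)[of n] v(1) unfolding borel_version_def by (auto elim!: eventually_mono)
  then have nrm: "Lw_norm q \<theta> (\<lambda>r. u (s n) r - v r) = enn2real (wint q \<theta> {0<..} (\<lambda>r. g (s n) r - v r)) powr (1 / q)" for n
    by (rule Lw_borel_version(2))
  have "(\<lambda>n. enn2real (wint q \<theta> {0<..} (\<lambda>r. g (s n) r - v r))) \<longlonglongrightarrow> 0"
    using tendsto_enn2real[where l = 0] lim by simp
  then have "(\<lambda>n. enn2real (wint q \<theta> {0<..} (\<lambda>r. g (s n) r - v r)) powr (1 / q)) \<longlonglongrightarrow> 0 powr (1 / q)"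
    using p q by (intro tendsto_powr' tendsto_const) auto
  then have "(\<lambda>n. Lw_norm q \<theta> (\<lambda>r. u (s n) r - v r)) \<longlonglongrightarrow> 0" by (simp add: nrm)
  with vL s show "\<exists>v\<in>Lw q \<theta>. \<exists>\<sigma>. strict_mono \<sigma> \<and> (\<lambda>n. Lw_norm q \<theta> (\<lambda>r. u (\<sigma> n) r - v r)) \<longlonglongrightarrow> 0"
    by blast
qed

(* Part (b) carries the hypothesis theta = -1 --> alpha_0 = -1. If theta = -1 < alpha_0, the
   inclusion fails for every q: any smooth function equal to 1 near 0 and to 0 for large r lies in X,
   although |u|^q / r is not integrable at 0. *)
theorem theorem1p1:
  fixes k :: nat and p \<theta> :: real and \<alpha> :: "nat \<Rightarrow> real"
  assumes "k \<ge> 1" and "p \<ge> 1"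
    and "\<forall>j<k. \<alpha> j \<ge> \<alpha> k - real (k - j) * p"
    and "\<alpha> k - real k * p \<le> \<theta>" and "\<theta> \<le> \<alpha> 0"
  shows
    "(\<alpha> k - real k * p + 1 > 0 \<longrightarrow>
       (let pstar = (\<theta> + 1) * p / (\<alpha> k - real k * p + 1) in
         (\<forall>q. p \<le> q \<and> q \<le> pstar \<longrightarrow>
            continuous_embedding (X_space k p \<alpha>) (X_norm k p \<alpha>) (Lw q \<theta>) (Lw_norm q \<theta>)) \<and>
         (\<forall>q. (\<theta> = \<alpha> 0 \<and> p < q \<and> q < pstar) \<or> (\<theta> < \<alpha> 0 \<and> p \<le> q \<and> q < pstar) \<longrightarrow>
            compact_embedding (X_space k p \<alpha>) (X_norm k p \<alpha>) (Lw q \<theta>) (Lw_norm q \<theta>))))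
     \<and>
     (\<alpha> k - real k * p + 1 = 0 \<and> (\<theta> = -1 \<longrightarrow> \<alpha> 0 = -1) \<longrightarrow>
         (\<forall>q. p \<le> q \<longrightarrow>
            continuous_embedding (X_space k p \<alpha>) (X_norm k p \<alpha>) (Lw q \<theta>) (Lw_norm q \<theta>)) \<and>
         (\<forall>q. (\<theta> = \<alpha> 0 \<and> q > p \<and> p > 1 \<and> \<alpha> 0 > -1) \<or> (\<theta> < \<alpha> 0 \<and> q \<ge> p \<and> p \<ge> 1) \<longrightarrow>
            compact_embedding (X_space k p \<alpha>) (X_norm k p \<alpha>) (Lw q \<theta>) (Lw_norm q \<theta>)))"
proof -
  define b where "b = \<alpha> k - real k * p"
  note A = assms(1-3) b_def
  have b0: "b \<le> \<alpha> 0" "b \<le> \<theta>" using assms by (auto simp: b_def)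
  \<comment> \<open>Part (a) takes \<open>c = b\<close>, which Hardy's inequality allows as
    \<open>b > -1\<close>.\<close>
  have a1: "continuous_embedding (X_space k p \<alpha>) (X_norm k p \<alpha>) (Lw q \<theta>) (Lw_norm q \<theta>)"
    if b: "b + 1 > 0" and q: "p \<le> q" "q \<le> (\<theta> + 1) * p / (b + 1)" for q
  proof (rule X_space_continuous_embedding[OF A])
    show "(b + 1) * q \<le> (\<theta> + 1) * p" using q(2) b by (simp add: field_simps)
  qed (use b q assms in auto)
  have a2: "compact_embedding (X_space k p \<alpha>) (X_norm k p \<alpha>) (Lw q \<theta>) (Lw_norm q \<theta>)"
    if b: "b + 1 > 0" and q: "p \<le> q" "q < (\<theta> + 1) * p / (b + 1)" "\<theta> < \<alpha> 0 \<or> p < q" for q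
  proof (rule X_space_compact_embedding[OF A])
    show "(b + 1) * q < (\<theta> + 1) * p" using q(2) b by (simp add: field_simps)
    \<comment> \<open>Here \<open>\<tau> = 1\<close> and \<open>\<delta> = b + 1 > 0\<close>; the
      decay makes \<open>p < q\<close> sufficient when \<open>\<theta> = \<alpha> 0\<close>.\<close>
    show "b + 1 \<le> \<alpha> 0 + 1" "b + 1 \<le> b + p - 1 * (p - 1)" using b0 by auto
    have "(b + 1) * (q - p) / p \<ge> 0" "p < q \<Longrightarrow> (b + 1) * (q - p) / p > 0" using b q(1) assms(2) by auto
    then show "\<theta> - (b + 1) * (q - p) / p < \<alpha> 0" using q(3) assms(5) by auto
  qed (use b q assms in auto)
  have ex: "\<exists>c>-1. b \<le> c \<and> (c + 1) * q < (\<theta> + 1) * p" if b: "b = -1" and "\<theta> > -1" "p \<le> q" for q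
  \<comment> \<open>\<open>c + 1\<close> is half of the value at which equality would hold.\<close>
  proof (intro exI[of _ "(\<theta> + 1) * p / (2 * q) - 1"] conjI)
    have q0: "q > 0" and pos: "(\<theta> + 1) * p > 0" using that assms(2) by auto
    then show "- 1 < (\<theta> + 1) * p / (2 * q) - 1" "b \<le> (\<theta> + 1) * p / (2 * q) - 1" using b by auto
    have "((\<theta> + 1) * p / (2 * q) - 1 + 1) * q = (\<theta> + 1) * p / 2" using q0 by simp
    then show "((\<theta> + 1) * p / (2 * q) - 1 + 1) * q < (\<theta> + 1) * p" using pos by linarith
  qed
  have b1: "continuous_embedding (X_space k p \<alpha>) (X_norm k p \<alpha>) (Lw q \<theta>) (Lw_norm q \<theta>)"
    if b: "b = -1" "\<theta> = -1 \<longrightarrow> \<alpha> 0 = -1" and q: "p \<le> q" for q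
  proof (cases "\<theta> = -1")
    \<comment> \<open>Then \<open>\<alpha> 0 = -1\<close>, the norm itself controls the weight
      \<open>c = -1\<close>, and both sides of the condition on \<open>q\<close> are 0.\<close>
    case True
    show ?thesis
      by (rule X_space_continuous_embedding[OF A, where c = "\<alpha> 0"]) (use True b q assms in auto)
  next
    case False
    then have "\<theta> > -1" using b b0 by auto
    from ex[OF b(1) this q] obtain c where c: "c > -1" "b \<le> c" "(c + 1) * q < (\<theta> + 1) * p" by blast
    show ?thesis
      by (rule X_space_continuous_embedding[OF A _ _ c(2) q _ assms(5)]) (use c b in auto)
  qed
  have b2: "compact_embedding (X_space k p \<alpha>) (X_norm k p \<alpha>) (Lw q \<theta>) (Lw_norm q \<theta>)"
    if b: "b = -1" "\<theta> > -1" and q: "p \<le> q" "\<theta> < \<alpha> 0 \<or> p < q \<and> p > 1" for q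
  proof -
    from ex[OF b q(1)] obtain c where c: "c > -1" "b \<le> c" "(c + 1) * q < (\<theta> + 1) * p" by blast
    have a0: "\<alpha> 0 > -1" using b assms(5) by simp
    show ?thesis
    proof (cases "\<theta> < \<alpha> 0")
      \<comment> \<open>For \<open>b = -1\<close> and \<open>\<tau> = 1\<close> there is no decay;
        the gap between \<open>\<theta>\<close> and \<open>\<alpha> 0\<close> alone makes the tails
        small.\<close>
      case True
      show ?thesis
        by (rule X_space_compact_embedding[OF A _ c(1,2) q(1) c(3) assms(5), where \<tau> = 1 and \<delta> = 0])
           (use True b a0 in auto)
    next
      case False
      \<comment> \<open>Needed are \<open>\<tau> < 1\<close> and
        \<open>\<alpha> 0 + \<tau> > 0\<close>; \<open>\<tau>\<close> is the midpoint between
        \<open>- min 1 (\<alpha> 0)\<close> and 1.\<close>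
      define \<tau> where "\<tau> = (1 - min 1 (\<alpha> 0)) / 2"
      \<comment> \<open>The smaller of the two upper limits for the decay exponent, since
        \<open>b + p - \<tau> * (p - 1) = (1 - \<tau>) * (p - 1)\<close> for \<open>b = -1\<close>;
        it is positive because \<open>p > 1\<close>.\<close>
      define \<delta> where "\<delta> = min (\<alpha> 0 + \<tau>) ((1 - \<tau>) * (p - 1))"
      have \<tau>: "\<tau> < 1" "\<alpha> 0 + \<tau> > 0" using a0 by (auto simp: \<tau>_def min_def field_simps)
      have p1: "p > 1" "p < q" using False q by auto
      then have "\<delta> > 0" using \<tau> by (simp add: \<delta>_def)
      then have "\<delta> * (q - p) / p > 0" using p1 by simp
      then have \<eta>: "\<theta> - \<delta> * (q - p) / p < \<alpha> 0" using assms(5) by linarith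
      show ?thesis
        by (rule X_space_compact_embedding[OF A _ c(1,2) q(1) c(3) assms(5) _ _ _ \<eta>, where \<tau> = \<tau>])
           (use \<tau> b in \<open>auto simp: \<delta>_def algebra_simps\<close>)
    qed
  qed
  show ?thesis
  proof (intro conjI impI)
    assume "\<alpha> k - real k * p + 1 > 0"
    then show "let pstar = (\<theta> + 1) * p / (\<alpha> k - real k * p + 1) in
         (\<forall>q. p \<le> q \<and> q \<le> pstar \<longrightarrow>
            continuous_embedding (X_space k p \<alpha>) (X_norm k p \<alpha>) (Lw q \<theta>) (Lw_norm q \<theta>)) \<and>
         (\<forall>q. (\<theta> = \<alpha> 0 \<and> p < q \<and> q < pstar) \<or> (\<theta> < \<alpha> 0 \<and> p \<le> q \<and> q < pstar) \<longrightarrow>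
            compact_embedding (X_space k p \<alpha>) (X_norm k p \<alpha>) (Lw q \<theta>) (Lw_norm q \<theta>))"
      unfolding Let_def b_def[symmetric] using a1 a2 by auto
  next
    assume h: "\<alpha> k - real k * p + 1 = 0 \<and> (\<theta> = -1 \<longrightarrow> \<alpha> 0 = -1)"
    then have b: "b = -1" by (simp add: b_def)
    show "\<forall>q. p \<le> q \<longrightarrow>
            continuous_embedding (X_space k p \<alpha>) (X_norm k p \<alpha>) (Lw q \<theta>) (Lw_norm q \<theta>)"
      using b1 b h by blast
    \<comment> \<open>For \<open>\<theta> = -1\<close> the hypothesis would give
      \<open>\<alpha> 0 = -1\<close>, which contradicts both alternatives.\<close>
    have "\<theta> > -1" if "\<theta> < \<alpha> 0 \<or> \<alpha> 0 > -1"
      using that h b b0(2) by (cases "\<theta> = -1") auto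
    then show "\<forall>q. (\<theta> = \<alpha> 0 \<and> q > p \<and> p > 1 \<and> \<alpha> 0 > -1) \<or> (\<theta> < \<alpha> 0 \<and> q \<ge> p \<and> p \<ge> 1) \<longrightarrow>
            compact_embedding (X_space k p \<alpha>) (X_norm k p \<alpha>) (Lw q \<theta>) (Lw_norm q \<theta>)"
      using b2[OF b] by force
  qed
qed

end
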